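(* Let $X\subset \mathbb{P}(W)$ be a locally closed subvariety with $\langle X\rangle=\mathbb{P}(W)$, let $X_0\subset X$ be its smooth locus, let $M$ be a matrix of linear forms on $W$, and let $k$ be an integer such that $X\subset\{\operatorname{rk} M\leqslant k\}$. Then for every positive integer $r$ $$\mathfrak{K}_r(X_0)\subset \{\operatorname{rk} M\leqslant k\cdot r\}.$$ In particular, if $g$ is an integer such that $\mathfrak{K}_g(X_0)=\mathbb{P}(W)$, then linear rank methods never provide a better lower bound on $X$-border rank than $g$; that is, for every matrix $M$ of linear forms on $W$, every integer $k\geqslant 1$ with $X\subset\{\operatorname{rk} M\leqslant k\}$, and every $F\in W$, the lower bound $\frac{\operatorname{rk} M(F)}{k}$ for the $X$-border rank of $F$ satisfies $\frac{\operatorname{rk} M(F)}{k}\leqslant g$.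
   Context: $\Bbbk$ is an algebraically closed field of any characteristic, $W$ is a finite-dimensional $\Bbbk$-vector space, and $\mathbb{P}(W)=(W\setminus\{0\})/\Bbbk^*$ with the Zariski topology. Subvarieties are reduced, not necessarily irreducible. For a subset or subscheme $R\subset\mathbb{P}(W)$, $\langle R\rangle$ denotes its projective linear span: the smallest projective linear subspace containing $R$ (scheme-theoretically, if $R$ is a scheme), i.e. the zero locus of all linear forms vanishing on $R$. A matrix $M$ of linear forms on $W$ is a matrix with entries in $W^*$; for $w\in W$, $M(w)$ is the matrix over $\Bbbk$ obtained by evaluating all entries at $w$. The rank locus $\{\operatorname{rk} M\leqslant k\}\subset\mathbb{P}(W)$ is the closed set of those $[w]$ with $\operatorname{rk} M(w)\leqslant k$. For a locally closed $Y\subset\mathbb{P}(W)$ and a positive integer $r$, the $r$-th cactus variety is $$\mathfrak{K}_r(Y):=\overline{\bigcup\{\langle R\rangle \mid R \text{ is a finite subscheme of } Y \text{ of degree } r\}}\subset\mathbb{P}(W).$$ The $r$-th secant variety is $\sigma_r(X):=\overline{\bigcup\{\langle x_1,\dots,x_r\rangle\mid x_i\in X\}}$, and the $X$-border rank of a nonzero $F\in W$ is the least $r$ with $[F]\in\sigma_r(X)$ (it is $0$ for $F=0$). The linear rank method is: if $X\subset\{\operatorname{rk} M\leqslant k\}$ with $k\geqslant1$, then the $X$-border rank of every $F\in W$ is at least $\frac{\operatorname{rk} M(F)}{k}$. *)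

theory Defs
  imports
    "HOL-Analysis.Abstract_Topology"
    "HOL-Library.Function_Algebras"
    "HOL-Computational_Algebra.Polynomial"
    "Jordan_Normal_Form.DL_Rank"
begin

text \<open>
  Throughout, \<open>s\<close> is the scalar multiplication of a finite-dimensional vector space \<open>W\<close> (the type
  \<open>'w\<close>) over an algebraically closed field \<open>\<k>\<close> (the type \<open>'a\<close>).
\<close>

subsection \<open>The homogeneous coordinate ring\<close>

text \<open>
  An algebraically closed field is infinite, so the symmetric algebra of \<open>W\<^sup>*\<close> is the ring of
  polynomial functions on \<open>W\<close>; we work inside the ring \<open>'w \<Rightarrow> 'a\<close> with pointwise operations.
\<close>

abbreviation fscale :: "'a::field \<Rightarrow> ('w \<Rightarrow> 'a) \<Rightarrow> ('w \<Rightarrow> 'a)" where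
  "fscale c f \<equiv> (\<lambda>w. c * f w)"

definition dual :: "('a::field \<Rightarrow> 'w::ab_group_add \<Rightarrow> 'w) \<Rightarrow> ('w \<Rightarrow> 'a) set" where
  "dual s = {l. Vector_Spaces.linear s (*) l}"

definition forms :: "('a::field \<Rightarrow> 'w::ab_group_add \<Rightarrow> 'w) \<Rightarrow> nat \<Rightarrow> ('w \<Rightarrow> 'a) set" where
  "forms s d = Modules.module.span fscale {\<lambda>w. \<Prod>i<d. l i w | l. \<forall>i<d. l i \<in> dual s}"

definition homog :: "('a::field \<Rightarrow> 'w::ab_group_add \<Rightarrow> 'w) \<Rightarrow> ('w \<Rightarrow> 'a) set" where
  "homog s = (\<Union>d. forms s d)"

definition polys :: "('a::field \<Rightarrow> 'w::ab_group_add \<Rightarrow> 'w) \<Rightarrow> ('w \<Rightarrow> 'a) set" where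
  "polys s = Modules.module.span fscale (homog s)"

subsection \<open>Projective space and its Zariski topology\<close>

text \<open>A point of \<open>\<P>(W)\<close> is the class \<open>{c w | c \<noteq> 0}\<close> of a nonzero vector \<open>w\<close>.\<close>

definition proj_space :: "('a::field \<Rightarrow> 'w::ab_group_add \<Rightarrow> 'w) \<Rightarrow> 'w set set" where
  "proj_space s = (UNIV - {0}) // {(v, w). \<exists>c. c \<noteq> 0 \<and> w = s c v}"

definition zero_locus ::
    "('a::field \<Rightarrow> 'w::ab_group_add \<Rightarrow> 'w) \<Rightarrow> ('w \<Rightarrow> 'a) set \<Rightarrow> 'w set set" where
  "zero_locus s F = {p \<in> proj_space s. \<forall>f\<in>F. \<forall>w\<in>p. f w = 0}"

definition zariski :: "('a::field \<Rightarrow> 'w::ab_group_add \<Rightarrow> 'w) \<Rightarrow> 'w set topology" where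
  "zariski s = topology (\<lambda>U. \<exists>F \<subseteq> homog s. U = proj_space s - zero_locus s F)"

definition locally_closed ::
    "('a::field \<Rightarrow> 'w::ab_group_add \<Rightarrow> 'w) \<Rightarrow> 'w set set \<Rightarrow> bool" where
  "locally_closed s X \<longleftrightarrow> (\<exists>U Z. openin (zariski s) U \<and> closedin (zariski s) Z \<and> X = U \<inter> Z)"

definition vanishing_ideal ::
    "('a::field \<Rightarrow> 'w::ab_group_add \<Rightarrow> 'w) \<Rightarrow> 'w set set \<Rightarrow> ('w \<Rightarrow> 'a) set" where
  "vanishing_ideal s X = {f \<in> polys s. \<forall>p\<in>X. \<forall>w\<in>p. f w = 0}"

subsection \<open>Closed subschemes, linear spans and cactus varieties\<close>

definition homogeneous_ideal ::
    "('a::field \<Rightarrow> 'w::ab_group_add \<Rightarrow> 'w) \<Rightarrow> ('w \<Rightarrow> 'a) set \<Rightarrow> bool" where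
  "homogeneous_ideal s I \<longleftrightarrow>
     I \<subseteq> polys s \<and> 0 \<in> I \<and> (\<forall>f\<in>I. \<forall>g\<in>I. f + g \<in> I) \<and> (\<forall>f\<in>polys s. \<forall>g\<in>I. f * g \<in> I) \<and>
     I \<subseteq> Modules.module.span fscale (I \<inter> homog s)"

text \<open>Saturated with respect to the irrelevant ideal, whose \<open>N\<close>-th power is generated by the forms
  of degree \<open>N\<close>.\<close>

definition saturated ::
    "('a::field \<Rightarrow> 'w::ab_group_add \<Rightarrow> 'w) \<Rightarrow> ('w \<Rightarrow> 'a) set \<Rightarrow> bool" where
  "saturated s I \<longleftrightarrow> (\<forall>f\<in>polys s. (\<exists>N. \<forall>g\<in>forms s N. g * f \<in> I) \<longrightarrow> f \<in> I)"

text \<open>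
  Closed subschemes of \<open>\<P>(W)\<close> are encoded by their saturated homogeneous ideals. Let \<open>Y\<close> be locally
  closed, with its reduced structure. A finite subscheme \<open>R\<close> of \<open>Y\<close> is proper over \<open>\<k>\<close>, hence a
  closed subscheme of \<open>\<P>(W)\<close>; a closed subscheme of \<open>\<P>(W)\<close> is a subscheme of \<open>Y\<close> iff its ideal
  contains that of the closure of \<open>Y\<close> and its support lies in \<open>Y\<close>. It is finite of degree \<open>r\<close>
  iff its Hilbert polynomial is the constant \<open>r\<close>.
\<close>

definition finite_subscheme ::
    "('a::field \<Rightarrow> 'w::ab_group_add \<Rightarrow> 'w) \<Rightarrow> nat \<Rightarrow> 'w set set \<Rightarrow> ('w \<Rightarrow> 'a) set \<Rightarrow> bool" where
  "finite_subscheme s r Y I \<longleftrightarrow>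
     homogeneous_ideal s I \<and> saturated s I \<and>
     vanishing_ideal s Y \<subseteq> I \<and> zero_locus s I \<subseteq> Y \<and>
     (\<exists>N. \<forall>d\<ge>N. Vector_Spaces.vector_space.dim fscale (forms s d) =
                 Vector_Spaces.vector_space.dim fscale (I \<inter> forms s d) + r)"

text \<open>The span of the scheme with ideal \<open>I\<close>; the span of a subset \<open>X\<close> is obtained for
  \<open>I = vanishing_ideal s X\<close>.\<close>

definition linear_span ::
    "('a::field \<Rightarrow> 'w::ab_group_add \<Rightarrow> 'w) \<Rightarrow> ('w \<Rightarrow> 'a) set \<Rightarrow> 'w set set" where
  "linear_span s I = zero_locus s (I \<inter> dual s)"

definition cactus_variety ::
    "('a::field \<Rightarrow> 'w::ab_group_add \<Rightarrow> 'w) \<Rightarrow> nat \<Rightarrow> 'w set set \<Rightarrow> 'w set set" where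
  "cactus_variety s r Y =
     zariski s closure_of (\<Union>{linear_span s I | I. finite_subscheme s r Y I})"

subsection \<open>The smooth locus\<close>

text \<open>\<open>f (w + t v)\<close> is a polynomial in \<open>t\<close>, unique because the field is infinite; its linear
  coefficient is the value at \<open>v\<close> of the differential of \<open>f\<close> at \<open>w\<close>.\<close>

definition differential ::
    "('a::field \<Rightarrow> 'w::ab_group_add \<Rightarrow> 'w) \<Rightarrow> ('w \<Rightarrow> 'a) \<Rightarrow> 'w \<Rightarrow> 'w \<Rightarrow> 'a" where
  "differential s f w v = coeff (THE q. \<forall>t. poly q t = f (w + s t v)) 1"

text \<open>
  Smoothness over \<open>\<k>\<close> at \<open>p\<close>, as in the definition of a smooth morphism by Mumford (The Red Book,
  III.10) or Bosch-Luetkebohmert-Raynaud (Neron Models, 2.2): in a neighbourhood of \<open>p\<close>, here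
  \<open>h \<noteq> 0\<close>, the ideal of \<open>X\<close> is generated by equations \<open>f 0, \<dots>, f (c - 1)\<close> whose differentials at
  \<open>p\<close> are linearly independent. No dimension of \<open>X\<close> is prescribed, so different components of \<open>X\<close>
  may have different dimensions. By Euler's formula the differential at \<open>w\<close> of a form vanishing
  at \<open>w\<close> kills \<open>w\<close>, so independence on \<open>W\<close> is independence on the tangent space
  \<open>W/\<langle>w\<rangle>\<close> of \<open>\<P>(W)\<close>.
\<close>

definition smooth_at ::
    "('a::field \<Rightarrow> 'w::ab_group_add \<Rightarrow> 'w) \<Rightarrow> 'w set set \<Rightarrow> 'w set \<Rightarrow> bool" where
  "smooth_at s X p \<longleftrightarrow>
     (\<exists>(c::nat) f. \<exists>h\<in>homog s.
        (\<forall>i<c. f i \<in> vanishing_ideal s X \<inter> homog s) \<and>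
        (\<forall>w\<in>p. h w \<noteq> 0) \<and>
        (\<forall>g\<in>vanishing_ideal s X. \<exists>a. (\<forall>i<c. a i \<in> polys s) \<and> h * g = (\<Sum>i<c. a i * f i)) \<and>
        (\<forall>w\<in>p. \<forall>b. (\<forall>v. (\<Sum>i<c. b i * differential s (f i) w v) = 0) \<longrightarrow> (\<forall>i<c. b i = 0)))"

definition smooth_locus ::
    "('a::field \<Rightarrow> 'w::ab_group_add \<Rightarrow> 'w) \<Rightarrow> 'w set set \<Rightarrow> 'w set set" where
  "smooth_locus s X = {p \<in> X. smooth_at s X p}"

subsection \<open>Matrices of linear forms\<close>

definition linear_form_matrix ::
    "('a::field \<Rightarrow> 'w::ab_group_add \<Rightarrow> 'w) \<Rightarrow> ('w \<Rightarrow> 'a) mat \<Rightarrow> bool" where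
  "linear_form_matrix s M \<longleftrightarrow> elements_mat M \<subseteq> dual s"

definition rank_at :: "('w \<Rightarrow> 'a::field) mat \<Rightarrow> 'w \<Rightarrow> nat" where
  "rank_at M w = vec_space.rank (dim_row M) (map_mat (\<lambda>l. l w) M)"

definition rank_locus ::
    "('a::field \<Rightarrow> 'w::ab_group_add \<Rightarrow> 'w) \<Rightarrow> ('w \<Rightarrow> 'a) mat \<Rightarrow> int \<Rightarrow> 'w set set" where
  "rank_locus s M k = {p \<in> proj_space s. \<forall>w\<in>p. int (rank_at M w) \<le> k}"

subsection \<open>The Zariski topology is a topology\<close>

lemma module_fscale: "Modules.module (fscale :: 'a::field \<Rightarrow> ('w \<Rightarrow> 'a) \<Rightarrow> _)"
  by unfold_locales (auto simp: algebra_simps fun_eq_iff)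

lemma forms_scale:
  fixes s :: "'a::field \<Rightarrow> 'w::ab_group_add \<Rightarrow> 'w"
  assumes "f \<in> forms s d"
  shows "f (s c w) = c ^ d * f w"
proof -
  interpret F: Modules.module "fscale :: 'a \<Rightarrow> ('w \<Rightarrow> 'a) \<Rightarrow> _" by (rule module_fscale)
  have lin: "l (s c w) = c * l w" if "l \<in> dual s" for l
    using that Modules.module_hom.scale[OF Vector_Spaces.linear.axioms(3)]
    unfolding dual_def by blast
  show ?thesis
    using assms unfolding forms_def
  proof (induction rule: F.span_induct_alt)
    case base
    then show ?case by simp
  next
    case (step c' x y)
    then obtain l where l: "\<forall>i<d. l i \<in> dual s" "x = (\<lambda>w. \<Prod>i<d. l i w)" by blast
    have "x (s c w) = (\<Prod>i<d. c * l i w)"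
      unfolding l(2) using l(1) by (intro prod.cong refl) (simp add: lin)
    then have "x (s c w) = c ^ d * x w" by (simp add: prod.distrib l(2))
    then show ?case using step(2) by (simp add: algebra_simps)
  qed
qed

lemma forms_mult:
  fixes s :: "'a::field \<Rightarrow> 'w::ab_group_add \<Rightarrow> 'w"
  assumes "f \<in> forms s d" "g \<in> forms s e"
  shows "f * g \<in> forms s (d + e)"
proof -
  interpret F: Modules.module "fscale :: 'a \<Rightarrow> ('w \<Rightarrow> 'a) \<Rightarrow> _" by (rule module_fscale)
  have gen: "(\<lambda>w. \<Prod>i<d. l i w) * (\<lambda>w. \<Prod>i<e. m i w) \<in> forms s (d + e)"
    if "\<forall>i<d. l i \<in> dual s" "\<forall>i<e. m i \<in> dual s" for l m
  proof -
    let ?n = "\<lambda>i. if i < d then l i else m (i - d)"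
    have split: "{..<d + e} = {..<d} \<union> (\<lambda>i. d + i) ` {..<e}"
    proof (intro equalityI subsetI)
      fix i assume "i \<in> {..<d + e}"
      then show "i \<in> {..<d} \<union> (\<lambda>i. d + i) ` {..<e}"
        by (cases "i < d") (auto intro!: image_eqI[of _ _ "i - d"])
    qed auto
    have "(\<Prod>i<d + e. ?n i w) = (\<Prod>i<d. l i w) * (\<Prod>i<e. m i w)" for w
      unfolding split by (subst prod.union_disjoint) (auto simp: prod.reindex inj_on_def)
    then have "(\<lambda>w. \<Prod>i<d. l i w) * (\<lambda>w. \<Prod>i<e. m i w) = (\<lambda>w. \<Prod>i<d + e. ?n i w)"
      by (simp add: fun_eq_iff)
    moreover have "\<forall>i<d + e. ?n i \<in> dual s" using that by auto
    ultimately show ?thesis unfolding forms_def by (intro F.span_base CollectI exI[of _ ?n]) simp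
  qed
  have *: "(\<lambda>w. \<Prod>i<d. l i w) * g \<in> forms s (d + e)" if l: "\<forall>i<d. l i \<in> dual s" for l
    using assms(2) unfolding forms_def[of s e]
  proof (induction rule: F.span_induct_alt)
    case base
    show ?case using F.span_zero by (simp add: forms_def zero_fun_def times_fun_def)
  next
    case (step c x y)
    let ?L = "\<lambda>w. \<Prod>i<d. l i w"
    have "?L * (fscale c x + y) = fscale c (?L * x) + ?L * y"
      by (simp add: fun_eq_iff algebra_simps)
    moreover have "?L * x \<in> forms s (d + e)" using step(1) gen[OF l] by auto
    ultimately show ?case using step(2) unfolding forms_def
      by (simp only: F.span_add F.span_scale)
  qed
  show ?thesis
    using assms(1) unfolding forms_def[of s d]
  proof (induction rule: F.span_induct_alt)
    case base
    show ?case using F.span_zero by (simp add: forms_def zero_fun_def times_fun_def)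
  next
    case (step c x y)
    have "(fscale c x + y) * g = fscale c (x * g) + y * g"
      by (simp add: fun_eq_iff algebra_simps)
    moreover have "x * g \<in> forms s (d + e)" using step(1) * by auto
    ultimately show ?case using step(2) unfolding forms_def
      by (simp only: F.span_add F.span_scale)
  qed
qed

lemma homog_vanish:
  assumes "f \<in> homog s" "p \<in> proj_space s" "v \<in> p" "w \<in> p" "f v = 0"
  shows "f w = 0"
proof -
  obtain u c c' where "c \<noteq> 0" "c' \<noteq> 0" "v = s c u" "w = s c' u"
    using assms(2-4) unfolding proj_space_def quotient_def by auto
  moreover obtain d where "f \<in> forms s d" using assms(1) unfolding homog_def by blast
  ultimately show ?thesis
    using assms(5) by (simp add: forms_scale)
qed

lemma zero_locus_Un:
  assumes "F \<subseteq> homog s" "G \<subseteq> homog s"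
  shows "zero_locus s F \<union> zero_locus s G = zero_locus s {f * g | f g. f \<in> F \<and> g \<in> G}"
proof (intro equalityI subsetI)
  fix p assume p: "p \<in> zero_locus s {f * g | f g. f \<in> F \<and> g \<in> G}"
  show "p \<in> zero_locus s F \<union> zero_locus s G"
  proof (rule ccontr)
    assume "\<not> ?thesis"
    with p obtain f g v w where
      "f \<in> F" "g \<in> G" "v \<in> p" "w \<in> p" "f v \<noteq> 0" "g w \<noteq> 0" "p \<in> proj_space s"
      by (auto simp: zero_locus_def)
    moreover from this have "f w \<noteq> 0" using homog_vanish assms by blast
    moreover have "(f * g) w = 0" using p calculation unfolding zero_locus_def by blast
    ultimately show False by simp
  qed
qed (auto simp: zero_locus_def)

lemma openin_zariski:
  "openin (zariski s) U \<longleftrightarrow> (\<exists>F \<subseteq> homog s. U = proj_space s - zero_locus s F)"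
proof -
  have "istopology (\<lambda>U. \<exists>F \<subseteq> homog s. U = proj_space s - zero_locus s F)"
    unfolding istopology_def
  proof (intro conjI allI impI)
    fix U V
    assume "\<exists>F \<subseteq> homog s. U = proj_space s - zero_locus s F"
      and "\<exists>F \<subseteq> homog s. V = proj_space s - zero_locus s F"
    then obtain F G where F: "F \<subseteq> homog s" "U = proj_space s - zero_locus s F"
      and G: "G \<subseteq> homog s" "V = proj_space s - zero_locus s G" by blast
    let ?H = "{f * g | f g. f \<in> F \<and> g \<in> G}"
    have "?H \<subseteq> homog s"
    proof
      fix h assume "h \<in> ?H"
      then obtain f g where h: "h = f * g" "f \<in> homog s" "g \<in> homog s" using F(1) G(1) by blast
      then obtain d e where "f \<in> forms s d" "g \<in> forms s e" unfolding homog_def by blast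
      then have "h \<in> forms s (d + e)" using forms_mult h(1) by simp
      then show "h \<in> homog s" unfolding homog_def by blast
    qed
    moreover have "U \<inter> V = proj_space s - zero_locus s ?H"
      using F(2) G(2) zero_locus_Un[OF F(1) G(1)] by auto
    ultimately show "\<exists>F \<subseteq> homog s. U \<inter> V = proj_space s - zero_locus s F" by blast
  next
    fix K
    assume K: "\<forall>U\<in>K. \<exists>F \<subseteq> homog s. U = proj_space s - zero_locus s F"
    have "\<forall>U\<in>K. \<exists>F. F \<subseteq> homog s \<and> proj_space s - zero_locus s F = U"
    proof
      fix U assume "U \<in> K"
      from bspec[OF K this] show "\<exists>F. F \<subseteq> homog s \<and> proj_space s - zero_locus s F = U"
        by (elim exE conjE) (intro exI conjI, assumption, rule sym)
    qed
    then obtain F where F: "\<forall>U\<in>K. F U \<subseteq> homog s \<and> proj_space s - zero_locus s (F U) = U"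
      by (rule bchoice[THEN exE])
    have "\<Union>K = proj_space s - zero_locus s (\<Union>(F ` K))"
    proof (intro equalityI subsetI)
      fix p assume "p \<in> \<Union>K"
      then obtain U where "U \<in> K" "p \<in> U" by blast
      then show "p \<in> proj_space s - zero_locus s (\<Union>(F ` K))"
        using bspec[OF F, of U] unfolding zero_locus_def by blast
    next
      fix p assume "p \<in> proj_space s - zero_locus s (\<Union>(F ` K))"
      then obtain U where "U \<in> K" "p \<in> proj_space s - zero_locus s (F U)"
        by (auto simp: zero_locus_def)
      then show "p \<in> \<Union>K" using F by blast
    qed
    then show "\<exists>F \<subseteq> homog s. \<Union>K = proj_space s - zero_locus s F"
      using F by (intro exI[of _ "\<Union>(F ` K)"]) blast
  qed
  then show ?thesis unfolding zariski_def by simp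
qed

end

theory Submission
  imports Defs
begin

text \<open>
  Rank bounds are tested on the \<open>k r + 1\<close> minors, so it suffices to bound
  \<open>rk M(v)\<close> for \<open>v\<close> in the span of one finite scheme \<open>R\<close>. McCoy's theorem gives a linear
  form \<open>l\<close> that is not a zero divisor on the coordinate ring of \<open>R\<close>; setting \<open>l = 1\<close> turns
  \<open>R\<close> into an ideal \<open>J\<close> of codimension at most \<open>r\<close> in the polynomial ring of \<open>W\<close>, and \<open>v\<close> into
  a functional \<open>\<phi>\<close> that kills \<open>J\<close>, with \<open>M(v) = \<phi>(M)\<close>. Codimension and rank are additive over
  the points of \<open>J\<close>, so \<open>J\<close> may be supported at one smooth point \<open>p\<close>.

  Newton's method provides, for \<open>q\<close> on the cone over \<open>X\<close> near \<open>p\<close>, polynomial maps \<open>\<theta> q\<close> that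
  translate \<open>p\<close> to \<open>q\<close>, respect the equations of \<open>X\<close> modulo \<open>J\<close>, depend rationally on \<open>q\<close>, and
  are the identity modulo \<open>J\<close> for \<open>q = p\<close>. Let \<open>t \<le> k\<close> be the largest rank that \<open>M\<close> takes
  arbitrarily close to \<open>p\<close>. Where it is attained, a \<open>t\<close>-minor of \<open>M \<circ> \<theta> q\<close> is a unit modulo \<open>J\<close>
  and all larger minors vanish, hence \<open>M \<circ> \<theta> q\<close> factors through rank \<open>t\<close> modulo \<open>J\<close> and
  \<open>\<phi>(M \<circ> \<theta> q)\<close> has rank at most \<open>t r\<close>. Such \<open>q\<close> accumulate at \<open>p\<close>, and the rank is lower
  semicontinuous, so \<open>\<phi>(M)\<close> has rank at most \<open>k r\<close>. No smoothability of \<open>R\<close> is needed.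
\<close>

text \<open>Vanishing of all larger minors modulo \<open>J\<close> does not by itself bound the rank
  after a functional is applied: a matrix whose entries are nilpotents with pairwise zero products
  has no nonzero 2-minors, yet it may need many factors. A minor that is a unit modulo
  \<open>J\<close> is what turns vanishing bordered minors into a factorization over the ring, and
  at \<open>p\<close> itself the rank of \<open>M\<close> may be too small to provide one. This
  forces the detour through nearby points \<open>q\<close>: smoothness lets the whole scheme,
  nilpotents included, be carried along \<open>X\<close> to \<open>q\<close>, where the rank is
  locally maximal. The product \<open>k r\<close> is then a count of pairs: \<open>t \<le> k\<close>
  inner indices of the factorization times at most \<open>r\<close> elements spanning the polynomial
  ring modulo \<open>J\<close>. The functional comes from duality: a vector lies in the span of
  \<open>R\<close> iff evaluation at it kills the linear forms in the ideal of \<open>R\<close>, and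
  such an evaluation extends to a functional that kills \<open>J\<close>.\<close>

section \<open>Minors and matrix rank\<close>

definition minor :: "(nat \<Rightarrow> nat \<Rightarrow> 'b::comm_ring_1) \<Rightarrow> nat \<Rightarrow> (nat \<Rightarrow> nat) \<Rightarrow> (nat \<Rightarrow> nat) \<Rightarrow> 'b" where
  "minor A t \<rho> \<kappa> = det (mat t t (\<lambda>(a, b). A (\<rho> a) (\<kappa> b)))"

lemma minor_cong:
  assumes "\<And>a b. a < t \<Longrightarrow> b < t \<Longrightarrow> A (\<rho> a) (\<kappa> b) = A' (\<rho>' a) (\<kappa>' b)"
  shows "minor A t \<rho> \<kappa> = minor A' t \<rho>' \<kappa>'"
  unfolding minor_def by (rule arg_cong[of _ _ det]) (auto intro!: eq_matI simp: assms)

lemma minor_0 [simp]: "minor A 0 \<rho> \<kappa> = 1"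
  unfolding minor_def by (simp add: det_dim_zero)

text \<open>Laplace expansion along the last column. Deleting row \<open>a\<close> is absorbed into
  the row selection, so the recursion stays among minors of the same \<open>A\<close> and inductions
  on \<open>t\<close> need only generalise \<open>\<rho>\<close>.\<close>

lemma minor_Suc:
  "minor A (Suc t) \<rho> \<kappa> =
     (\<Sum>a<Suc t. A (\<rho> a) (\<kappa> t) * ((-1) ^ (a + t) * minor A t (\<lambda>x. \<rho> (if x < a then x else Suc x)) \<kappa>))"
proof -
  let ?B = "mat (Suc t) (Suc t) (\<lambda>(a, b). A (\<rho> a) (\<kappa> b))"
  have "cofactor ?B a t = (-1) ^ (a + t) * minor A t (\<lambda>x. \<rho> (if x < a then x else Suc x)) \<kappa>"
    if "a < Suc t" for a
  proof -
    have "mat_delete ?B a t = mat t t (\<lambda>(x, b). A (\<rho> (if x < a then x else Suc x)) (\<kappa> b))"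
      by (rule eq_matI) (auto simp: mat_delete_def)
    then show ?thesis by (simp add: cofactor_def minor_def)
  qed
  then show ?thesis
    unfolding minor_def[of A "Suc t"]
    by (subst laplace_expansion_column[of _ "Suc t" t]) (auto intro!: sum.cong)
qed

text \<open>The cofactors of the new column depend on \<open>i\<close> but not on \<open>j\<close>.
  Once the bordered minors vanish and the central one is invertible, row \<open>i\<close> of
  \<open>A\<close> is therefore a combination of the \<open>t\<close> rows \<open>\<rho> a\<close>:
  a factorization of length \<open>t\<close>. Selections are arbitrary functions, so
  \<open>i\<close> and \<open>j\<close> may repeat earlier indices without case
  distinctions.\<close>

lemma minor_bordered:
  "minor A (Suc t) (\<rho>(t := i)) (\<kappa>(t := j)) =
     A i j * minor A t \<rho> \<kappa> +
     (\<Sum>a<t. A (\<rho> a) j * ((-1) ^ (a + t) * minor A t (\<lambda>x. (\<rho>(t := i)) (if x < a then x else Suc x)) \<kappa>))"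
proof -
  have 1: "minor A t (\<lambda>x. (\<rho>(t := i)) (if x < t then x else Suc x)) \<kappa> = minor A t \<rho> \<kappa>"
    by (rule minor_cong) auto
  have 2: "minor A t (\<lambda>x. (\<rho>(t := i)) (if x < a then x else Suc x)) (\<kappa>(t := j)) =
      minor A t (\<lambda>x. (\<rho>(t := i)) (if x < a then x else Suc x)) \<kappa>" for a
    by (rule minor_cong) auto
  have 3: "((-1) ^ (t + t) :: 'a) = 1" by (simp flip: mult_2)
  show ?thesis
    unfolding minor_Suc sum.lessThan_Suc 2 1 3 by (simp add: add.commute)
qed

text \<open>A minor is a polynomial with integer coefficients in its entries. The set
  \<open>S\<close> will be the polynomial functions or the functions regular near a point.\<close>

lemma minor_closed:
  assumes "\<And>f g. f \<in> S \<Longrightarrow> g \<in> S \<Longrightarrow> f + g \<in> S" "\<And>f g. f \<in> S \<Longrightarrow> g \<in> S \<Longrightarrow> f * g \<in> S"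
    and "1 \<in> S" "0 \<in> S" "-1 \<in> S" and A: "\<And>a b. a < t \<Longrightarrow> b < t \<Longrightarrow> A (\<rho> a) (\<kappa> b) \<in> S"
  shows "minor A t \<rho> \<kappa> \<in> S"
  using A
proof (induction t arbitrary: \<rho>)
  case (Suc t)
  have sum: "(\<Sum>a\<in>T. h a) \<in> S" if "finite T" "\<And>a. a \<in> T \<Longrightarrow> h a \<in> S" for h T
    using that by (induction T) (auto intro: assms)
  have pow: "(-1) ^ n \<in> S" for n
  proof (induction n)
    case (Suc n)
    show ?case unfolding power_Suc by (rule assms(2)[OF assms(5) Suc])
  qed (simp add: assms)
  have "minor A t (\<lambda>x. \<rho> (if x < a then x else Suc x)) \<kappa> \<in> S" for a
    by (rule Suc.IH) (auto intro!: Suc.prems)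
  with pow show ?case unfolding minor_Suc
    by (intro sum assms(2)) (auto intro!: Suc.prems)
qed (simp add: assms)

lemma sum_fun_apply: "(\<Sum>x\<in>T. h x) w = (\<Sum>x\<in>T. h x w :: 'b::comm_monoid_add)"
  by (induction T rule: infinite_finite_induct) auto

lemma minor_apply:
  fixes A :: "nat \<Rightarrow> nat \<Rightarrow> 'c \<Rightarrow> 'b::comm_ring_1"
  shows "minor A t \<rho> \<kappa> w = minor (\<lambda>i j. A i j w) t \<rho> \<kappa>"
proof (induction t arbitrary: \<rho>)
  case (Suc t)
  have "((-1) ^ n :: 'c \<Rightarrow> 'b) w = (-1) ^ n" for n by (induction n) auto
  with Suc show ?case by (simp add: minor_Suc sum_fun_apply)
qed simp

lemma minor_mult_eq_0:
  assumes "\<And>a b. a < Suc t \<Longrightarrow> b < Suc t \<Longrightarrow> A (\<rho> a) (\<kappa> b) = (\<Sum>s<t. P (\<rho> a) s * Q s (\<kappa> b))"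
  shows "minor A (Suc t) \<rho> \<kappa> = 0"
proof -
  \<comment> \<open>The left factor is padded by a zero column to make it square, which kills its
    determinant.\<close>
  let ?P = "mat (Suc t) (Suc t) (\<lambda>(a, s). if s < t then P (\<rho> a) s else 0)"
  let ?Q = "mat (Suc t) (Suc t) (\<lambda>(s, b). Q s (\<kappa> b))"
  have "mat (Suc t) (Suc t) (\<lambda>(a, b). A (\<rho> a) (\<kappa> b)) = ?P * ?Q"
    by (rule eq_matI) (auto simp: scalar_prod_def assms atLeast0LessThan)
  moreover have "det ?P = 0"
    by (subst laplace_expansion_column[of _ "Suc t" t]) auto
  ultimately show ?thesis
    unfolding minor_def using det_mult[of ?P "Suc t" ?Q] by simp
qed

text \<open>A relation among the chosen columns restricts to the chosen rows, where the square
  submatrix is invertible. Distinctness is shown separately because independence concerns the set of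
  columns and does not see repetitions.\<close>

lemma rank_ge_minor:
  fixes A :: "'a::field mat"
  assumes A: "A \<in> carrier_mat m n" and \<kappa>: "\<And>a. a < t \<Longrightarrow> \<kappa> a < n" and \<rho>: "\<And>a. a < t \<Longrightarrow> \<rho> a < m"
    and nz: "minor (\<lambda>i j. A $$ (i, j)) t \<rho> \<kappa> \<noteq> 0"
  shows "t \<le> vec_space.rank m A"
proof -
  interpret V: vec_space "TYPE('a)" m .
  let ?C = "mat m t (\<lambda>(i, b). A $$ (i, \<kappa> b))"
  let ?D = "mat t t (\<lambda>(a, b). A $$ (\<rho> a, \<kappa> b))"
  have dist: "distinct (cols ?C)"
  proof (rule ccontr)
    assume "\<not> distinct (cols ?C)"
    then obtain i j where ij: "i \<noteq> j" "i < t" "j < t" "col ?C i = col ?C j"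
      by (auto simp: distinct_conv_nth)
    have "A $$ (x, \<kappa> i) = A $$ (x, \<kappa> j)" if "x < m" for x
      using arg_cong[OF ij(4), of "\<lambda>v. v $ x"] ij(2,3) that by (simp del: col_mat)
    then have "col ?D i = col ?D j" using ij \<rho> by (intro eq_vecI) auto
    then have "det ?D = 0" using ij by (intro det_identical_cols[of _ t i j]) auto
    then show False using nz by (simp add: minor_def)
  qed
  have "V.lin_indpt (set (cols ?C))"
  proof
    assume "V.lin_dep (set (cols ?C))"
    then obtain v where v: "v \<in> carrier_vec t" "v \<noteq> 0\<^sub>v t" "?C *\<^sub>v v = 0\<^sub>v m"
      using V.lin_depE[of ?C t] dist by auto
    have "?D *\<^sub>v v = 0\<^sub>v t"
    proof (rule eq_vecI)
      fix a assume "a < dim_vec (0\<^sub>v t :: 'a vec)"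
      then have a: "a < t" "\<rho> a < m" using \<rho> by auto
      have "(?C *\<^sub>v v) $ \<rho> a = 0" using v a by simp
      then show "(?D *\<^sub>v v) $ a = 0\<^sub>v t $ a" using a v(1) by (auto simp: scalar_prod_def)
    qed simp
    then have "det ?D = 0" using v det_0_iff_vec_prod_zero_field[of ?D t] by auto
    then show False using nz by (simp add: minor_def)
  qed
  moreover have "set (cols ?C) \<subseteq> set (cols A)"
  proof
    fix c assume "c \<in> set (cols ?C)"
    then obtain b where b: "b < t" "c = col ?C b" by (auto simp: cols_def)
    then have "c = col A (\<kappa> b)" using A \<kappa> by (intro eq_vecI) auto
    then show "c \<in> set (cols A)" using b A \<kappa> by (auto simp: cols_def)
  qed
  ultimately have "card (set (cols ?C)) \<le> V.rank A" by (intro V.rank_ge_card_indpt[OF A])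
  then show ?thesis using distinct_card[OF dist] by simp
qed

lemma rank_le_sum:
  fixes A :: "'a::field mat"
  assumes "A \<in> carrier_mat m n" "\<And>i j. i < m \<Longrightarrow> j < n \<Longrightarrow> A $$ (i, j) = (\<Sum>s<t. P i s * Q s j)"
  shows "vec_space.rank m A \<le> t"
  using assms
proof (induction t arbitrary: A)
  case 0
  then have "A = 0\<^sub>m m n" by (intro eq_matI) auto
  then show ?case by (simp add: vec_space.rank_0I)
next
  case (Suc t)
  let ?A = "mat m n (\<lambda>(i, j). \<Sum>s<t. P i s * Q s j)" and ?B = "mat m n (\<lambda>(i, j). P i t * Q t j)"
  have "A = ?A + ?B" by (rule eq_matI) (use Suc.prems in auto)
  moreover have "vec_space.rank m ?A \<le> t" by (rule Suc.IH) auto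
  moreover have "vec_space.rank m ?B \<le> 1"
    by (rule vec_space.rank_le_1_product_entries[of _ _ n "\<lambda>i. P i t" "\<lambda>j. Q t j"]) auto
  moreover have "vec_space.rank m (?A + ?B) \<le> vec_space.rank m ?A + vec_space.rank m ?B"
    by (rule vec_space.rank_subadditive[of _ _ n]) auto
  ultimately show ?case by simp
qed

section \<open>Polynomial functions over an infinite field\<close>

text \<open>Over a finite field, 1 plus the product of all \<open>X - a\<close> has no root although
  its degree is positive.\<close>

lemma alg_closed_field_infinite: "infinite (UNIV :: 'a::alg_closed_field set)"
proof
  assume fin: "finite (UNIV :: 'a set)"
  let ?p = "(\<Prod>a\<in>UNIV. [:- a, 1:]) + 1 :: 'a poly"
  have val: "poly ?p x = 1" for x
    using fin by (auto simp: poly_prod intro!: prod_zero bexI[of _ x])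
  have "degree (\<Prod>a\<in>(UNIV :: 'a set). [:- a, 1:]) = card (UNIV :: 'a set)"
    by (subst degree_prod_eq_sum_degree) auto
  moreover have "card (UNIV :: 'a set) > 0" using fin by (simp add: card_gt_0_iff)
  ultimately have "degree ?p > 0" by (subst degree_add_eq_left) auto
  then obtain x where "poly ?p x = 0" using alg_closed_imp_poly_has_root by blast
  with val show False by simp
qed

text \<open>Guarantees that the \<open>THE\<close> in \<open>differential\<close> picks the
  polynomial at hand, and later lets identities in a parameter be read off coefficientwise.\<close>

lemma alg_closed_poly_eqI:
  fixes p q :: "'a::alg_closed_field poly"
  assumes "\<And>t. poly p t = poly q t"
  shows "p = q"
proof (rule ccontr)
  assume "p \<noteq> q"
  then have "finite {t. poly (p - q) t = 0}" by (intro poly_roots_finite) simp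
  moreover have "{t. poly (p - q) t = 0} = UNIV" using assms by simp
  ultimately show False using alg_closed_field_infinite by metis
qed

locale poly_functions = finite_dimensional_vector_space s B
  for s :: "'a::alg_closed_field \<Rightarrow> 'w::ab_group_add \<Rightarrow> 'w" and B :: "'w set"
begin

sublocale F: vector_space "fscale :: 'a \<Rightarrow> ('w \<Rightarrow> 'a) \<Rightarrow> 'w \<Rightarrow> 'a"
  by unfold_locales (auto simp: algebra_simps fun_eq_iff)

abbreviation "S \<equiv> polys s"

lemma dual_add: "l \<in> dual s \<Longrightarrow> l (v + w) = l v + l w"
  unfolding dual_def using Modules.module_hom.add[OF Vector_Spaces.linear.axioms(3)] by blast

lemma dual_scale: "l \<in> dual s \<Longrightarrow> l (s c v) = c * l v"
  unfolding dual_def using Modules.module_hom.scale[OF Vector_Spaces.linear.axioms(3)] by blast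

lemma dual_0: "l \<in> dual s \<Longrightarrow> l 0 = 0"
  using dual_scale[of l 0 0] by simp

lemma dual_diff: "l \<in> dual s \<Longrightarrow> l (v - w) = l v - l w"
  using dual_add[of l "v - w" w] by simp

lemma dual_sum: "l \<in> dual s \<Longrightarrow> l (\<Sum>i\<in>T. f i) = (\<Sum>i\<in>T. l (f i))"
  by (induction T rule: infinite_finite_induct) (auto simp: dual_0 dual_add)

lemma dualI:
  assumes "\<And>v w. l (v + w) = l v + l w" "\<And>c v. l (s c v) = c * l v"
  shows "l \<in> dual s"
  unfolding dual_def using assms by (auto intro!: Vector_Spaces.linear.intro Modules.module_hom.intro
    vector_space_axioms module_hom_axioms.intro module_axioms simp: Vector_Spaces.vector_space_def
    Modules.module_def algebra_simps)

lemma forms_subset: "forms s d \<subseteq> homog s" unfolding homog_def by blast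

lemma homog_subset: "homog s \<subseteq> S" unfolding polys_def by (rule F.span_superset)

lemma const_forms: "(\<lambda>w. c) \<in> forms s 0"
proof -
  have "fscale c (\<lambda>w. 1) \<in> forms s 0"
    unfolding forms_def by (intro F.span_scale F.span_base) auto
  then show ?thesis by simp
qed

lemma dual_forms: "l \<in> dual s \<Longrightarrow> l \<in> forms s 1"
  unfolding forms_def by (intro F.span_base CollectI exI[of _ "\<lambda>_. l"]) auto

lemma const_S: "(\<lambda>w. c) \<in> S"
  using const_forms forms_subset homog_subset by blast

lemma dual_S: "l \<in> dual s \<Longrightarrow> l \<in> S"
  using dual_forms forms_subset homog_subset by blast

lemma zero_S: "0 \<in> S" and one_S: "1 \<in> S"
  using const_S[of 0] const_S[of 1] by (simp_all add: zero_fun_def one_fun_def)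

lemma add_S: "f \<in> S \<Longrightarrow> g \<in> S \<Longrightarrow> f + g \<in> S"
  unfolding polys_def by (rule F.span_add)

lemma scale_S: "f \<in> S \<Longrightarrow> fscale c f \<in> S"
  unfolding polys_def by (rule F.span_scale)

lemma uminus_S: "f \<in> S \<Longrightarrow> - f \<in> S"
  unfolding polys_def by (rule F.span_neg)

lemma diff_S: "f \<in> S \<Longrightarrow> g \<in> S \<Longrightarrow> f - g \<in> S"
  unfolding polys_def by (rule F.span_diff)

lemma mult_S:
  assumes "f \<in> S" "g \<in> S"
  shows "f * g \<in> S"
proof -
  have 1: "f * g \<in> S" if "f \<in> homog s" "g \<in> homog s" for f g
    using that forms_mult homog_subset forms_subset unfolding homog_def by blast
  have 2: "f * g \<in> S" if f: "f \<in> homog s" for f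
    using assms(2) unfolding polys_def[of s]
  proof (induction rule: F.span_induct_alt)
    case (step c x y)
    have "f * (fscale c x + y) = fscale c (f * x) + f * y" by (simp add: fun_eq_iff algebra_simps)
    then show ?case using 1[OF f step(1)] step(2) unfolding polys_def
      by (simp only: F.span_add F.span_scale)
  qed (use F.span_zero in \<open>simp add: polys_def zero_fun_def times_fun_def\<close>)
  show ?thesis using assms(1) unfolding polys_def[of s]
  proof (induction rule: F.span_induct_alt)
    case (step c x y)
    have "(fscale c x + y) * g = fscale c (x * g) + y * g" by (simp add: fun_eq_iff algebra_simps)
    then show ?case using 2[OF step(1)] step(2) unfolding polys_def
      by (simp only: F.span_add F.span_scale)
  qed (use F.span_zero in \<open>simp add: polys_def zero_fun_def times_fun_def\<close>)
qed

lemma sum_S: "(\<And>x. x \<in> T \<Longrightarrow> f x \<in> S) \<Longrightarrow> (\<Sum>x\<in>T. f x) \<in> S"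
  by (induction T rule: infinite_finite_induct) (auto simp: zero_S add_S)

lemma power_S: "f \<in> S \<Longrightarrow> f ^ n \<in> S"
  by (induction n) (auto simp: one_S mult_S)

lemma minor_S: "(\<And>a b. a < t \<Longrightarrow> b < t \<Longrightarrow> A (\<rho> a) (\<kappa> b) \<in> S) \<Longrightarrow> minor A t \<rho> \<kappa> \<in> S"
  by (rule minor_closed) (auto intro: add_S mult_S one_S zero_S uminus_S)

text \<open>Unfolds the two nested spans behind \<open>polys\<close> once and for all: the
  polynomial functions form the algebra generated by constants and linear forms.\<close>

lemma polys_induct [consumes 1, case_names const dual add mult]:
  assumes f: "f \<in> S"
    and const: "\<And>c. P (\<lambda>w. c)" and dual: "\<And>l. l \<in> dual s \<Longrightarrow> P l"
    and add: "\<And>f g. f \<in> S \<Longrightarrow> P f \<Longrightarrow> g \<in> S \<Longrightarrow> P g \<Longrightarrow> P (f + g)"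
    and mult: "\<And>f g. f \<in> S \<Longrightarrow> P f \<Longrightarrow> g \<in> S \<Longrightarrow> P g \<Longrightarrow> P (f * g)"
  shows "P f"
proof -
  have scale: "P (fscale c f)" if "f \<in> S" "P f" for c f
    using mult[OF const_S const that] by (simp add: times_fun_def)
  have prod: "P (\<lambda>w. \<Prod>i<d. l i w) \<and> (\<lambda>w. \<Prod>i<d. l i w) \<in> S" if "\<forall>i<d. l i \<in> dual s" for d :: nat and l
    using that
  proof (induction d)
    case (Suc d)
    have eq: "(\<lambda>w. \<Prod>i<Suc d. l i w) = (\<lambda>w. \<Prod>i<d. l i w) * l d" by auto
    have "P (\<lambda>w. \<Prod>i<d. l i w)" "(\<lambda>w. \<Prod>i<d. l i w) \<in> S" "l d \<in> dual s"
      using Suc by auto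
    then show ?case unfolding eq by (blast intro: mult mult_S dual dual_S)
  qed (simp_all add: const const_S)
  have homog: "P f \<and> f \<in> S" if "f \<in> forms s d" for f d
    using that unfolding forms_def
  proof (induction rule: F.span_induct_alt)
    case (step c x y)
    then have "P x" "x \<in> S" using prod by auto
    then have "P (fscale c x + y) \<and> fscale c x + y \<in> S"
      using step(2) by (blast intro: add scale add_S scale_S)
    then show ?case .
  qed (use const[of 0] zero_S in \<open>auto simp: zero_fun_def\<close>)
  have "P f \<and> f \<in> S" using f unfolding polys_def[of s]
  proof (induction rule: F.span_induct_alt)
    case (step c x y)
    then have "P x" "x \<in> S" using homog unfolding homog_def by auto
    then have "P (fscale c x + y) \<and> fscale c x + y \<in> S"
      using step(2) unfolding polys_def[symmetric] by (blast intro: add scale add_S scale_S)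
    then show ?case unfolding polys_def .
  qed (use const[of 0] zero_S in \<open>auto simp: zero_fun_def polys_def\<close>)
  then show ?thesis by blast
qed

definition coord :: "'w \<Rightarrow> 'w \<Rightarrow> 'a" where
  "coord b w = representation B w b"

lemma coord_dual: "coord b \<in> dual s"
  unfolding coord_def
  by (rule dualI)
    (use independent_Basis span_Basis in \<open>auto simp: representation_add representation_scale\<close>)

lemma sum_coord: "(\<Sum>b\<in>B. s (coord b w) b) = w"
  unfolding coord_def
  by (rule sum_representation_eq) (use independent_Basis span_Basis finite_Basis in auto)

lemma dual_eq_sum_coord:
  assumes "l \<in> dual s"
  shows "l = (\<Sum>b\<in>B. fscale (l b) (coord b))"
proof
  fix w
  have "l w = l (\<Sum>b\<in>B. s (coord b w) b)" by (simp add: sum_coord)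
  also have "\<dots> = (\<Sum>b\<in>B. fscale (l b) (coord b)) w"
    by (simp add: dual_sum dual_scale assms sum_fun_apply mult.commute)
  finally show "l w = (\<Sum>b\<in>B. fscale (l b) (coord b)) w" .
qed

lemma polys_comp:
  assumes "f \<in> S" "\<And>l. l \<in> dual s \<Longrightarrow> (\<lambda>w. l (\<theta> w)) \<in> S"
  shows "(\<lambda>w. f (\<theta> w)) \<in> S"
  using assms(1)
proof (induction rule: polys_induct)
  case (add f g)
  then show ?case using add_S[OF add.IH] by (simp add: plus_fun_def)
next
  case (mult f g)
  then show ?case using mult_S[OF mult.IH] by (simp add: times_fun_def)
qed (use assms(2) const_S in auto)

subsection \<open>Differentials\<close>

lemma polys_on_line: "f \<in> S \<Longrightarrow> \<exists>q. \<forall>t. poly q t = f (w + s t v)"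
proof (induction rule: polys_induct)
  case (const c)
  show ?case by (rule exI[of _ "[:c:]"]) simp
next
  case (dual l)
  then show ?case by (intro exI[of _ "[:l w, l v:]"]) (simp add: dual_add dual_scale)
next
  case (add f g)
  then obtain p q where "\<forall>t. poly p t = f (w + s t v)" "\<forall>t. poly q t = g (w + s t v)" by blast
  then show ?case by (intro exI[of _ "p + q"]) simp
next
  case (mult f g)
  then obtain p q where "\<forall>t. poly p t = f (w + s t v)" "\<forall>t. poly q t = g (w + s t v)" by blast
  then show ?case by (intro exI[of _ "p * q"]) simp
qed

lemma differential_eqI:
  assumes "\<And>t. poly q t = f (w + s t v)"
  shows "differential s f w v = coeff q 1"
proof -
  have "(THE q. \<forall>t. poly q t = f (w + s t v)) = q"
    using assms by (intro the_equality alg_closed_poly_eqI) auto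
  then show ?thesis by (simp add: differential_def)
qed

lemma differential_const: "differential s (\<lambda>w. c) w v = 0"
  by (subst differential_eqI[of "[:c:]"]) auto

lemma differential_dual: "l \<in> dual s \<Longrightarrow> differential s l w v = l v"
  by (subst differential_eqI[of "[:l w, l v:]"]) (auto simp: dual_add dual_scale)

lemma differential_add:
  assumes "f \<in> S" "g \<in> S"
  shows "differential s (f + g) w v = differential s f w v + differential s g w v"
proof -
  obtain p q where pq: "\<forall>t. poly p t = f (w + s t v)" "\<forall>t. poly q t = g (w + s t v)"
    using polys_on_line assms by meson
  then show ?thesis
    using differential_eqI[of p f w v] differential_eqI[of q g w v]
      differential_eqI[of "p + q" "f + g" w v] by simp
qed

lemma differential_mult:
  assumes "f \<in> S" "g \<in> S"
  shows "differential s (f * g) w v = f w * differential s g w v + g w * differential s f w v"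
proof -
  obtain p q where pq: "\<forall>t. poly p t = f (w + s t v)" "\<forall>t. poly q t = g (w + s t v)"
    using polys_on_line assms by meson
  have "coeff p 0 = f w" "coeff q 0 = g w"
    using pq[THEN spec, of 0] by (simp_all add: poly_0_coeff_0)
  moreover have "coeff (p * q) 1 = coeff p 0 * coeff q 1 + coeff p 1 * coeff q 0"
    by (simp add: coeff_mult)
  ultimately show ?thesis
    using pq differential_eqI[of p f w v] differential_eqI[of q g w v]
      differential_eqI[of "p * q" "f * g" w v] by (simp add: mult.commute)
qed

lemma differential_S: "f \<in> S \<Longrightarrow> (\<lambda>w. differential s f w v) \<in> S"
proof (induction rule: polys_induct)
  case (add f g)
  have "(\<lambda>w. differential s (f + g) w v) = (\<lambda>w. differential s f w v) + (\<lambda>w. differential s g w v)"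
    using add by (auto simp: differential_add)
  then have "(\<lambda>w. differential s (f + g) w v) \<in> S" using add by (simp only: add_S)
  then show ?case .
next
  case (mult f g)
  have "(\<lambda>w. differential s (f * g) w v) = f * (\<lambda>w. differential s g w v) + g * (\<lambda>w. differential s f w v)"
    using mult by (auto simp: differential_mult)
  then have "(\<lambda>w. differential s (f * g) w v) \<in> S" using mult by (simp only: add_S mult_S)
  then show ?case .
qed (simp_all add: differential_const differential_dual const_S)

lemma differential_linear: "f \<in> S \<Longrightarrow> differential s f w \<in> dual s"
proof (induction rule: polys_induct)
  case (const c)
  show ?case by (rule dualI) (auto simp: differential_const)
next
  case (dual l)
  then show ?case by (intro dualI) (auto simp: differential_dual dual_add dual_scale)
next
  case (add f g)
  then have "differential s (f + g) w \<in> dual s"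
    by (intro dualI) (auto simp: differential_add dual_add dual_scale algebra_simps)
  then show ?case .
next
  case (mult f g)
  then have "differential s (f * g) w \<in> dual s"
    by (intro dualI) (auto simp: differential_mult dual_add dual_scale algebra_simps)
  then show ?case .
qed

text \<open>If no vector \<open>w\<close> extends a nonzero minor, expanding the bordered minors gives a linear relation.\<close>

lemma independent_functionals_minor:
  assumes l: "\<And>i. i < c \<Longrightarrow> l i \<in> dual s"
    and indep: "\<And>b. (\<forall>v. (\<Sum>i<c. b i * l i v) = 0) \<Longrightarrow> \<forall>i<c. b i = 0"
  shows "\<exists>v. minor (\<lambda>i j. l i (v j)) c id id \<noteq> 0"
proof -
  have "\<exists>v. minor (\<lambda>i j. l i (v j)) t id id \<noteq> 0" if "t \<le> c" for t
    using that
  proof (induction t)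
    case (Suc t)
    then obtain v where v: "minor (\<lambda>i j. l i (v j)) t id id \<noteq> 0" by (meson Suc_leD)
    \<comment> \<open>Cofactors of a prospective new column, extended by 0 to all functionals. Since
      \<open>b t\<close> is the nonzero old minor, independence provides a vector \<open>w\<close>
      on which the combination, which is the enlarged minor, does not vanish.\<close>
    define b where "b a = (if a < Suc t then
        (-1) ^ (a + t) * minor (\<lambda>i j. l i (v j)) t (\<lambda>x. if x < a then x else Suc x) id else 0)" for a
    have "minor (\<lambda>i j. l i (v j)) t (\<lambda>x. if x < t then x else Suc x) id = minor (\<lambda>i j. l i (v j)) t id id"
      by (rule minor_cong) auto
    moreover have "((-1) ^ (t + t) :: 'a) = 1" by (simp flip: mult_2)
    ultimately have "b t = minor (\<lambda>i j. l i (v j)) t id id"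
      unfolding b_def by simp
    with v have "b t \<noteq> 0" by argo
    then have "\<not> (\<forall>i<c. b i = 0)" using Suc.prems by (auto simp: Suc_le_eq)
    with indep[of b] obtain w where w: "(\<Sum>i<c. b i * l i w) \<noteq> 0" by blast
    have "(\<Sum>i<c. b i * l i w) = (\<Sum>i<Suc t. b i * l i w)"
      using Suc.prems by (intro sum.mono_neutral_right) (auto simp: b_def)
    also have "\<dots> = minor (\<lambda>i j. l i ((v(t := w)) j)) (Suc t) id id"
    proof -
      have eq: "minor (\<lambda>i j. l i ((v(t := w)) j)) t \<rho> id = minor (\<lambda>i j. l i (v j)) t \<rho> id" for \<rho>
        by (rule minor_cong) auto
      show ?thesis unfolding minor_Suc eq
        by (rule sum.cong) (simp_all add: b_def mult_ac)
    qed
    finally have "minor (\<lambda>i j. l i ((v(t := w)) j)) (Suc t) id id \<noteq> 0" using w by argo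
    then show ?case by (rule exI[of _ "v(t := w)"])
  qed simp
  then show ?thesis by simp
qed

end

text \<open>Allows an arbitrary finite index set, because the rank count ends in a sum over pairs;
  smaller sets are padded with zero columns.\<close>

lemma minor_factor_eq_0:
  assumes "finite T" "card T \<le> t"
    and "\<And>i j. A i j = (\<Sum>x\<in>T. P i x * Q x j)"
  shows "minor A (Suc t) \<rho> \<kappa> = 0"
proof -
  obtain e where e: "bij_betw e {..<card T} T"
    using ex_bij_betw_nat_finite[OF assms(1)] by (auto simp: atLeast0LessThan)
  have "A i j = (\<Sum>s<t. (if s < card T then P i (e s) else 0) * Q (e s) j)" for i j
  proof -
    have "A i j = (\<Sum>s<card T. P i (e s) * Q (e s) j)"
      unfolding assms(3) by (rule sum.reindex_bij_betw[OF e, symmetric])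
    also have "\<dots> = (\<Sum>s<t. (if s < card T then P i (e s) else 0) * Q (e s) j)"
      using assms(2) by (intro sum.mono_neutral_cong_left) auto
    finally show ?thesis .
  qed
  then show ?thesis
    by (rule minor_mult_eq_0[where P = "\<lambda>i s. if s < card T then P i (e s) else 0" and Q = "\<lambda>s. Q (e s)"])
qed

lemma minor_zero_row:
  assumes "a < t" "\<And>b. b < t \<Longrightarrow> A (\<rho> a) (\<kappa> b) = 0"
  shows "minor A t \<rho> \<kappa> = 0"
  unfolding minor_def by (subst laplace_expansion_row[of _ t a]) (auto simp: assms)

lemma minor_zero_col:
  assumes "b < t" "\<And>a. a < t \<Longrightarrow> A (\<rho> a) (\<kappa> b) = 0"
  shows "minor A t \<rho> \<kappa> = 0"
  unfolding minor_def by (subst laplace_expansion_column[of _ t b]) (auto simp: assms)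

section \<open>Ideals of polynomial functions and first-order Taylor expansion\<close>

lemma mult_diff_mult:
  fixes a :: "'b::comm_ring_1"
  shows "a * b - a' * b' = a * (b - b') + b' * (a - a')"
  by (simp add: algebra_simps)

text \<open>The Taylor defect of a product is a combination of the defects of the factors plus
  \<open>da * db\<close>, the only term quadratic in the differentials.\<close>

lemma taylor_product_identity:
  fixes a :: "'b::comm_ring_1"
  shows "a' * b' - a * b - (a * db + b * da) =
    (a' - a - da) * b' + (a + da) * (b' - b - db) + da * db"
  by (simp add: algebra_simps)

context poly_functions
begin

definition poly_ideal :: "('w \<Rightarrow> 'a) set \<Rightarrow> bool" where
  "poly_ideal J \<longleftrightarrow> J \<subseteq> S \<and> 0 \<in> J \<and> (\<forall>f\<in>J. \<forall>g\<in>J. f + g \<in> J) \<and> (\<forall>f\<in>S. \<forall>g\<in>J. f * g \<in> J)"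

context
  fixes J assumes J: "poly_ideal J"
begin

lemma ideal_S: "f \<in> J \<Longrightarrow> f \<in> S"
  and ideal_0: "0 \<in> J"
  and ideal_add: "f \<in> J \<Longrightarrow> g \<in> J \<Longrightarrow> f + g \<in> J"
  and ideal_mult: "f \<in> S \<Longrightarrow> g \<in> J \<Longrightarrow> f * g \<in> J"
  using J unfolding poly_ideal_def by blast+

lemma ideal_mult': "g \<in> J \<Longrightarrow> f \<in> S \<Longrightarrow> g * f \<in> J"
  by (subst mult.commute) (rule ideal_mult)

lemma ideal_scale: "f \<in> J \<Longrightarrow> fscale c f \<in> J"
  using ideal_mult[OF const_S] by (simp add: times_fun_def)

lemma ideal_uminus: "f \<in> J \<Longrightarrow> - f \<in> J"
  using ideal_mult[OF uminus_S[OF one_S], of f] by simp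

lemma ideal_diff: "f \<in> J \<Longrightarrow> g \<in> J \<Longrightarrow> f - g \<in> J"
  using ideal_add[OF _ ideal_uminus, of f g] by simp

lemma ideal_sum: "(\<And>x. x \<in> T \<Longrightarrow> f x \<in> J) \<Longrightarrow> (\<Sum>x\<in>T. f x) \<in> J"
  by (induction T rule: infinite_finite_induct) (auto simp: ideal_0 ideal_add)

lemma comp_cong_ideal:
  assumes "f \<in> S" and \<theta>: "\<And>l. l \<in> dual s \<Longrightarrow> (\<lambda>w. l (\<theta> w)) \<in> S"
    and \<theta>': "\<And>l. l \<in> dual s \<Longrightarrow> (\<lambda>w. l (\<theta>' w)) \<in> S"
    and eq: "\<And>l. l \<in> dual s \<Longrightarrow> (\<lambda>w. l (\<theta> w)) - (\<lambda>w. l (\<theta>' w)) \<in> J"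
  shows "(\<lambda>w. f (\<theta> w)) - (\<lambda>w. f (\<theta>' w)) \<in> J"
  using assms(1)
proof (induction rule: polys_induct)
  case (const c)
  have "(\<lambda>w. c) - (\<lambda>w. c) \<in> J" using ideal_0 by (simp only: diff_self)
  then show ?case .
next
  case (dual l)
  then show ?case by (rule eq)
next
  case (add f g)
  have "(\<lambda>w. (f + g) (\<theta> w)) - (\<lambda>w. (f + g) (\<theta>' w)) =
      ((\<lambda>w. f (\<theta> w)) - (\<lambda>w. f (\<theta>' w))) + ((\<lambda>w. g (\<theta> w)) - (\<lambda>w. g (\<theta>' w)))"
    by (auto simp: fun_eq_iff)
  also have "\<dots> \<in> J" using add.IH by (rule ideal_add)
  finally show ?case .
next
  case (mult f g)
  have "(\<lambda>w. f (\<theta> w)) * (\<lambda>w. g (\<theta> w)) - (\<lambda>w. f (\<theta>' w)) * (\<lambda>w. g (\<theta>' w)) \<in> J"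
    unfolding mult_diff_mult
    using mult.IH polys_comp[of f \<theta>, OF mult.hyps(1) \<theta>] polys_comp[of g \<theta>', OF mult.hyps(2) \<theta>']
    by (simp only: ideal_add ideal_mult)
  then have "(\<lambda>w. (f * g) (\<theta> w)) - (\<lambda>w. (f * g) (\<theta>' w)) \<in> J" by (simp only: times_fun_def)
  then show ?case .
qed

text \<open>The increment of \<open>f\<close> obeys the Leibniz rule up to products of two
  first-order terms, which lie in \<open>J\<close>. Induction over sums and products avoids second
  derivatives and factorials, so the expansion holds in every characteristic.\<close>

lemma taylor_ideal:
  fixes c :: nat
  assumes f: "f \<in> S" and \<theta>: "\<And>l. l \<in> dual s \<Longrightarrow> (\<lambda>w. l (\<theta> w)) \<in> S"
    and \<delta>: "\<And>j. j < c \<Longrightarrow> \<delta> j \<in> S" and \<delta>\<delta>: "\<And>i j. i < c \<Longrightarrow> j < c \<Longrightarrow> \<delta> i * \<delta> j \<in> J"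
  shows "(\<lambda>w. f (\<theta> w + (\<Sum>j<c. s (\<delta> j w) (v j)))) - (\<lambda>w. f (\<theta> w)) -
      (\<Sum>j<c. (\<lambda>w. differential s f (\<theta> w) (v j)) * \<delta> j) \<in> J"
proof -
  define \<theta>' where "\<theta>' w = \<theta> w + (\<Sum>j<c. s (\<delta> j w) (v j))" for w
  define D where "D f = (\<Sum>j<c. (\<lambda>w. differential s f (\<theta> w) (v j)) * \<delta> j)" for f
  have l\<theta>': "(\<lambda>w. l (\<theta>' w)) = (\<lambda>w. l (\<theta> w)) + (\<Sum>j<c. fscale (l (v j)) (\<delta> j))" if "l \<in> dual s" for l
    using that by (auto simp: fun_eq_iff \<theta>'_def dual_add dual_sum dual_scale sum_fun_apply mult.commute)
  have \<theta>'S: "(\<lambda>w. l (\<theta>' w)) \<in> S" if "l \<in> dual s" for l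
    unfolding l\<theta>'[OF that] using that by (intro add_S \<theta> sum_S scale_S \<delta>) auto
  have dS: "(\<lambda>w. differential s f (\<theta> w) (v j)) \<in> S" if "f \<in> S" for f j
    using that by (intro polys_comp[of "\<lambda>w. differential s f w (v j)" \<theta>] differential_S \<theta>)
  have DS: "D f \<in> S" if "f \<in> S" for f
    unfolding D_def using that by (intro sum_S mult_S dS \<delta>) auto
  have "(\<lambda>w. f (\<theta>' w)) - (\<lambda>w. f (\<theta> w)) - D f \<in> J"
    using f
  proof (induction rule: polys_induct)
    case (const a)
    have "(\<lambda>w. a) - (\<lambda>w. a) - D (\<lambda>w. a) = 0"
      by (auto simp: fun_eq_iff D_def differential_const sum_fun_apply)
    then have "(\<lambda>w. a) - (\<lambda>w. a) - D (\<lambda>w. a) \<in> J" using ideal_0 by (simp only:)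
    then show ?case .
  next
    case (dual l)
    have "D l = (\<Sum>j<c. fscale (l (v j)) (\<delta> j))"
      using dual by (auto simp: D_def differential_dual fun_eq_iff sum_fun_apply)
    then have "(\<lambda>w. l (\<theta>' w)) - (\<lambda>w. l (\<theta> w)) - D l = 0"
      unfolding l\<theta>'[OF dual] by simp
    then have "(\<lambda>w. l (\<theta>' w)) - (\<lambda>w. l (\<theta> w)) - D l \<in> J" using ideal_0 by (simp only:)
    then show ?case .
  next
    case (add f g)
    have "D (f + g) = D f + D g"
      using add by (auto simp: D_def fun_eq_iff differential_add sum_fun_apply sum.distrib algebra_simps)
    then have "(\<lambda>w. (f + g) (\<theta>' w)) - (\<lambda>w. (f + g) (\<theta> w)) - D (f + g) =
        ((\<lambda>w. f (\<theta>' w)) - (\<lambda>w. f (\<theta> w)) - D f) + ((\<lambda>w. g (\<theta>' w)) - (\<lambda>w. g (\<theta> w)) - D g)"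
      by (auto simp: fun_eq_iff)
    also have "\<dots> \<in> J" using add.IH by (rule ideal_add)
    finally show ?case .
  next
    case (mult f g)
    have D: "D (f * g) = (\<lambda>w. f (\<theta> w)) * D g + (\<lambda>w. g (\<theta> w)) * D f"
      using mult by (auto simp: D_def fun_eq_iff differential_mult sum_fun_apply sum.distrib
          sum_distrib_left algebra_simps)
    have DD: "D f * D g \<in> J"
    proof -
      have eq: "D f * D g = (\<Sum>i<c. \<Sum>j<c. ((\<lambda>w. differential s f (\<theta> w) (v i)) *
          (\<lambda>w. differential s g (\<theta> w) (v j))) * (\<delta> i * \<delta> j))"
        unfolding D_def sum_product by (intro sum.cong refl) (simp only: mult_ac)
      show ?thesis unfolding eq
        using mult by (intro ideal_sum ideal_mult mult_S dS \<delta>\<delta>) auto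
    qed
    have "(\<lambda>w. f (\<theta>' w)) * (\<lambda>w. g (\<theta>' w)) - (\<lambda>w. f (\<theta> w)) * (\<lambda>w. g (\<theta> w)) - D (f * g) \<in> J"
      unfolding D taylor_product_identity
      using mult.IH DD polys_comp[of g \<theta>', OF mult.hyps(2) \<theta>'S]
        add_S[OF polys_comp[of f \<theta>, OF mult.hyps(1) \<theta>] DS[OF mult.hyps(1)]]
      by (simp only: ideal_add ideal_mult ideal_mult')
    then have "(\<lambda>w. (f * g) (\<theta>' w)) - (\<lambda>w. (f * g) (\<theta> w)) - D (f * g) \<in> J"
      by (simp only: times_fun_def)
    then show ?case .
  qed
  then show ?thesis unfolding \<theta>'_def D_def .
qed

end

subsection \<open>Ideals supported at one point\<close>

text \<open>By the Nullstellensatz this says that the zeros of \<open>J\<close> lie in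
  \<open>{p}\<close>; nilpotency is the form in which it is used. The unit ideal is
  included.\<close>

definition local_at :: "'w \<Rightarrow> ('w \<Rightarrow> 'a) set \<Rightarrow> bool" where
  "local_at p J \<longleftrightarrow> (\<forall>b\<in>B. \<exists>n. (coord b - (\<lambda>w. coord b p)) ^ n \<in> J)"

text \<open>Identifies the maximal ideal at \<open>p\<close> with the ideal of the shifted
  coordinates; for a product, first \<open>f\<close> and then \<open>g\<close> is expanded.\<close>

lemma polys_expand_at:
  assumes "f \<in> S"
  shows "\<exists>g. (\<forall>b. g b \<in> S) \<and> f = (\<lambda>w. f p) + (\<Sum>b\<in>B. (coord b - (\<lambda>w. coord b p)) * g b)"
  using assms
proof (induction rule: polys_induct)
  case (const c)
  show ?case
    by (rule exI[of _ "\<lambda>_ _. 0"]) (auto simp: const_S fun_eq_iff sum_fun_apply)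
next
  case (dual l)
  have eq: "l w = l p + (\<Sum>b\<in>B. (coord b w - coord b p) * l b)" for w
  proof -
    have "l w - l p = (\<Sum>b\<in>B. fscale (l b) (coord b)) w - (\<Sum>b\<in>B. fscale (l b) (coord b)) p"
      using dual_eq_sum_coord[OF dual] by metis
    then show ?thesis
      by (simp add: sum_fun_apply sum_subtractf algebra_simps)
  qed
  have "l = (\<lambda>w. l p) + (\<Sum>b\<in>B. (coord b - (\<lambda>w. coord b p)) * (\<lambda>w. l b))"
  proof
    fix w
    show "l w = ((\<lambda>w. l p) + (\<Sum>b\<in>B. (coord b - (\<lambda>w. coord b p)) * (\<lambda>w. l b))) w"
      using eq[of w] by (simp add: sum_fun_apply)
  qed
  then show ?case by (intro exI[of _ "\<lambda>b w. l b"] conjI allI const_S)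
next
  case (add f g)
  then obtain f' g' where f': "\<forall>b. f' b \<in> S" "f = (\<lambda>w. f p) + (\<Sum>b\<in>B. (coord b - (\<lambda>w. coord b p)) * f' b)"
    and g': "\<forall>b. g' b \<in> S" "g = (\<lambda>w. g p) + (\<Sum>b\<in>B. (coord b - (\<lambda>w. coord b p)) * g' b)"
    by blast
  have "f + g = ((\<lambda>w. f p) + (\<Sum>b\<in>B. (coord b - (\<lambda>w. coord b p)) * f' b)) +
      ((\<lambda>w. g p) + (\<Sum>b\<in>B. (coord b - (\<lambda>w. coord b p)) * g' b))"
    using f'(2) g'(2) by argo
  also have "\<dots> = (\<lambda>w. (f + g) p) + (\<Sum>b\<in>B. (coord b - (\<lambda>w. coord b p)) * (f' b + g' b))"
    by (simp add: fun_eq_iff sum_fun_apply sum.distrib sum_subtractf algebra_simps)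
  finally show ?case
    by (intro exI[of _ "\<lambda>b. f' b + g' b"] conjI allI add_S f'(1)[THEN spec] g'(1)[THEN spec])
next
  case (mult f g)
  then obtain f' g' where f': "\<forall>b. f' b \<in> S" "f = (\<lambda>w. f p) + (\<Sum>b\<in>B. (coord b - (\<lambda>w. coord b p)) * f' b)"
    and g': "\<forall>b. g' b \<in> S" "g = (\<lambda>w. g p) + (\<Sum>b\<in>B. (coord b - (\<lambda>w. coord b p)) * g' b)"
    by blast
  let ?F = "\<Sum>b\<in>B. (coord b - (\<lambda>w. coord b p)) * f' b"
  let ?G = "\<Sum>b\<in>B. (coord b - (\<lambda>w. coord b p)) * g' b"
  have 1: "f * g = (\<lambda>w. f p) * g + ?F * g"
    by (subst f'(2)) (rule distrib_right)
  have 2: "(\<lambda>w. f p) * g = (\<lambda>w. f p) * (\<lambda>w. g p) + (\<lambda>w. f p) * ?G"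
    by (subst g'(2)) (rule distrib_left)
  have "(\<lambda>w. f p) * ?G + ?F * g =
      (\<Sum>b\<in>B. (coord b - (\<lambda>w. coord b p)) * ((\<lambda>w. f p) * g' b + f' b * g))"
    unfolding sum_distrib_left sum_distrib_right sum.distrib[symmetric]
    by (intro sum.cong refl) (simp only: distrib_left mult_ac)
  then have "f * g = (\<lambda>w. f p) * (\<lambda>w. g p) +
      (\<Sum>b\<in>B. (coord b - (\<lambda>w. coord b p)) * ((\<lambda>w. f p) * g' b + f' b * g))"
    unfolding 1 2 add.assoc by (rule arg_cong)
  moreover have "(\<lambda>w. f p) * (\<lambda>w. g p) = (\<lambda>w. (f * g) p)" by (simp only: times_fun_def)
  ultimately have "f * g = (\<lambda>w. (f * g) p) +
      (\<Sum>b\<in>B. (coord b - (\<lambda>w. coord b p)) * ((\<lambda>w. f p) * g' b + f' b * g))"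
    by (rule back_subst[where P = "\<lambda>u. f * g = u + _"])
  then show ?case
    by (intro exI[of _ "\<lambda>b. (\<lambda>w. f p) * g' b + f' b * g"] conjI allI add_S mult_S const_S
        f'(1)[THEN spec] g'(1)[THEN spec] mult.hyps(2))
qed

text \<open>Pigeonhole: a word of length \<open>L + n\<close> contains \<open>y\<close> at least
  \<open>n\<close> times or at least \<open>L\<close> letters from the remaining set. Lists keep
  track of repeated factors.\<close>

lemma nilpotent_prod_list:
  assumes J: "poly_ideal J" and "finite C" "C \<subseteq> S" "\<And>x. x \<in> C \<Longrightarrow> \<exists>n. x ^ n \<in> J"
  shows "\<exists>L. \<forall>xs. set xs \<subseteq> C \<longrightarrow> L \<le> length xs \<longrightarrow> prod_list xs \<in> J"
  using assms(2-)
proof (induction C)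
  case empty
  show ?case by (rule exI[of _ 1]) auto
next
  case (insert y C)
  then obtain L where L: "\<And>xs. set xs \<subseteq> C \<Longrightarrow> L \<le> length xs \<Longrightarrow> prod_list xs \<in> J" by auto
  obtain n where n: "y ^ n \<in> J" using insert.prems by blast
  have prodS: "prod_list xs \<in> S" if "set xs \<subseteq> S" for xs
    using that by (induction xs) (auto intro: one_S mult_S)
  have "prod_list xs \<in> J" if xs: "set xs \<subseteq> insert y C" "L + n \<le> length xs" for xs
  proof -
    let ?m = "length (filter (\<lambda>x. x = y) xs)" and ?ys = "filter (\<lambda>x. x \<noteq> y) xs"
    have split: "prod_list xs = y ^ length (filter (\<lambda>x. x = y) xs) * prod_list (filter (\<lambda>x. x \<noteq> y) xs)" for xs
      by (induction xs) (simp_all add: mult.assoc mult.left_commute)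
    have len: "?m + length ?ys = length xs" by (rule sum_length_filter_compl)
    have ysC: "set ?ys \<subseteq> C" using xs by auto
    consider "n \<le> ?m" | "L \<le> length ?ys" using len xs(2) by linarith
    then show ?thesis
    proof cases
      case 1
      then have eq: "y ^ ?m = y ^ (?m - n) * y ^ n" by (simp flip: power_add)
      show ?thesis unfolding split[of xs] eq using n insert.prems ysC
        by (intro ideal_mult'[OF J] ideal_mult[OF J] power_S prodS) auto
    next
      case 2
      then show ?thesis unfolding split[of xs] using L[OF ysC] insert.prems
        by (intro ideal_mult[OF J] power_S) auto
    qed
  qed
  then show ?case by blast
qed

text \<open>A descending filtration from \<open>S\<close> to \<open>J\<close> that plays the role of the powers of the maximal ideal
  at \<open>p\<close>.\<close>

definition filtration :: "'w \<Rightarrow> ('w \<Rightarrow> 'a) set \<Rightarrow> (nat \<Rightarrow> ('w \<Rightarrow> 'a) set) \<Rightarrow> bool" where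
  "filtration p J K \<longleftrightarrow> (\<forall>t. poly_ideal (K t)) \<and> K 0 = S \<and> (\<exists>L. \<forall>t\<ge>L. K t = J) \<and>
     (\<forall>t. \<forall>f\<in>S. f p = 0 \<longrightarrow> (\<forall>g\<in>K t. f * g \<in> K (Suc t)))"

text \<open>The filtration is \<open>K t\<close> = \<open>J : m^(L - t)\<close>, with
  \<open>m\<close> the maximal ideal at \<open>p\<close> and \<open>L\<close> so large that
  \<open>m^L\<close> lies in \<open>J\<close>. Multiplication by an element of \<open>m\<close>
  shortens the list of test factors by one, and truncated subtraction makes the filtration
  stationary at \<open>J\<close>.\<close>

lemma local_filtration:
  assumes J: "poly_ideal J" and loc: "local_at p J"
  shows "\<exists>K. filtration p J K"
proof -
  define y where "y b = coord b - (\<lambda>w. coord b p)" for b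
  have yS: "y b \<in> S" for b unfolding y_def by (intro diff_S dual_S coord_dual const_S)
  have "\<exists>L. \<forall>xs. set xs \<subseteq> y ` B \<longrightarrow> L \<le> length xs \<longrightarrow> prod_list xs \<in> J"
    using loc yS finite_Basis by (intro nilpotent_prod_list[OF J]) (auto simp: local_at_def y_def)
  then obtain L where L: "\<And>xs. set xs \<subseteq> y ` B \<Longrightarrow> L \<le> length xs \<Longrightarrow> prod_list xs \<in> J" by blast
  define K where "K t = {g \<in> S. \<forall>xs. set xs \<subseteq> y ` B \<longrightarrow> length xs = L - t \<longrightarrow> prod_list xs * g \<in> J}" for t
  have K: "poly_ideal (K t)" for t
    unfolding poly_ideal_def
  proof (intro conjI ballI)
    show "K t \<subseteq> S" unfolding K_def by blast
    show "0 \<in> K t" unfolding K_def using zero_S ideal_0[OF J] by simp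
  next
    fix f g assume "f \<in> K t" "g \<in> K t"
    then show "f + g \<in> K t"
      using add_S ideal_add[OF J] unfolding K_def by (simp add: distrib_left)
  next
    fix f g assume "f \<in> S" "g \<in> K t"
    moreover from this have "prod_list xs * (f * g) \<in> J" if "set xs \<subseteq> y ` B" "length xs = L - t" for xs
      using that ideal_mult[OF J, of f "prod_list xs * g"] unfolding K_def by (simp add: mult.left_commute)
    ultimately show "f * g \<in> K t" unfolding K_def by (simp add: mult_S)
  qed
  have "K 0 = S"
    unfolding K_def using L ideal_mult'[OF J] by simp blast
  moreover have KL: "K t = J" if "L \<le> t" for t
    unfolding K_def using that ideal_S[OF J] by auto
  moreover have "f * g \<in> K (Suc t)" if f: "f \<in> S" "f p = 0" and g: "g \<in> K t" for t f g
  proof (cases "t < L")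
    case False
    then show ?thesis using KL[of t] KL[of "Suc t"] f g ideal_mult[OF J, of f g] by simp
  next
    case True
    obtain f' where f': "\<And>b. f' b \<in> S" "f = (\<lambda>w. f p) + (\<Sum>b\<in>B. y b * f' b)"
      using polys_expand_at[OF f(1), of p] unfolding y_def[symmetric] by (elim exE conjE) (rule that; simp)
    then have eq: "f = (\<Sum>b\<in>B. y b * f' b)" using f(2) by (simp add: fun_eq_iff)
    have "prod_list xs * (f * g) \<in> J" if xs: "set xs \<subseteq> y ` B" "length xs = L - Suc t" for xs
    proof -
      have "prod_list xs * (f * g) = (\<Sum>b\<in>B. f' b * (prod_list (y b # xs) * g))"
        unfolding eq sum_distrib_left sum_distrib_right by (intro sum.cong refl) (simp only: prod_list.Cons mult_ac)
      also have "\<dots> \<in> J"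
      proof (rule ideal_sum[OF J])
        fix b assume "b \<in> B"
        then have "set (y b # xs) \<subseteq> y ` B" "length (y b # xs) = L - t" using xs True by auto
        then have "prod_list (y b # xs) * g \<in> J" using g unfolding K_def by blast
        then show "f' b * (prod_list (y b # xs) * g) \<in> J" by (rule ideal_mult[OF J f'(1)])
      qed
      finally show ?thesis .
    qed
    moreover have "f * g \<in> S" using f g by (simp add: K_def mult_S)
    ultimately show ?thesis unfolding K_def by simp
  qed
  ultimately show ?thesis using K unfolding filtration_def by (intro exI[of _ K]) auto
qed

text \<open>Normalised to value 1 at \<open>p\<close>, the function \<open>g\<close> is
  \<open>1 - z\<close> with \<open>z\<close> vanishing at \<open>p\<close>; the geometric series
  inverts it because \<open>z ^ L\<close> lies in \<open>K L = J\<close>.\<close>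

lemma local_unit:
  assumes J: "poly_ideal J" and loc: "local_at p J" and g: "g \<in> S" "g p \<noteq> 0"
  shows "\<exists>e\<in>S. g * e - 1 \<in> J"
proof -
  obtain K where K: "filtration p J K" using local_filtration[OF J loc] by blast
  then obtain L where L: "K L = J" unfolding filtration_def by blast
  define z where "z = 1 - fscale (1 / g p) g"
  have "z \<in> S" unfolding z_def by (intro diff_S one_S scale_S g)
  moreover have "z p = 0" using g(2) by (simp add: z_def)
  ultimately have z: "z \<in> S" "z p = 0" .
  have zK: "z ^ t \<in> K t" for t 
  proof (induction t)
    case 0
    have "z ^ 0 \<in> K 0" using K one_S unfolding filtration_def by (simp only: power_0)
    then show ?case .
  next
    case (Suc t)
    then show ?case using K z unfolding filtration_def power_Suc by blast
  qed
  let ?e = "fscale (1 / g p) (\<Sum>i<L. z ^ i)"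
  have "g * ?e - 1 = fscale (1 / g p) g * (\<Sum>i<L. z ^ i) - 1" by (simp add: fun_eq_iff)
  also have "\<dots> = - (z ^ L)" using one_diff_power_eq[of z L] unfolding z_def by (simp add: algebra_simps)
  finally have "g * ?e - 1 \<in> J" using zK[of L] L by (simp only: ideal_uminus[OF J])
  moreover have "?e \<in> S" by (intro scale_S sum_S power_S z)
  ultimately show ?thesis by blast
qed

lemma local_cancel:
  assumes J: "poly_ideal J" and loc: "local_at p J" and g: "g \<in> S" "g p \<noteq> 0"
    and x: "x \<in> S" "g * x \<in> J"
  shows "x \<in> J"
proof -
  obtain e where e: "e \<in> S" "g * e - 1 \<in> J" using local_unit[OF J loc g] by blast
  have "x = e * (g * x) - (g * e - 1) * x" by (simp only: algebra_simps mult_1)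
  also have "\<dots> \<in> J"
    by (rule ideal_diff[OF J ideal_mult[OF J e(1) x(2)] ideal_mult'[OF J e(2) x(1)]])
  finally show ?thesis .
qed

subsection \<open>Regular functions near a point and families parametrized by them\<close>

text \<open>A rational function defined at \<open>p\<close>, kept as a total function: where the
  denominator \<open>b\<close> vanishes nothing is required, and \<open>p\<close> itself lies in the
  good set.\<close>

definition reg :: "'w \<Rightarrow> ('w \<Rightarrow> 'a) \<Rightarrow> bool" where
  "reg p \<alpha> \<longleftrightarrow> (\<exists>a\<in>S. \<exists>b\<in>S. b p \<noteq> 0 \<and> (\<forall>q. b q \<noteq> 0 \<longrightarrow> \<alpha> q * b q = a q))"

lemma regI:
  assumes "a \<in> S" "b \<in> S" "b p \<noteq> 0" "\<And>q. b q \<noteq> 0 \<Longrightarrow> \<alpha> q * b q = a q"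
  shows "reg p \<alpha>"
  unfolding reg_def using assms by blast

lemma reg_S: "f \<in> S \<Longrightarrow> reg p f"
  by (rule regI[of f 1]) (auto simp: one_S)

lemma reg_const: "reg p (\<lambda>q. c)"
  by (rule reg_S[OF const_S])

lemma reg_add:
  assumes "reg p \<alpha>" "reg p \<beta>"
  shows "reg p (\<lambda>q. \<alpha> q + \<beta> q)"
proof -
  obtain a b where ab: "a \<in> S" "b \<in> S" "b p \<noteq> 0" "\<forall>q. b q \<noteq> 0 \<longrightarrow> \<alpha> q * b q = a q"
    using assms(1) unfolding reg_def by blast
  obtain a' b' where ab': "a' \<in> S" "b' \<in> S" "b' p \<noteq> 0" "\<forall>q. b' q \<noteq> 0 \<longrightarrow> \<beta> q * b' q = a' q"
    using assms(2) unfolding reg_def by blast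
  show ?thesis
  proof (rule regI[of "a * b' + a' * b" "b * b'"])
    fix q assume "(b * b') q \<noteq> 0"
    then have "\<alpha> q * b q = a q" "\<beta> q * b' q = a' q" using ab(4) ab'(4) by auto
    then show "(\<alpha> q + \<beta> q) * (b * b') q = (a * b' + a' * b) q"
      by (simp add: algebra_simps flip: \<open>\<alpha> q * b q = a q\<close> \<open>\<beta> q * b' q = a' q\<close>)
  qed (use ab ab' in \<open>auto intro: add_S mult_S\<close>)
qed

lemma reg_mult:
  assumes "reg p \<alpha>" "reg p \<beta>"
  shows "reg p (\<lambda>q. \<alpha> q * \<beta> q)"
proof -
  obtain a b where ab: "a \<in> S" "b \<in> S" "b p \<noteq> 0" "\<forall>q. b q \<noteq> 0 \<longrightarrow> \<alpha> q * b q = a q"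
    using assms(1) unfolding reg_def by blast
  obtain a' b' where ab': "a' \<in> S" "b' \<in> S" "b' p \<noteq> 0" "\<forall>q. b' q \<noteq> 0 \<longrightarrow> \<beta> q * b' q = a' q"
    using assms(2) unfolding reg_def by blast
  show ?thesis
  proof (rule regI[of "a * a'" "b * b'"])
    fix q assume "(b * b') q \<noteq> 0"
    then have "\<alpha> q * b q = a q" "\<beta> q * b' q = a' q" using ab(4) ab'(4) by auto
    then show "(\<alpha> q * \<beta> q) * (b * b') q = (a * a') q"
      by (simp add: mult_ac flip: \<open>\<alpha> q * b q = a q\<close> \<open>\<beta> q * b' q = a' q\<close>)
  qed (use ab ab' in \<open>auto intro: mult_S\<close>)
qed

lemma reg_inverse:
  assumes "reg p \<alpha>" "\<alpha> p \<noteq> 0"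
  shows "reg p (\<lambda>q. 1 / \<alpha> q)"
proof -
  obtain a b where ab: "a \<in> S" "b \<in> S" "b p \<noteq> 0" "\<forall>q. b q \<noteq> 0 \<longrightarrow> \<alpha> q * b q = a q"
    using assms(1) unfolding reg_def by blast
  show ?thesis
  \<comment> \<open>The inverse is \<open>b / a\<close>; the common factor \<open>b\<close> ensures
    that a nonzero denominator certifies \<open>b q \<noteq> 0\<close>, where the relation for
    \<open>\<alpha>\<close> is available.\<close>
  proof (rule regI[of "b * b" "a * b"])
    fix q assume "(a * b) q \<noteq> 0"
    then have "\<alpha> q * b q = a q" "b q \<noteq> 0" "\<alpha> q \<noteq> 0" using ab(4)[rule_format, of q] by auto
    then show "1 / \<alpha> q * (a * b) q = (b * b) q"
      by (simp flip: \<open>\<alpha> q * b q = a q\<close>)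
  next
    show "(a * b) p \<noteq> 0" using ab(4)[rule_format, of p] ab(3) assms(2) by auto
  qed (use ab in \<open>auto intro: mult_S\<close>)
qed

lemma reg_nonzero:
  assumes "reg p \<alpha>" "\<alpha> p \<noteq> 0"
  shows "\<exists>g\<in>S. g p \<noteq> 0 \<and> (\<forall>q. g q \<noteq> 0 \<longrightarrow> \<alpha> q \<noteq> 0)"
proof -
  obtain a b where ab: "a \<in> S" "b \<in> S" "b p \<noteq> 0" "\<forall>q. b q \<noteq> 0 \<longrightarrow> \<alpha> q * b q = a q"
    using assms(1) unfolding reg_def by blast
  show ?thesis
  proof (intro bexI[of _ "a * b"] conjI allI impI)
    show "(a * b) p \<noteq> 0" using ab(4)[rule_format, of p] ab(3) assms(2) by auto
    fix q assume "(a * b) q \<noteq> 0"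
    then show "\<alpha> q \<noteq> 0" using ab(4)[rule_format, of q] by auto
  qed (use ab in \<open>auto intro: mult_S\<close>)
qed

lemma reg_minor:
  assumes "\<And>a b. a < t \<Longrightarrow> b < t \<Longrightarrow> reg p (A (\<rho> a) (\<kappa> b))"
  shows "reg p (\<lambda>q. minor (\<lambda>i j. A i j q) t \<rho> \<kappa>)"
proof -
  have "minor A t \<rho> \<kappa> \<in> {\<alpha>. reg p \<alpha>}"
  proof (rule minor_closed)
    show "f + g \<in> {\<alpha>. reg p \<alpha>}" if "f \<in> {\<alpha>. reg p \<alpha>}" "g \<in> {\<alpha>. reg p \<alpha>}" for f g
      using that by (simp add: plus_fun_def reg_add)
    show "f * g \<in> {\<alpha>. reg p \<alpha>}" if "f \<in> {\<alpha>. reg p \<alpha>}" "g \<in> {\<alpha>. reg p \<alpha>}" for f g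
      using that by (simp add: times_fun_def reg_mult)
  qed (use assms in \<open>auto intro: reg_S one_S zero_S uminus_S\<close>)
  then show ?thesis by (simp flip: minor_apply)
qed

text \<open>Cramer's rule with the determinant as \<open>h\<close>: the entries of the inverse are
  cofactors over \<open>h\<close>, hence regular at \<open>p\<close>.\<close>

lemma reg_matrix_inverse:
  assumes D: "\<And>i j. i < c \<Longrightarrow> j < c \<Longrightarrow> D i j \<in> S" and nz: "minor D c id id p \<noteq> 0"
  shows "\<exists>I. \<exists>h\<in>S. h p \<noteq> 0 \<and> (\<forall>i j. reg p (I i j)) \<and>
    (\<forall>q i j. h q \<noteq> 0 \<longrightarrow> i < c \<longrightarrow> j < c \<longrightarrow> (\<Sum>k<c. D i k q * I k j q) = (if i = j then 1 else 0))"
proof -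
  define h where "h = minor D c id id"
  define Dm where "Dm q = mat c c (\<lambda>(i, j). D i j q)" for q
  define skip :: "nat \<Rightarrow> nat \<Rightarrow> nat" where "skip i x = (if x < i then x else Suc x)" for i x
  \<comment> \<open>Zero outside the index range, so that regularity holds for all indices.\<close>
  define I where "I i j q = (if i < c \<and> j < c then adj_mat (Dm q) $$ (i, j) / h q else 0)" for i j q
  have h: "h q = det (Dm q)" for q
    unfolding h_def minor_apply unfolding minor_def Dm_def by simp
  have hS: "h \<in> S" unfolding h_def using D by (intro minor_S) auto
  have adj: "adj_mat (Dm q) $$ (i, j) = (-1) ^ (j + i) * minor (\<lambda>i j. D i j q) (c - 1) (skip j) (skip i)"
    if "i < c" "j < c" for i j q
  proof -
    have "mat_delete (Dm q) j i = mat (c - 1) (c - 1) (\<lambda>(a, b). D (skip j a) (skip i b) q)"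
      using that unfolding Dm_def mat_delete_def skip_def by (intro eq_matI) auto
    then show ?thesis using that by (simp add: adj_mat_def cofactor_def Dm_def minor_def)
  qed
  have "reg p (I i j)" for i j
  proof (cases "i < c \<and> j < c")
    case True
    have "reg p (\<lambda>q. (-1) ^ (j + i) * minor (\<lambda>i j. D i j q) (c - 1) (skip j) (skip i) * (1 / h q))"
      using True nz by (intro reg_mult reg_const reg_minor reg_S D reg_inverse hS) (auto simp: skip_def h_def)
    moreover have "I i j = (\<lambda>q. (-1) ^ (j + i) * minor (\<lambda>i j. D i j q) (c - 1) (skip j) (skip i) * (1 / h q))"
      using True by (auto simp: fun_eq_iff I_def adj)
    ultimately show ?thesis by simp
  next
    case False
    then have "I i j = (\<lambda>q. 0)" by (auto simp: fun_eq_iff I_def)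
    then show ?thesis by (simp add: reg_const)
  qed
  moreover have "(\<Sum>k<c. D i k q * I k j q) = (if i = j then 1 else 0)"
    if q: "h q \<noteq> 0" and ij: "i < c" "j < c" for q i j
  proof -
    have car: "Dm q \<in> carrier_mat c c" by (simp add: Dm_def)
    have car': "adj_mat (Dm q) \<in> carrier_mat c c" by (rule adj_mat(1)[OF car])
    have "(Dm q * adj_mat (Dm q)) $$ (i, j) = (\<Sum>k<c. D i k q * adj_mat (Dm q) $$ (k, j))"
      using ij car car' by (auto simp: scalar_prod_def atLeast0LessThan Dm_def intro!: sum.cong)
    also have "(Dm q * adj_mat (Dm q)) $$ (i, j) = (if i = j then h q else 0)"
      using ij by (simp add: adj_mat(2)[OF car] h)
    finally have "(\<Sum>k<c. D i k q * adj_mat (Dm q) $$ (k, j)) / h q = (if i = j then 1 else 0)"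
      using q by (auto split: if_splits)
    then show ?thesis using ij by (simp add: I_def sum_divide_distrib)
  qed
  ultimately show ?thesis using hS nz
    by (intro exI[of _ I] bexI[of _ h] conjI allI impI) (simp_all add: h_def)
qed

text \<open>Finite sums \<open>\<Sum> \<alpha>(q) \<beta>(w)\<close> with \<open>\<alpha>\<close> regular near \<open>p\<close> and \<open>\<beta>\<close> polynomial; a functional applied
  in \<open>w\<close> leaves a regular function of \<open>q\<close>.\<close>

inductive fam :: "'w \<Rightarrow> ('w \<Rightarrow> 'w \<Rightarrow> 'a) \<Rightarrow> bool" for p where
  base: "reg p \<alpha> \<Longrightarrow> \<beta> \<in> S \<Longrightarrow> fam p (\<lambda>q w. \<alpha> q * \<beta> w)"
| add: "fam p \<Phi> \<Longrightarrow> fam p \<Psi> \<Longrightarrow> fam p (\<lambda>q w. \<Phi> q w + \<Psi> q w)"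

lemma fam_reg: "reg p \<alpha> \<Longrightarrow> fam p (\<lambda>q w. \<alpha> q)"
  using fam.base[OF _ one_S] by simp

lemma fam_S: "\<beta> \<in> S \<Longrightarrow> fam p (\<lambda>q w. \<beta> w)"
  using fam.base[OF reg_const[of p 1]] by simp

lemma fam_sum: "(\<And>x. x \<in> T \<Longrightarrow> fam p (\<Phi> x)) \<Longrightarrow> fam p (\<lambda>q w. \<Sum>x\<in>T. \<Phi> x q w)"
  by (induction T rule: infinite_finite_induct) (auto intro: fam_reg[OF reg_const] fam.add)

lemma fam_mult:
  assumes "fam p \<Phi>" "fam p \<Psi>"
  shows "fam p (\<lambda>q w. \<Phi> q w * \<Psi> q w)"
  using assms(1)
proof induction
  case (base \<alpha> \<beta>)
  show ?case using assms(2)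
  proof induction
    case (base \<alpha>' \<beta>')
    have "fam p (\<lambda>q w. (\<alpha> q * \<alpha>' q) * (\<beta> * \<beta>') w)"
      by (rule fam.base[OF reg_mult[OF \<open>reg p \<alpha>\<close> base(1)] mult_S[OF \<open>\<beta> \<in> S\<close> base(2)]])
    moreover have "(\<lambda>q w. (\<alpha> q * \<alpha>' q) * (\<beta> * \<beta>') w) = (\<lambda>q w. (\<alpha> q * \<beta> w) * (\<alpha>' q * \<beta>' w))"
      by (intro ext) simp
    ultimately show ?case by (simp only:)
  next
    case (add \<Psi> \<Psi>')
    then show ?case using fam.add[OF add.IH] by (simp only: distrib_left)
  qed
next
  case (add \<Phi> \<Phi>')
  then show ?case using fam.add[OF add.IH] by (simp only: distrib_right)
qed

lemma fam_uminus: "fam p \<Phi> \<Longrightarrow> fam p (\<lambda>q w. - \<Phi> q w)"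
  using fam_mult[OF fam_reg[OF reg_const[of p "-1"]]] by simp

lemma fam_polys: "fam p \<Phi> \<Longrightarrow> \<Phi> q \<in> S"
proof (induction rule: fam.induct)
  case (base \<alpha> \<beta>)
  then show ?case by (intro scale_S)
next
  case (add \<Phi> \<Psi>)
  have "\<Phi> q + \<Psi> q \<in> S" using add by (intro add_S)
  then show ?case by (simp add: plus_fun_def)
qed

lemma fam_comp:
  assumes "f \<in> S" "\<And>l. l \<in> dual s \<Longrightarrow> fam p (\<lambda>q w. l (\<theta> q w))"
  shows "fam p (\<lambda>q w. f (\<theta> q w))"
  using assms(1)
proof (induction rule: polys_induct)
  case (const c)
  show ?case by (rule fam_reg[OF reg_const])
next
  case (dual l)
  then show ?case by (rule assms(2))
next
  case (add f g)
  then show ?case using fam.add[OF add.IH] by simp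
next
  case (mult f g)
  then show ?case using fam_mult[OF mult.IH] by simp
qed

text \<open>Functionals live on all functions, not only polynomial ones, so that linearity carries
  no membership conditions.\<close>

definition functional :: "(('w \<Rightarrow> 'a) \<Rightarrow> 'a) \<Rightarrow> bool" where
  "functional \<phi> \<longleftrightarrow> (\<forall>f g. \<phi> (f + g) = \<phi> f + \<phi> g) \<and> (\<forall>c f. \<phi> (fscale c f) = c * \<phi> f)"

lemma functional_add: "functional \<phi> \<Longrightarrow> \<phi> (f + g) = \<phi> f + \<phi> g"
  and functional_scale: "functional \<phi> \<Longrightarrow> \<phi> (fscale c f) = c * \<phi> f"
  unfolding functional_def by blast+

lemma functional_0: "functional \<phi> \<Longrightarrow> \<phi> 0 = 0"
  using functional_scale[of \<phi> 0 0] by (simp add: zero_fun_def)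

lemma functional_diff: "functional \<phi> \<Longrightarrow> \<phi> (f - g) = \<phi> f - \<phi> g"
  using functional_add[of \<phi> "f - g" g] by simp

lemma functional_sum: "functional \<phi> \<Longrightarrow> \<phi> (\<Sum>x\<in>T. f x) = (\<Sum>x\<in>T. \<phi> (f x))"
  by (induction T rule: infinite_finite_induct) (auto simp: functional_0 functional_add)

lemma fam_functional:
  assumes "functional \<phi>" "fam p \<Phi>"
  shows "reg p (\<lambda>q. \<phi> (\<Phi> q))"
  using assms(2)
proof induction
  case (base \<alpha> \<beta>)
  then show ?case
    using reg_mult[OF base(1) reg_const] by (simp add: functional_scale[OF assms(1)])
next
  case (add \<Phi> \<Psi>)
  have "(\<lambda>q. \<phi> (\<lambda>w. \<Phi> q w + \<Psi> q w)) = (\<lambda>q. \<phi> (\<Phi> q) + \<phi> (\<Psi> q))"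
    by (simp add: functional_add[OF assms(1), symmetric] plus_fun_def)
  then show ?case using reg_add[OF add.IH] by simp
qed

subsection \<open>Deforming a point along a smooth variety\<close>

text \<open>Newton's method: the coordinates \<open>y\<close> in the directions \<open>v\<close> correct the translation
  \<open>w \<mapsto> w - p + q\<close> to a map that respects the equations \<open>f\<close> modulo \<open>J\<close>.\<close>

lemma newton_deformation:
  fixes c :: nat and v :: "nat \<Rightarrow> 'w"
  assumes J: "poly_ideal J" and loc: "local_at p J"
    and f: "\<And>i. i < c \<Longrightarrow> f i \<in> J"
    and nz: "minor (\<lambda>i j. differential s (f i) p (v j)) c id id \<noteq> 0"
  shows "\<exists>\<theta>. \<exists>h\<in>S. h p \<noteq> 0 \<and> (\<forall>l\<in>dual s. fam p (\<lambda>q w. l (\<theta> q w))) \<and>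
    (\<forall>l\<in>dual s. (\<lambda>w. l (\<theta> p w)) - l \<in> J) \<and>
    (\<forall>q. (\<forall>i<c. f i q = 0) \<longrightarrow> \<theta> q p = q \<and> (h q \<noteq> 0 \<longrightarrow> (\<forall>i<c. (\<lambda>w. f i (\<theta> q w)) \<in> J)))"
proof -
  have fS: "f i \<in> S" if "i < c" for i using f[OF that] by (rule ideal_S[OF J])
  obtain K where "filtration p J K" using local_filtration[OF J loc] by blast
  then obtain L where K: "\<And>t. poly_ideal (K t)" "K 0 = S" "\<And>t. L \<le> t \<Longrightarrow> K t = J"
    "\<And>t f g. f \<in> S \<Longrightarrow> f p = 0 \<Longrightarrow> g \<in> K t \<Longrightarrow> f * g \<in> K (Suc t)"
    unfolding filtration_def by (elim conjE exE) (metis (full_types))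
  define D where "D i j w = differential s (f i) w (v j)" for i j w
  have DS: "D i j \<in> S" if "i < c" for i j
  proof -
    have "D i j = (\<lambda>w. differential s (f i) w (v j))" by (simp add: D_def fun_eq_iff)
    then show ?thesis using differential_S[OF fS[OF that], of "v j"] by simp
  qed
  have "minor D c id id p \<noteq> 0" using nz by (simp add: minor_apply D_def)
  \<comment> \<open>\<open>I\<close> inverts the Jacobian in the directions \<open>v\<close> at
    \<open>q\<close>. It depends on \<open>q\<close> alone, so corrections built from it remain
    families.\<close>
  from reg_matrix_inverse[of c D p, OF DS this]
  obtain I h where h: "h \<in> S" "h p \<noteq> 0" and I: "\<forall>i j. reg p (I i j)"
    and DI: "\<forall>q i j. h q \<noteq> 0 \<longrightarrow> i < c \<longrightarrow> j < c \<longrightarrow> (\<Sum>k<c. D i k q * I k j q) = (if i = j then 1 else 0)"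
    by blast
  note I = I[rule_format] and DI = DI[rule_format]
  define T where "T y q w = w - p + q + (\<Sum>j<c. s (y j q w) (v j))"
    for y :: "nat \<Rightarrow> 'w \<Rightarrow> 'w \<Rightarrow> 'a" and q w
  have lT: "l (T y q w) = l w + (l q - l p) + (\<Sum>j<c. y j q w * l (v j))" if "l \<in> dual s" for l y q w
    using that by (simp add: T_def dual_add dual_diff dual_sum dual_scale)
  have famT: "fam p (\<lambda>q w. l (T y q w))" if l: "l \<in> dual s" and y: "\<And>j. j < c \<Longrightarrow> fam p (y j)" for l y
  proof -
    have "fam p (\<lambda>q w. \<Sum>j<c. y j q w * l (v j))"
    proof (rule fam_sum)
      fix j assume "j \<in> {..<c}"
      then show "fam p (\<lambda>q w. y j q w * l (v j))"
        by (intro fam_mult[OF y fam_reg[OF reg_const]]) simp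
    qed
    moreover have "reg p (\<lambda>q. l q - l p)"
    proof -
      have "l - (\<lambda>w. l p) \<in> S" by (intro diff_S dual_S const_S l)
      then have "reg p (l - (\<lambda>w. l p))" by (rule reg_S)
      then show ?thesis by (simp add: fun_diff_def)
    qed
    ultimately show ?thesis unfolding lT[OF l]
      by (intro fam.add[OF fam.add[OF fam_S[OF dual_S[OF l]] fam_reg]])
  qed
  have TS: "(\<lambda>w. l (T y q w)) \<in> S" if "l \<in> dual s" "\<And>j. j < c \<Longrightarrow> fam p (y j)" for l y q
    using fam_polys[OF famT[OF that]] .
  have Tp: "T y q p = q" if "\<And>j. j < c \<Longrightarrow> y j q p = 0" for y q
    unfolding T_def using that by simp
  \<comment> \<open>Invariant of the Newton iteration: the corrections lie in \<open>J\<close> for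
    \<open>q = p\<close>, vanish at the point \<open>p\<close> for every \<open>q\<close> solving
    the equations, and solve the equations modulo step \<open>Suc t\<close> of the
    filtration.\<close>
  have ex: "\<exists>y. (\<forall>j<c. fam p (y j)) \<and> (\<forall>j<c. y j p \<in> J) \<and>
      (\<forall>q. (\<forall>i<c. f i q = 0) \<longrightarrow> (\<forall>j<c. y j q p = 0) \<and>
        (h q \<noteq> 0 \<longrightarrow> (\<forall>i<c. (\<lambda>w. f i (T y q w)) \<in> K (Suc t))))" for t
  proof (induction t)
    case 0
    \<comment> \<open>The bare translation sends \<open>p\<close> to \<open>q\<close>, so each
      equation already vanishes at \<open>p\<close> and lies in the first filtration step.\<close>
    let ?y = "\<lambda>(j::nat) (q::'w) (w::'w). 0::'a"
    have y: "fam p (?y j)" for j by (rule fam_reg[OF reg_const])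
    have "(\<lambda>w. f i (T ?y q w)) \<in> K (Suc 0)" if "\<forall>i<c. f i q = 0" "i < c" for q i
    proof -
      have "(\<lambda>w. f i (T ?y q w)) \<in> S"
        by (rule polys_comp[of "f i" "T ?y q", OF fS[OF \<open>i < c\<close>] TS[OF _ y]])
      moreover have "f i (T ?y q p) = 0" using Tp[of ?y q] that by simp
      moreover have "1 \<in> K 0" using K(2) one_S by blast
      ultimately have "(\<lambda>w. f i (T ?y q w)) * 1 \<in> K (Suc 0)" by (rule K(4))
      then show ?thesis by (simp only: mult_1_right)
    qed
    moreover have "(\<lambda>w. 0) \<in> J" using ideal_0[OF J] by (simp only: zero_fun_def)
    ultimately show ?case using y by (intro exI[of _ ?y]) simp
  next
    case (Suc t)
    then obtain y where y: "\<And>j. j < c \<Longrightarrow> fam p (y j)" "\<And>j. j < c \<Longrightarrow> y j p \<in> J"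
      "\<And>q j. \<forall>i<c. f i q = 0 \<Longrightarrow> j < c \<Longrightarrow> y j q p = 0"
      "\<And>q i. \<forall>i<c. f i q = 0 \<Longrightarrow> h q \<noteq> 0 \<Longrightarrow> i < c \<Longrightarrow> (\<lambda>w. f i (T y q w)) \<in> K (Suc t)"
      by blast
    define X where "X i q w = f i (T y q w)" for i q w
    \<comment> \<open>Newton correction with the Jacobian frozen at \<open>q\<close> instead of
      evaluated at \<open>T y q w\<close>. The discrepancy vanishes at \<open>p\<close>, so its
      product with \<open>\<delta>\<close> is negligible at the next order.\<close>
    define \<delta> where "\<delta> j q w = - (\<Sum>i<c. I j i q * X i q w)" for j q w
    define y' where "y' j q w = y j q w + \<delta> j q w" for j q w
    have famX: "fam p (X i)" if "i < c" for i
    proof -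
      have "X i = (\<lambda>q w. f i (T y q w))" by (simp add: fun_eq_iff X_def)
      then show ?thesis using fam_comp[of "f i" p "T y", OF fS[OF that] famT[OF _ y(1)]] by simp
    qed
    have fam\<delta>: "fam p (\<delta> j)" for j
    proof -
      have "fam p (\<lambda>q w. \<Sum>i<c. I j i q * X i q w)"
      proof (rule fam_sum)
        fix i assume "i \<in> {..<c}"
        then show "fam p (\<lambda>q w. I j i q * X i q w)"
          by (intro fam_mult[OF fam_reg[OF I] famX]) simp
      qed
      then have "fam p (\<lambda>q w. - (\<Sum>i<c. I j i q * X i q w))" by (rule fam_uminus)
      moreover have "\<delta> j = (\<lambda>q w. - (\<Sum>i<c. I j i q * X i q w))" by (simp add: fun_eq_iff \<delta>_def)
      ultimately show ?thesis by (simp only:)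
    qed
    have famy': "fam p (y' j)" if "j < c" for j
    proof -
      have "y' j = (\<lambda>q w. y j q w + \<delta> j q w)" by (simp add: fun_eq_iff y'_def)
      then show ?thesis using fam.add[OF y(1)[OF that] fam\<delta>] by (simp only:)
    qed
    have \<delta>_eq: "\<delta> j q = - (\<Sum>i<c. fscale (I j i q) (X i q))" for j q
      by (simp add: fun_eq_iff \<delta>_def sum_fun_apply)
    \<comment> \<open>For \<open>q = p\<close> the current map is the identity modulo
      \<open>J\<close>, so the residuals \<open>X i p\<close> are congruent to \<open>f i\<close>
      and lie in \<open>J\<close>.\<close>
    have \<delta>p: "\<delta> j p \<in> J" for j
    proof -
      have "X i p \<in> J" if i: "i < c" for i
      proof -
        have "(\<lambda>w. f i (T y p w)) - (\<lambda>w. f i (id w)) \<in> J"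
        proof (rule comp_cong_ideal[OF J fS[OF i]])
          fix l assume l: "l \<in> dual s"
          show "(\<lambda>w. l (T y p w)) \<in> S" by (rule TS[OF l y(1)])
          show "(\<lambda>w. l (id w)) \<in> S" using dual_S[OF l] by simp
          have "(\<lambda>w. l (T y p w)) - (\<lambda>w. l (id w)) = (\<Sum>j<c. fscale (l (v j)) (y j p))"
            by (simp add: fun_eq_iff lT[OF l] sum_fun_apply mult.commute)
          also have "\<dots> \<in> J" by (intro ideal_sum[OF J] ideal_scale[OF J] y(2)) simp
          finally show "(\<lambda>w. l (T y p w)) - (\<lambda>w. l (id w)) \<in> J" .
        qed
        moreover have "X i p = (\<lambda>w. f i (T y p w))" by (simp add: fun_eq_iff X_def)
        moreover have "f i = (\<lambda>w. f i (id w))" by simp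
        ultimately have "X i p - f i \<in> J" by argo
        from ideal_add[OF J this f[OF i]] show ?thesis by (simp only: diff_add_cancel)
      qed
      then show ?thesis unfolding \<delta>_eq
        by (intro ideal_uminus[OF J] ideal_sum[OF J] ideal_scale[OF J]) simp
    qed
    have "y' j p \<in> J" if "j < c" for j
    proof -
      have "y' j p = y j p + \<delta> j p" by (simp add: fun_eq_iff y'_def)
      then show ?thesis using ideal_add[OF J y(2)[OF that] \<delta>p] by (simp only:)
    qed
    moreover have y'p: "y' j q p = 0" if q: "\<forall>i<c. f i q = 0" and j: "j < c" for q j
    proof -
      have "T y q p = q" by (rule Tp) (rule y(3)[OF q])
      then show ?thesis using q y(3)[OF q j] by (simp add: y'_def \<delta>_def X_def)
    qed
    moreover have "(\<lambda>w. f i (T y' q w)) \<in> K (Suc (Suc t))"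
      if q: "\<forall>i<c. f i q = 0" and hq: "h q \<noteq> 0" and i: "i < c" for q i
    proof -
      note K2 = K(1)[of "Suc (Suc t)"]
      have XK: "X k q \<in> K (Suc t)" if "k < c" for k
      proof -
        have "X k q = (\<lambda>w. f k (T y q w))" by (simp add: fun_eq_iff X_def)
        then show ?thesis using y(4)[OF q hq that] by (simp only:)
      qed
      have \<delta>K: "\<delta> j q \<in> K (Suc t)" for j
        unfolding \<delta>_eq using XK
        by (intro ideal_uminus[OF K(1)] ideal_sum[OF K(1)] ideal_scale[OF K(1)]) simp
      have \<delta>S: "\<delta> j q \<in> S" for j by (rule ideal_S[OF K(1) \<delta>K])
      have \<delta>0: "\<delta> j q p = 0" if "j < c" for j
        using y'p[OF q that] y(3)[OF q that] by (simp add: y'_def)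
      have T': "T y' q w = T y q w + (\<Sum>j<c. s (\<delta> j q w) (v j))" for w
        unfolding T_def y'_def by (simp add: scale_left_distrib sum.distrib add.assoc)
      \<comment> \<open>Products of two corrections gain one order, because each correction vanishes
        at \<open>p\<close> and lies in \<open>K (Suc t)\<close>. Hence the first-order expansion is
        valid modulo \<open>K (Suc (Suc t))\<close>.\<close>
      have "(\<lambda>w. f i (T y q w + (\<Sum>j<c. s (\<delta> j q w) (v j)))) - (\<lambda>w. f i (T y q w)) -
          (\<Sum>j<c. (\<lambda>w. differential s (f i) (T y q w) (v j)) * \<delta> j q) \<in> K (Suc (Suc t))"
        by (rule taylor_ideal[OF K2 fS[OF i], of "T y q" c "\<lambda>j. \<delta> j q"])
          (use TS[OF _ y(1)] \<delta>S \<delta>0 \<delta>K K(4) in auto)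
      moreover have "(\<Sum>j<c. ((\<lambda>w. D i j (T y q w)) - (\<lambda>w. D i j q)) * \<delta> j q) \<in> K (Suc (Suc t))"
      proof (rule ideal_sum[OF K2])
        fix j assume "j \<in> {..<c}"
        have "(\<lambda>w. D i j (T y q w)) \<in> S"
          by (rule polys_comp[of "D i j" "T y q", OF DS[OF i] TS[OF _ y(1)]])
        then have "(\<lambda>w. D i j (T y q w)) - (\<lambda>w. D i j q) \<in> S" by (rule diff_S[OF _ const_S])
        moreover have "T y q p = q" by (rule Tp) (rule y(3)[OF q])
        ultimately show "((\<lambda>w. D i j (T y q w)) - (\<lambda>w. D i j q)) * \<delta> j q \<in> K (Suc (Suc t))"
          by (intro K(4) \<delta>K) auto
      qed
      moreover have "(\<lambda>w. f i (T y' q w)) =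
          ((\<lambda>w. f i (T y q w + (\<Sum>j<c. s (\<delta> j q w) (v j)))) - (\<lambda>w. f i (T y q w)) -
            (\<Sum>j<c. (\<lambda>w. differential s (f i) (T y q w) (v j)) * \<delta> j q)) +
          (\<Sum>j<c. ((\<lambda>w. D i j (T y q w)) - (\<lambda>w. D i j q)) * \<delta> j q)"
      proof
        fix w
        have "(\<Sum>j<c. D i j q * \<delta> j q w) = - (\<Sum>j<c. \<Sum>k<c. D i j q * I j k q * X k q w)"
          unfolding \<delta>_def by (simp add: sum_distrib_left sum_negf mult.assoc)
        also have "(\<Sum>j<c. \<Sum>k<c. D i j q * I j k q * X k q w) = (\<Sum>k<c. (\<Sum>j<c. D i j q * I j k q) * X k q w)"
          unfolding sum_distrib_right by (rule sum.swap)
        also have "\<dots> = (\<Sum>k<c. (if i = k then 1 else 0) * X k q w)"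
          by (intro sum.cong refl) (simp add: DI[OF hq i])
        also have "\<dots> = X i q w" using i by (simp add: if_distrib[of "\<lambda>x. x * _"] cong: if_cong)
        finally show "(\<lambda>w. f i (T y' q w)) w =
          (((\<lambda>w. f i (T y q w + (\<Sum>j<c. s (\<delta> j q w) (v j)))) - (\<lambda>w. f i (T y q w)) -
            (\<Sum>j<c. (\<lambda>w. differential s (f i) (T y q w) (v j)) * \<delta> j q)) +
          (\<Sum>j<c. ((\<lambda>w. D i j (T y q w)) - (\<lambda>w. D i j q)) * \<delta> j q)) w"
          by (simp add: T' X_def sum_fun_apply left_diff_distrib sum_subtractf flip: D_def)
      qed
      ultimately show ?thesis using ideal_add[OF K2] by (simp only:)
    qed
    ultimately show ?case using famy' by (intro exI[of _ y']) blast
  qed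
  obtain y where y: "\<And>j. j < c \<Longrightarrow> fam p (y j)" "\<And>j. j < c \<Longrightarrow> y j p \<in> J"
    "\<And>q j. \<forall>i<c. f i q = 0 \<Longrightarrow> j < c \<Longrightarrow> y j q p = 0"
    "\<And>q i. \<forall>i<c. f i q = 0 \<Longrightarrow> h q \<noteq> 0 \<Longrightarrow> i < c \<Longrightarrow> (\<lambda>w. f i (T y q w)) \<in> K (Suc L)"
    using ex[of L] by blast
  have KL: "K (Suc L) = J" by (rule K(3)) simp
  have "(\<lambda>w. l (T y p w)) - l \<in> J" if l: "l \<in> dual s" for l
  proof -
    have "(\<lambda>w. l (T y p w)) - l = (\<Sum>j<c. fscale (l (v j)) (y j p))"
      by (simp add: fun_eq_iff lT[OF l] sum_fun_apply mult.commute)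
    also have "\<dots> \<in> J" by (intro ideal_sum[OF J] ideal_scale[OF J] y(2)) simp
    finally show ?thesis .
  qed
  moreover have "T y q p = q" if "\<forall>i<c. f i q = 0" for q
    by (rule Tp) (rule y(3)[OF that])
  moreover have "fam p (\<lambda>q w. l (T y q w))" if "l \<in> dual s" for l
    by (rule famT[OF that y(1)])
  moreover have "(\<lambda>w. f i (T y q w)) \<in> J" if "\<forall>i<c. f i q = 0" "h q \<noteq> 0" "i < c" for q i
    using y(4)[OF that] KL by simp
  ultimately show ?thesis using h
    by (intro exI[of _ "T y"] bexI[of _ h] conjI ballI allI impI)
qed

section \<open>Rank bound for an ideal supported at one smooth point\<close>

text \<open>The affine counterpart of \<open>smooth_at\<close>: \<open>Z\<close> will be the cone
  over \<open>X\<close> without its vertex. Homogeneity is dropped because the pulled-back functions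
  do not have it.\<close>

definition smooth_point :: "'w set \<Rightarrow> 'w \<Rightarrow> bool" where
  "smooth_point Z p \<longleftrightarrow>
     (\<exists>(c::nat) f. \<exists>h\<in>S. h p \<noteq> 0 \<and>
        (\<forall>i<c. f i \<in> S \<and> (\<forall>w\<in>Z. f i w = 0)) \<and>
        (\<forall>g\<in>S. (\<forall>w\<in>Z. g w = 0) \<longrightarrow> (\<exists>a. (\<forall>i<c. a i \<in> S) \<and> h * g = (\<Sum>i<c. a i * f i))) \<and>
        (\<forall>b. (\<forall>v. (\<Sum>i<c. b i * differential s (f i) p v) = 0) \<longrightarrow> (\<forall>i<c. b i = 0)))"

definition spanned_mod :: "nat \<Rightarrow> ('w \<Rightarrow> 'a) set \<Rightarrow> (nat \<Rightarrow> 'w \<Rightarrow> 'a) \<Rightarrow> bool" where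
  "spanned_mod r J \<beta> \<longleftrightarrow> (\<forall>i<r. \<beta> i \<in> S) \<and> (\<forall>g\<in>S. \<exists>c. g - (\<Sum>i<r. fscale (c i) (\<beta> i)) \<in> J)"

text \<open>Expanding the second factor in the spanning family writes
  \<open>\<phi> (P i a * Q a j)\<close> as a sum in which \<open>i\<close> and \<open>j\<close>
  separate. The inner indices are pairs, \<open>v * r\<close> in number, which is the origin of the
  product \<open>k * r\<close>.\<close>

lemma minor_functional_eq_0:
  assumes J: "poly_ideal J" and \<phi>: "functional \<phi>" "\<And>f. f \<in> J \<Longrightarrow> \<phi> f = 0"
    and \<beta>: "spanned_mod r J \<beta>"
    and P: "\<And>i a. a < v \<Longrightarrow> P i a \<in> S" and Q: "\<And>a j. a < v \<Longrightarrow> Q a j \<in> S"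
    and A: "\<And>i j. A i j - (\<Sum>a<v. P i a * Q a j) \<in> J" and v: "v \<le> k"
  shows "minor (\<lambda>i j. \<phi> (A i j)) (Suc (k * r)) \<rho> \<kappa> = 0"
proof -
  have "\<forall>a j. \<exists>d. a < v \<longrightarrow> Q a j - (\<Sum>t<r. fscale (d t) (\<beta> t)) \<in> J"
    using \<beta> Q unfolding spanned_mod_def by blast
  then obtain d where d: "\<And>a j. a < v \<Longrightarrow> Q a j - (\<Sum>t<r. fscale (d a j t) (\<beta> t)) \<in> J" by metis
  have "\<phi> (A i j) = (\<Sum>x\<in>{..<v} \<times> {..<r}. \<phi> (P i (fst x) * \<beta> (snd x)) * d (fst x) j (snd x))" for i j
  proof -
    have expand: "\<phi> (P i a * Q a j) = (\<Sum>t<r. d a j t * \<phi> (P i a * \<beta> t))" if a: "a < v" for a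
    proof -
      have "P i a * (Q a j - (\<Sum>t<r. fscale (d a j t) (\<beta> t))) \<in> J"
        by (rule ideal_mult[OF J P[OF a] d[OF a]])
      then have "\<phi> (P i a * Q a j - P i a * (\<Sum>t<r. fscale (d a j t) (\<beta> t))) = 0"
        unfolding right_diff_distrib by (rule \<phi>(2))
      then have "\<phi> (P i a * Q a j) = \<phi> (P i a * (\<Sum>t<r. fscale (d a j t) (\<beta> t)))"
        by (simp only: functional_diff[OF \<phi>(1)] right_minus_eq)
      also have "P i a * (\<Sum>t<r. fscale (d a j t) (\<beta> t)) = (\<Sum>t<r. fscale (d a j t) (P i a * \<beta> t))"
        by (simp add: fun_eq_iff sum_fun_apply sum_distrib_left mult.left_commute)
      finally show ?thesis by (simp only: functional_sum[OF \<phi>(1)] functional_scale[OF \<phi>(1)])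
    qed
    have "\<phi> (A i j - (\<Sum>a<v. P i a * Q a j)) = 0" by (rule \<phi>(2)[OF A])
    then have "\<phi> (A i j) = (\<Sum>a<v. \<phi> (P i a * Q a j))"
      by (simp only: functional_diff[OF \<phi>(1)] functional_sum[OF \<phi>(1)] right_minus_eq)
    also have "\<dots> = (\<Sum>a<v. \<Sum>t<r. \<phi> (P i a * \<beta> t) * d a j t)"
      by (intro sum.cong refl) (simp only: expand lessThan_iff mult.commute)
    also have "\<dots> = (\<Sum>x\<in>{..<v} \<times> {..<r}. \<phi> (P i (fst x) * \<beta> (snd x)) * d (fst x) j (snd x))"
      by (simp add: sum.cartesian_product case_prod_beta)
    finally show ?thesis .
  qed
  then show ?thesis
    by (rule minor_factor_eq_0[where T = "{..<v} \<times> {..<r}", rotated 2])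
      (use v in \<open>auto simp: card_cartesian_product\<close>)
qed

lemma local_rank_bound:
  fixes M :: "nat \<Rightarrow> nat \<Rightarrow> 'w \<Rightarrow> 'a"
  assumes p: "p \<in> Z" and smooth: "smooth_point Z p"
    and M: "\<And>i j. M i j \<in> dual s"
    and rank: "\<And>q \<rho> \<kappa>. q \<in> Z \<Longrightarrow> minor (\<lambda>i j. M i j q) (Suc k) \<rho> \<kappa> = 0"
    and J: "poly_ideal J" and loc: "local_at p J"
    and ZJ: "\<And>g. g \<in> S \<Longrightarrow> (\<forall>w\<in>Z. g w = 0) \<Longrightarrow> g \<in> J"
    and \<phi>: "functional \<phi>" "\<And>f. f \<in> J \<Longrightarrow> \<phi> f = 0"
    and \<beta>: "spanned_mod r J \<beta>"
  shows "minor (\<lambda>i j. \<phi> (M i j)) (Suc (k * r)) \<rho> \<kappa> = 0"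
proof (rule ccontr)
  assume nonzero: "minor (\<lambda>i j. \<phi> (M i j)) (Suc (k * r)) \<rho> \<kappa> \<noteq> 0"
  obtain c :: nat and f h where h: "h \<in> S" "h p \<noteq> 0"
    and f: "\<forall>i<c. f i \<in> S \<and> (\<forall>w\<in>Z. f i w = 0)"
    and gen: "\<forall>g\<in>S. (\<forall>w\<in>Z. g w = 0) \<longrightarrow> (\<exists>a. (\<forall>i<c. a i \<in> S) \<and> h * g = (\<Sum>i<c. a i * f i))"
    and indep: "\<forall>b. (\<forall>v. (\<Sum>i<c. b i * differential s (f i) p v) = 0) \<longrightarrow> (\<forall>i<c. b i = 0)"
    using smooth unfolding smooth_point_def by blast
  have fJ: "f i \<in> J" if "i < c" for i using ZJ[of "f i"] f that by blast
  have "\<exists>v. minor (\<lambda>i j. differential s (f i) p (v j)) c id id \<noteq> 0"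
    by (rule independent_functionals_minor) (use f indep differential_linear in auto)
  then obtain v where v: "minor (\<lambda>i j. differential s (f i) p (v j)) c id id \<noteq> 0" by blast
  obtain \<theta> h1 where h1: "h1 \<in> S" "h1 p \<noteq> 0"
    and fam: "\<forall>l\<in>dual s. fam p (\<lambda>q w. l (\<theta> q w))"
    and \<theta>p: "\<forall>l\<in>dual s. (\<lambda>w. l (\<theta> p w)) - l \<in> J"
    and \<theta>: "\<forall>q. (\<forall>i<c. f i q = 0) \<longrightarrow> \<theta> q p = q \<and> (h1 q \<noteq> 0 \<longrightarrow> (\<forall>i<c. (\<lambda>w. f i (\<theta> q w)) \<in> J))"
    using newton_deformation[OF J loc fJ v] by blast
  have compS: "(\<lambda>w. g (\<theta> q w)) \<in> S" if "g \<in> S" for g q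
    by (rule polys_comp[of g "\<theta> q", OF that]) (use fam fam_polys in blast)
  define N where "N i j q = \<phi> (\<lambda>w. M i j (\<theta> q w))" for i j q
  have regN: "reg p (N i j)" for i j
  proof -
    have "reg p (\<lambda>q. \<phi> (\<lambda>w. M i j (\<theta> q w)))"
      using fam M by (intro fam_functional[OF \<phi>(1), of p "\<lambda>q w. M i j (\<theta> q w)"]) blast
    moreover have "N i j = (\<lambda>q. \<phi> (\<lambda>w. M i j (\<theta> q w)))" by (simp add: fun_eq_iff N_def)
    ultimately show ?thesis by (simp only:)
  qed
  \<comment> \<open>At \<open>q = p\<close> the family gives back the original matrix, because
    \<open>\<theta> p\<close> is the identity modulo \<open>J\<close>; a nonzero minor there
    persists on a neighbourhood.\<close>
  have Np: "N i j p = \<phi> (M i j)" for i j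
    using \<phi>(2)[OF \<theta>p[rule_format, OF M[of i j]]] by (simp add: N_def functional_diff[OF \<phi>(1)])
  have "reg p (\<lambda>q. minor (\<lambda>i j. N i j q) (Suc (k * r)) \<rho> \<kappa>)" by (rule reg_minor[OF regN])
  moreover have "minor (\<lambda>i j. N i j p) (Suc (k * r)) \<rho> \<kappa> \<noteq> 0" unfolding Np by (rule nonzero)
  ultimately obtain h2 where h2: "h2 \<in> S" "h2 p \<noteq> 0"
    "\<forall>q. h2 q \<noteq> 0 \<longrightarrow> minor (\<lambda>i j. N i j q) (Suc (k * r)) \<rho> \<kappa> \<noteq> 0"
    using reg_nonzero by blast
  \<comment> \<open>\<open>full t\<close>: rank \<open>t\<close> occurs on \<open>Z\<close> arbitrarily close to \<open>p\<close>\<close>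
  define full where "full t \<longleftrightarrow> (\<forall>g\<in>S. g p \<noteq> 0 \<longrightarrow>
    (\<exists>q\<in>Z. g q \<noteq> 0 \<and> (\<exists>\<rho> \<kappa>. minor (\<lambda>i j. M i j q) t \<rho> \<kappa> \<noteq> 0)))" for t
  \<comment> \<open>The rank sought is \<open>u - 1\<close>: the least failing size is at most
    \<open>Suc k\<close> by the rank hypothesis, and positive because the empty minor is 1.\<close>
  define u where "u = (LEAST t. \<not> full t)"
  have "\<not> full (Suc k)" unfolding full_def using rank one_S by (auto intro!: bexI[of _ 1])
  then have u: "\<not> full u" "u \<le> Suc k"
    unfolding u_def by (rule LeastI[of "\<lambda>t. \<not> full t"], rule Least_le[of "\<lambda>t. \<not> full t"])
  have "full 0" unfolding full_def using p by auto
  then have "u \<noteq> 0" using u(1) by (cases u) auto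
  then obtain t where t: "u = Suc t" "t \<le> k" using u(2) by (cases u) auto
  have "full t" using not_less_Least[of t "\<lambda>t. \<not> full t"] t by (auto simp: u_def)
  obtain h3 where h3: "h3 \<in> S" "h3 p \<noteq> 0"
    "\<And>q \<rho> \<kappa>. q \<in> Z \<Longrightarrow> h3 q \<noteq> 0 \<Longrightarrow> minor (\<lambda>i j. M i j q) (Suc t) \<rho> \<kappa> = 0"
    using u(1) unfolding t full_def by blast
  \<comment> \<open>One point \<open>q\<close> of \<open>Z\<close> serves four purposes: the
    \<open>f i\<close> generate the ideal of \<open>Z\<close> there, the deformation respects them
    modulo \<open>J\<close>, the nonzero minor of \<open>N\<close> persists, and no rank above
    \<open>t\<close> occurs.\<close>
  have "h * h1 * h2 * h3 \<in> S" "(h * h1 * h2 * h3) p \<noteq> 0"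
    using h h1 h2 h3 by (auto intro!: mult_S)
  with \<open>full t\<close> obtain q \<rho>' \<kappa>' where q: "q \<in> Z" "(h * h1 * h2 * h3) q \<noteq> 0"
    "minor (\<lambda>i j. M i j q) t \<rho>' \<kappa>' \<noteq> 0"
    unfolding full_def by blast
  then have hq: "h q \<noteq> 0" "h1 q \<noteq> 0" "h2 q \<noteq> 0" "h3 q \<noteq> 0" by auto
  have fq: "\<forall>i<c. f i q = 0" using f q(1) by blast
  then have \<theta>q: "\<theta> q p = q" and f\<theta>: "\<And>i. i < c \<Longrightarrow> (\<lambda>w. f i (\<theta> q w)) \<in> J"
    using \<theta> hq by blast+
  note cancel = local_cancel[OF J loc]
  \<comment> \<open>Only the generators \<open>f i\<close> are known to be respected. The factor
    \<open>h (\<theta> q w)\<close> has value \<open>h q\<close> at \<open>p\<close>, so it is a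
    unit modulo \<open>J\<close> and can be cancelled.\<close>
  have van: "(\<lambda>w. g (\<theta> q w)) \<in> J" if g: "g \<in> S" "\<forall>w\<in>Z. g w = 0" for g
  proof (rule cancel)
    obtain a where a: "\<forall>i<c. a i \<in> S" "h * g = (\<Sum>i<c. a i * f i)" using gen g by blast
    have "(\<lambda>w. h (\<theta> q w)) * (\<lambda>w. g (\<theta> q w)) = (\<Sum>i<c. (\<lambda>w. a i (\<theta> q w)) * (\<lambda>w. f i (\<theta> q w)))"
    proof
      fix w
      have "h (\<theta> q w) * g (\<theta> q w) = (\<Sum>i<c. a i * f i) (\<theta> q w)" by (simp only: a(2)[symmetric] times_fun_apply)
      then show "((\<lambda>w. h (\<theta> q w)) * (\<lambda>w. g (\<theta> q w))) w = (\<Sum>i<c. (\<lambda>w. a i (\<theta> q w)) * (\<lambda>w. f i (\<theta> q w))) w"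
        by (simp add: sum_fun_apply)
    qed
    also have "\<dots> \<in> J"
      using a(1) f\<theta> by (intro ideal_sum[OF J] ideal_mult[OF J] compS) auto
    finally show "(\<lambda>w. h (\<theta> q w)) * (\<lambda>w. g (\<theta> q w)) \<in> J" .
  qed (use h g hq \<theta>q in \<open>auto intro: compS\<close>)
  define A where "A i j w = M i j (\<theta> q w)" for i j w
  have AS: "A i j \<in> S" for i j
  proof -
    have "A i j = (\<lambda>w. M i j (\<theta> q w))" by (simp add: fun_eq_iff A_def)
    then show ?thesis using compS[OF dual_S[OF M]] by simp
  qed
  have minorA: "minor A t \<rho> \<kappa> = (\<lambda>w. minor M t \<rho> \<kappa> (\<theta> q w))" for t \<rho> \<kappa>
    by (simp add: fun_eq_iff minor_apply A_def)
  have minorM: "minor M t \<rho> \<kappa> \<in> S" for t \<rho> \<kappa> by (intro minor_S dual_S M)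
  \<comment> \<open>The larger minors of \<open>M\<close> are known to vanish only on
    \<open>Z\<close> near \<open>p\<close>; multiplied by \<open>h3\<close> they vanish on all of
    \<open>Z\<close>, and \<open>h3 (\<theta> q w)\<close> is again a unit modulo
    \<open>J\<close>.\<close>
  have big: "minor A (Suc t) \<rho> \<kappa> \<in> J" for \<rho> \<kappa>
  proof (rule cancel)
    have "(\<lambda>w. (h3 * minor M (Suc t) \<rho> \<kappa>) (\<theta> q w)) \<in> J"
    proof (rule van)
      show "\<forall>w\<in>Z. (h3 * minor M (Suc t) \<rho> \<kappa>) w = 0"
      proof
        fix w assume "w \<in> Z"
        then show "(h3 * minor M (Suc t) \<rho> \<kappa>) w = 0"
          using h3(3)[of w] by (cases "h3 w = 0") (simp_all add: minor_apply)
      qed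
    qed (intro mult_S h3 minorM)
    then show "(\<lambda>w. h3 (\<theta> q w)) * minor A (Suc t) \<rho> \<kappa> \<in> J" by (simp only: minorA times_fun_def)
  qed (use h3 hq \<theta>q in \<open>auto intro: compS minor_S AS\<close>)
  \<comment> \<open>Its value at \<open>p\<close> is the chosen \<open>t\<close>-minor of
    \<open>M\<close> at \<open>q\<close>, so it is invertible modulo \<open>J\<close> and the
    bordered minors can be solved for \<open>A i j\<close>.\<close>
  define \<mu> where "\<mu> = minor A t \<rho>' \<kappa>'"
  have \<mu>: "\<mu> \<in> S" "\<mu> p \<noteq> 0"
    unfolding \<mu>_def using q(3) by (auto intro: minor_S AS simp: minor_apply A_def \<theta>q)
  obtain e where e: "e \<in> S" "\<mu> * e - 1 \<in> J" using local_unit[OF J loc \<mu>] by blast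
  define C where "C i a = (-1) ^ (a + t) * minor A t (\<lambda>x. (\<rho>'(t := i)) (if x < a then x else Suc x)) \<kappa>'" for i a
  have CS: "C i a \<in> S" for i a
    unfolding C_def by (intro mult_S power_S uminus_S one_S minor_S AS)
  have "A i j - (\<Sum>a<t. - (C i a * e) * A (\<rho>' a) j) \<in> J" for i j
  proof -
    have "minor A (Suc t) (\<rho>'(t := i)) (\<kappa>'(t := j)) = A i j * \<mu> + (\<Sum>a<t. A (\<rho>' a) j * C i a)"
      unfolding minor_bordered \<mu>_def C_def by simp
    then have "A i j * \<mu> + (\<Sum>a<t. A (\<rho>' a) j * C i a) \<in> J" using big by metis
    from ideal_diff[OF J ideal_mult[OF J e(1) this] ideal_mult[OF J AS e(2)]]
    have "e * (A i j * \<mu> + (\<Sum>a<t. A (\<rho>' a) j * C i a)) - A i j * (\<mu> * e - 1) \<in> J" .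
    moreover have "e * (A i j * \<mu> + (\<Sum>a<t. A (\<rho>' a) j * C i a)) - A i j * (\<mu> * e - 1) =
        A i j + e * (\<Sum>a<t. A (\<rho>' a) j * C i a)"
      by (simp only: algebra_simps mult_1)
    moreover have "e * (\<Sum>a<t. A (\<rho>' a) j * C i a) = - (\<Sum>a<t. - (C i a * e) * A (\<rho>' a) j)"
      unfolding sum_negf[symmetric] sum_distrib_left by (intro sum.cong refl) (simp only: mult_ac mult_minus_left mult_minus_right minus_minus)
    ultimately show ?thesis by (simp only: diff_conv_add_uminus)
  qed
  then have "minor (\<lambda>i j. \<phi> (A i j)) (Suc (k * r)) \<rho> \<kappa> = 0"
    using CS e AS t(2)
    by (intro minor_functional_eq_0[OF J \<phi> \<beta>, of t "\<lambda>i a. - (C i a * e)" "\<lambda>a j. A (\<rho>' a) j"]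
      uminus_S mult_S)
  moreover have "\<phi> (A i j) = N i j q" for i j
    unfolding N_def by (rule arg_cong[of _ _ \<phi>]) (simp add: fun_eq_iff A_def)
  ultimately show False using h2(3) hq(3) by simp
qed

end

section \<open>Rank as length of a factorization; coprime polynomials\<close>

text \<open>Rank at most \<open>t\<close> for a matrix with infinitely many rows and columns, in a
  form that is visibly additive and has no dimensions to track.\<close>

definition factors :: "(nat \<Rightarrow> nat \<Rightarrow> 'a::field) \<Rightarrow> nat \<Rightarrow> bool" where
  "factors A t \<longleftrightarrow> (\<exists>P Q. \<forall>i j. A i j = (\<Sum>s<t. P i s * Q s j))"

lemma factors_add:
  assumes "factors A t" "factors A' t'"
  shows "factors (\<lambda>i j. A i j + A' i j) (t + t')"
proof -
  obtain P Q P' Q' where PQ: "\<And>i j. A i j = (\<Sum>s<t. P i s * Q s j)"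
    and PQ': "\<And>i j. A' i j = (\<Sum>s<t'. P' i s * Q' s j)"
    using assms unfolding factors_def by metis
  have split: "(\<Sum>s<t + t'. g s) = (\<Sum>s<t. g s) + (\<Sum>s<t'. g (t + s))" for g :: "nat \<Rightarrow> 'a"
    by (induction t') (simp_all add: add.assoc)
  have "A i j + A' i j =
      (\<Sum>s<t + t'. (if s < t then P i s else P' i (s - t)) * (if s < t then Q s j else Q' (s - t) j))" for i j
    unfolding PQ PQ' split by simp
  then show ?thesis unfolding factors_def
    by (intro exI[of _ "\<lambda>i s. if s < t then P i s else P' i (s - t)"]
        exI[of _ "\<lambda>s j. if s < t then Q s j else Q' (s - t) j"]) simp
qed

lemma factors_0: "(\<And>i j. A i j = 0) \<Longrightarrow> factors A t"
  unfolding factors_def by (intro exI[of _ "\<lambda>_ _. 0"]) simp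

lemma factors_mono: "factors A t \<Longrightarrow> t \<le> t' \<Longrightarrow> factors A t'"
  using factors_add[OF _ factors_0[of "\<lambda>_ _. 0" "t' - t"], of A t] by simp

lemma factors_imp_minor_eq_0: "factors A t \<Longrightarrow> minor A (Suc t) \<rho> \<kappa> = 0"
  unfolding factors_def by (elim exE) (rule minor_mult_eq_0, simp)

text \<open>A largest nonvanishing minor exists because the empty minor is 1. All minors that border
  it vanish, and solving them for \<open>A i j\<close> gives the factorization.\<close>

lemma factors_if_minors_eq_0:
  assumes "\<And>\<rho> \<kappa>. minor A (Suc t) \<rho> \<kappa> = 0"
  shows "factors A t"
proof -
  let ?Z = "\<lambda>t. \<forall>\<rho> \<kappa>. minor A t \<rho> \<kappa> = 0"
  define u where "u = (LEAST t. ?Z t)"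
  have Zt: "?Z (Suc t)" using assms by blast
  have Zu: "?Z u" unfolding u_def by (rule LeastI[of ?Z, OF Zt])
  have "u \<le> Suc t" unfolding u_def by (rule Least_le[of ?Z, OF Zt])
  moreover have "u \<noteq> 0"
  proof
    assume "u = 0"
    then have "minor A 0 id id = 0" using Zu by blast
    then show False by simp
  qed
  ultimately obtain v where v: "u = Suc v" "v \<le> t" by (cases u) auto
  have "\<not> ?Z v" using not_less_Least[of v ?Z] v unfolding u_def by auto
  then obtain \<rho> \<kappa> where \<rho>\<kappa>: "minor A v \<rho> \<kappa> \<noteq> 0" by blast
  define C where
    "C i a = (-1) ^ (a + v) * minor A v (\<lambda>x. (\<rho>(v := i)) (if x < a then x else Suc x)) \<kappa>" for i a
  define \<mu> where "\<mu> = minor A v \<rho> \<kappa>"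
  have "A i j = (\<Sum>s<v. - C i s / \<mu> * A (\<rho> s) j)" for i j
  proof -
    have "A i j * \<mu> + (\<Sum>a<v. A (\<rho> a) j * C i a) = minor A (Suc v) (\<rho>(v := i)) (\<kappa>(v := j))"
      unfolding minor_bordered C_def \<mu>_def ..
    also have "\<dots> = 0" using Zu v(1) by blast
    finally have "A i j * \<mu> = - (\<Sum>a<v. A (\<rho> a) j * C i a)"
      by (simp add: eq_neg_iff_add_eq_0)
    also have "\<dots> = (\<Sum>s<v. - C i s / \<mu> * A (\<rho> s) j) * \<mu>"
      unfolding sum_distrib_right sum_negf[symmetric]
      by (rule sum.cong) (use \<rho>\<kappa> in \<open>auto simp: \<mu>_def\<close>)
    finally show ?thesis using \<rho>\<kappa> by (simp add: \<mu>_def)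
  qed
  then have "factors A v" unfolding factors_def
    by (intro exI[of _ "\<lambda>i s. - C i s / \<mu>"] exI[of _ "\<lambda>s j. A (\<rho> s) j"]) blast
  then show ?thesis using v(2) by (rule factors_mono)
qed

text \<open>Modulo \<open>X - a\<close> the polynomial \<open>q\<close> is a nonzero constant, which
  settles the first power; each induction step inserts that relation into the previous one.\<close>

lemma coprime_linear_power:
  fixes q :: "'a::field poly"
  assumes "poly q a \<noteq> 0"
  shows "\<exists>u v. u * [:- a, 1:] ^ n + v * q = 1"
proof (induction n)
  case 0
  show ?case by (intro exI[of _ 1] exI[of _ 0]) simp
next
  case (Suc n)
  then obtain u v where uv: "u * [:- a, 1:] ^ n + v * q = 1" by blast
  have "[:- a, 1:] dvd q - [:poly q a:]" by (simp flip: poly_eq_0_iff_dvd)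
  then obtain w where w: "q - [:poly q a:] = [:- a, 1:] * w" by blast
  let ?c = "[:1 / poly q a:]"
  have "?c * q - ?c * w * [:- a, 1:] = ?c * (q - [:- a, 1:] * w)"
    by (simp only: right_diff_distrib mult_ac)
  also have "q - [:- a, 1:] * w = [:poly q a:]" using w by (simp add: algebra_simps)
  also have "?c * [:poly q a:] = 1" using assms by (simp add: one_pCons)
  finally have one: "?c * q - ?c * w * [:- a, 1:] = 1" .
  have "1 = u * [:- a, 1:] ^ n * (?c * q - ?c * w * [:- a, 1:]) + v * q"
    by (simp only: one uv mult_1_right)
  also have "\<dots> = (- (u * ?c * w)) * [:- a, 1:] ^ Suc n + (u * [:- a, 1:] ^ n * ?c + v) * q"
  proof -
    have "u * x * (c * q - c * w * y) + v * q = (- (u * c * w)) * (y * x) + (u * x * c + v) * q"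
      for x y c :: "'a poly"
      by (simp add: algebra_simps)
    then show ?thesis unfolding power_Suc .
  qed
  finally show ?case by metis
qed

context poly_functions
begin

subsection \<open>Finite schemes in affine space\<close>

definition indep_mod :: "('w \<Rightarrow> 'a) set \<Rightarrow> nat \<Rightarrow> (nat \<Rightarrow> 'w \<Rightarrow> 'a) \<Rightarrow> bool" where
  "indep_mod J n g \<longleftrightarrow>
     (\<forall>i<n. g i \<in> S) \<and> (\<forall>c. (\<Sum>i<n. fscale (c i) (g i)) \<in> J \<longrightarrow> (\<forall>i<n. c i = 0))"

text \<open>Dimension of the quotient by \<open>J\<close> bounded by \<open>r\<close>, expressed
  through independent families in order to avoid forming the quotient.\<close>

definition codim_le :: "('w \<Rightarrow> 'a) set \<Rightarrow> nat \<Rightarrow> bool" where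
  "codim_le J r \<longleftrightarrow> (\<forall>n g. indep_mod J n g \<longrightarrow> n \<le> r)"

lemma codim_exact:
  assumes "codim_le J r"
  shows "\<exists>n\<le>r. \<exists>g. indep_mod J n g \<and> codim_le J n"
proof -
  let ?P = "\<lambda>n. \<exists>g. indep_mod J n g"
  have P0: "?P 0" by (auto simp: indep_mod_def)
  have bound: "n \<le> r" if "?P n" for n using assms that unfolding codim_le_def by blast
  have "?P (Greatest ?P)" by (rule GreatestI_nat[of ?P, OF P0]) (use bound in blast)
  moreover have "n \<le> Greatest ?P" if "?P n" for n
    by (rule Greatest_le_nat[of ?P, OF that]) (use bound in blast)
  ultimately show ?thesis using bound unfolding codim_le_def by meson
qed

lemma indep_mod_spanned:
  assumes J: "poly_ideal J" and g: "indep_mod J n g" and cod: "codim_le J n"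
  shows "spanned_mod n J g"
  unfolding spanned_mod_def
proof (intro conjI ballI)
  show "\<forall>i<n. g i \<in> S" using g unfolding indep_mod_def by blast
  fix f assume f: "f \<in> S"
  have "\<not> indep_mod J (Suc n) (g(n := f))" using cod unfolding codim_le_def by (meson Suc_n_not_le_n)
  moreover have "\<forall>i<Suc n. (g(n := f)) i \<in> S" using g f by (auto simp: indep_mod_def)
  ultimately obtain c where c: "(\<Sum>i<Suc n. fscale (c i) ((g(n := f)) i)) \<in> J" "\<not> (\<forall>i<Suc n. c i = 0)"
    unfolding indep_mod_def by blast
  have sum: "(\<Sum>i<Suc n. fscale (c i) ((g(n := f)) i)) = (\<Sum>i<n. fscale (c i) (g i)) + fscale (c n) f"
    by simp
  have cn: "c n \<noteq> 0"
  proof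
    assume 0: "c n = 0"
    have "(\<Sum>i<n. fscale (c i) (g i)) + fscale (c n) f = (\<Sum>i<n. fscale (c i) (g i))"
      by (simp add: 0 fun_eq_iff)
    then have "(\<Sum>i<n. fscale (c i) (g i)) \<in> J" using c(1) unfolding sum by (simp only:)
    then have "\<forall>i<n. c i = 0" using g unfolding indep_mod_def by blast
    then show False using c(2) 0 by (auto simp: less_Suc_eq)
  qed
  have "fscale (1 / c n) ((\<Sum>i<n. fscale (c i) (g i)) + fscale (c n) f) \<in> J"
    using c(1) unfolding sum by (rule ideal_scale[OF J])
  moreover have "fscale (1 / c n) ((\<Sum>i<n. fscale (c i) (g i)) + fscale (c n) f) =
      f - (\<Sum>i<n. fscale (- (c i / c n)) (g i))"
    using cn by (simp add: fun_eq_iff sum_fun_apply distrib_left sum_distrib_left sum_negf)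
  ultimately have "f - (\<Sum>i<n. fscale (- (c i / c n)) (g i)) \<in> J" by (simp only:)
  then show "\<exists>c. f - (\<Sum>i<n. fscale (c i) (g i)) \<in> J"
    by (rule exI[of "\<lambda>c. f - (\<Sum>i<n. fscale (c i) (g i)) \<in> J"])
qed

definition zeros :: "('w \<Rightarrow> 'a) set \<Rightarrow> 'w set" where
  "zeros J = {p. \<forall>f\<in>J. f p = 0}"

lemma coord_basis: "b \<in> B \<Longrightarrow> b' \<in> B \<Longrightarrow> coord b b' = (if b = b' then 1 else 0)"
  unfolding coord_def using representation_basis[OF independent_Basis, of b'] by auto

lemma poly_coord_S: "x \<in> S \<Longrightarrow> (\<lambda>w. poly q (x w)) \<in> S"
proof (induction q)
  case 0
  then show ?case by (simp add: const_S)
next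
  case (pCons a q)
  have "(\<lambda>w. a) + x * (\<lambda>w. poly q (x w)) \<in> S" using pCons by (intro add_S mult_S const_S)
  moreover have "(\<lambda>w. a) + x * (\<lambda>w. poly q (x w)) = (\<lambda>w. poly (pCons a q) (x w))"
    by (simp add: fun_eq_iff)
  ultimately show ?case by (simp only:)
qed

text \<open>Among the \<open>r + 1\<close> powers of \<open>x\<close> up to the \<open>r\<close>-th
  there is a linear relation modulo \<open>J\<close>.\<close>

lemma codim_imp_poly:
  assumes J: "poly_ideal J" and cod: "codim_le J r" and x: "x \<in> S"
  shows "\<exists>q. q \<noteq> 0 \<and> (\<lambda>w. poly q (x w)) \<in> J"
proof -
  have "\<not> indep_mod J (Suc r) (\<lambda>i. x ^ i)" using cod unfolding codim_le_def by (meson Suc_n_not_le_n)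
  then obtain c where c: "(\<Sum>i<Suc r. fscale (c i) (x ^ i)) \<in> J" "\<not> (\<forall>i<Suc r. c i = 0)"
    using power_S[OF x] unfolding indep_mod_def by blast
  let ?q = "\<Sum>i<Suc r. monom (c i) i"
  have pow: "(x ^ i) w = x w ^ i" for i w by (induction i) auto
  have "(\<lambda>w. poly ?q (x w)) = (\<Sum>i<Suc r. fscale (c i) (x ^ i))"
    by (simp only: fun_eq_iff poly_sum poly_monom sum_fun_apply pow) simp
  moreover have "?q \<noteq> 0"
  proof
    assume "?q = 0"
    then have "coeff ?q i = 0" for i by simp
    moreover have "coeff ?q i = c i" if "i < Suc r" for i
      using that by (simp only: coeff_sum coeff_monom) simp
    ultimately show False using c(2) by metis
  qed
  ultimately show ?thesis using c(1) by (intro exI[of _ ?q]) simp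
qed

text \<open>For \<open>e\<close> idempotent modulo \<open>J\<close> this is the ideal of the part of
  the scheme on which \<open>e\<close> is 1; its quotient is isomorphic to \<open>e\<close> times
  the quotient by \<open>J\<close>.\<close>

definition colon :: "('w \<Rightarrow> 'a) set \<Rightarrow> ('w \<Rightarrow> 'a) \<Rightarrow> ('w \<Rightarrow> 'a) set" where
  "colon J e = {g \<in> S. e * g \<in> J}"

lemma colon_ideal:
  assumes J: "poly_ideal J"
  shows "poly_ideal (colon J e)"
  unfolding poly_ideal_def
proof (intro conjI ballI)
  show "colon J e \<subseteq> S" "0 \<in> colon J e" unfolding colon_def using zero_S ideal_0[OF J] by auto
next
  fix f g assume "f \<in> colon J e" "g \<in> colon J e"
  then show "f + g \<in> colon J e"
    unfolding colon_def mem_Collect_eq distrib_left by (simp only: add_S ideal_add[OF J])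
next
  fix f g assume f: "f \<in> S" and g: "g \<in> colon J e"
  then have "f * (e * g) \<in> J" unfolding colon_def using ideal_mult[OF J f] by blast
  then show "f * g \<in> colon J e"
    using f g unfolding colon_def mem_Collect_eq by (simp only: mult_S mult.left_commute)
qed

lemma subset_colon: "poly_ideal J \<Longrightarrow> e \<in> S \<Longrightarrow> J \<subseteq> colon J e"
  unfolding colon_def using ideal_mult[of J e] ideal_S[of J] by blast

text \<open>Complementary idempotents split the quotient by \<open>J\<close> into a direct sum, so
  the dimensions of the two parts add up.\<close>

lemma indep_mod_colon:
  assumes J: "poly_ideal J" and e: "e1 \<in> S" "e2 \<in> S" "e1 + e2 = 1" "e1 * e2 \<in> J"
    and g1: "indep_mod (colon J e1) n1 g1" and g2: "indep_mod (colon J e2) n2 g2"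
  shows "indep_mod J (n1 + n2) (\<lambda>i. if i < n1 then e1 * g1 i else e2 * g2 (i - n1))"
    (is "indep_mod J _ ?g")
  unfolding indep_mod_def
proof (intro conjI allI impI)
  have S1: "g1 i \<in> S" if "i < n1" for i using g1 that unfolding indep_mod_def by blast
  have S2: "g2 i \<in> S" if "i < n2" for i using g2 that unfolding indep_mod_def by blast
  show "?g i \<in> S" if "i < n1 + n2" for i using e S1 S2 that by (auto intro: mult_S)
  fix c i
  assume c: "(\<Sum>i<n1 + n2. fscale (c i) (?g i)) \<in> J" and i: "i < n1 + n2"
  define G1 where "G1 = (\<Sum>i<n1. fscale (c i) (g1 i))"
  define G2 where "G2 = (\<Sum>i<n2. fscale (c (n1 + i)) (g2 i))"
  have G: "G1 \<in> S" "G2 \<in> S" unfolding G1_def G2_def using S1 S2 by (auto intro!: sum_S scale_S)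
  have split: "(\<Sum>s<n + n'. g s) = (\<Sum>s<n. g s) + (\<Sum>s<n'. g (n + s))" for g :: "nat \<Rightarrow> 'w \<Rightarrow> 'a" and n n'
    by (induction n') (simp_all add: add.assoc)
  have "(\<Sum>i<n1 + n2. fscale (c i) (?g i)) = e1 * G1 + e2 * G2"
    unfolding split G1_def G2_def sum_distrib_left
    by (intro arg_cong2[of _ _ _ _ "(+)"] sum.cong) (auto simp: fun_eq_iff mult.left_commute)
  with c have main: "e1 * G1 + e2 * G2 \<in> J" by (simp only:)
  \<comment> \<open>Multiplying the relation by \<open>e\<close> isolates its first term, since
    \<open>e * e'\<close> lies in \<open>J\<close> and \<open>e * e\<close> is congruent to
    \<open>e\<close>.\<close>
  have key: "e * X \<in> J" if "e \<in> S" "e' \<in> S" "e + e' = 1" "e * e' \<in> J" "X \<in> S" "Y \<in> S" "e * X + e' * Y \<in> J" for e e' X Y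
  proof -
    have "e * (e * X + e' * Y) + (e * e') * (X - Y) \<in> J"
      by (rule ideal_add[OF J ideal_mult[OF J that(1,7)] ideal_mult'[OF J that(4) diff_S[OF that(5,6)]]])
    moreover have "e * (e * X + e' * Y) + (e * e') * (X - Y) = (e + e') * (e * X)"
      by (simp only: algebra_simps)
    ultimately show ?thesis using that(3) by (simp only: mult_1)
  qed
  have "e1 * G1 \<in> J" by (rule key[OF e G main])
  then have 1: "\<forall>i<n1. c i = 0"
    using G(1) g1 unfolding indep_mod_def colon_def G1_def by blast
  have "e2 + e1 = 1" "e2 * e1 \<in> J" "e2 * G2 + e1 * G1 \<in> J"
    using e(3,4) main
    by (simp_all only: add.commute[of e2 e1] mult.commute[of e2 e1] add.commute[of "e2 * G2" "e1 * G1"])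
  then have "e2 * G2 \<in> J" by (rule key[OF e(2,1) _ _ G(2,1)])
  then have "(\<Sum>i<n2. fscale (c (n1 + i)) (g2 i)) \<in> colon J e2"
    using G(2) unfolding colon_def G2_def by blast
  then have 2: "\<forall>i<n2. c (n1 + i) = 0"
    using g2[unfolded indep_mod_def, THEN conjunct2, THEN spec, of "\<lambda>i. c (n1 + i)"] by blast
  show "c i = 0"
    using 1 2[rule_format, of "i - n1"] i by (cases "i < n1") auto
qed

text \<open>Strong induction on the codimension. Either each coordinate has a single eigenvalue
  modulo \<open>J\<close>, so that \<open>J\<close> is supported at one point, or some coordinate
  has two, and the resulting idempotents split both \<open>J\<close> and \<open>\<phi>\<close> into
  parts of smaller codimension; \<open>k * r\<close> is additive in \<open>r\<close>.\<close>

theorem affine_rank_bound: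
  fixes M :: "nat \<Rightarrow> nat \<Rightarrow> 'w \<Rightarrow> 'a"
  assumes M: "\<And>i j. M i j \<in> dual s"
    and rank: "\<And>q \<rho> \<kappa>. q \<in> Z \<Longrightarrow> minor (\<lambda>i j. M i j q) (Suc k) \<rho> \<kappa> = 0"
    and J: "poly_ideal J" and ZJ: "{g \<in> S. \<forall>w\<in>Z. g w = 0} \<subseteq> J"
    and smooth: "\<And>p. p \<in> zeros J \<Longrightarrow> p \<in> Z \<and> smooth_point Z p"
    and \<phi>: "functional \<phi>" "\<forall>f\<in>J. \<phi> f = 0" and cod: "codim_le J r"
  shows "factors (\<lambda>i j. \<phi> (M i j)) (k * r)"
  using J ZJ smooth \<phi> cod
proof (induction r arbitrary: J \<phi> rule: less_induct)
  case (less r J \<phi>)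
  note J = less.prems(1)
  show ?case
  proof (cases "1 \<in> J")
    case True
    then have "M i j \<in> J" for i j using ideal_mult'[OF J True dual_S[OF M]] by simp
    then show ?thesis using less.prems(5) by (intro factors_0) blast
  next
    case one: False
    show ?thesis
    proof (cases "\<forall>b\<in>B. \<exists>a n. (coord b - (\<lambda>w. a)) ^ n \<in> J")
      case True
      then obtain a where a: "\<forall>b\<in>B. \<exists>n. (coord b - (\<lambda>w. a b)) ^ n \<in> J" by metis
      define p where "p = (\<Sum>b\<in>B. s (a b) b)"
      have "coord b p = a b" if b: "b \<in> B" for b
        unfolding p_def dual_sum[OF coord_dual] dual_scale[OF coord_dual]
      proof -
        have "(\<Sum>i\<in>B. a i * coord b i) = (\<Sum>i\<in>B. if i = b then a i else 0)"
          by (intro sum.cong) (auto simp: coord_basis[OF b])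
        also have "\<dots> = a b" using b finite_Basis by simp
        finally show "(\<Sum>i\<in>B. a i * coord b i) = a b" .
      qed
      then have loc: "local_at p J" unfolding local_at_def using a by simp
      \<comment> \<open>Otherwise a member of \<open>J\<close> is nonzero at \<open>p\<close>, hence
        a unit modulo \<open>J\<close>.\<close>
      have "p \<in> zeros J"
      proof (rule ccontr)
        assume "p \<notin> zeros J"
        then obtain f where f: "f \<in> J" "f p \<noteq> 0" unfolding zeros_def by blast
        have "1 \<in> J"
          by (rule local_cancel[OF J loc ideal_S[OF J f(1)] f(2) one_S]) (use f in simp)
        with one show False ..
      qed
      with less.prems(3) have p: "p \<in> Z" "smooth_point Z p" by blast+
      \<comment> \<open>\<open>r\<close> is only an upper bound; an independent family spans when
        its length is the exact codimension \<open>n\<close>.\<close>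
      obtain n \<beta> where n: "n \<le> r" "indep_mod J n \<beta>" "codim_le J n"
        using codim_exact[OF less.prems(6)] by blast
      have "factors (\<lambda>i j. \<phi> (M i j)) (k * n)"
      proof (rule factors_if_minors_eq_0)
        show "minor (\<lambda>i j. \<phi> (M i j)) (Suc (k * n)) \<rho> \<kappa> = 0" for \<rho> \<kappa>
          by (rule local_rank_bound[OF p M rank J loc _ less.prems(4) _ indep_mod_spanned[OF J n(2,3)]])
            (use less.prems(2,5) in blast)+
      qed
      then show ?thesis by (rule factors_mono) (simp add: n(1))
    next
      case False
      then obtain b where b: "b \<in> B" "\<And>a n. (coord b - (\<lambda>w. a)) ^ n \<notin> J" by blast
      define ev where "ev q w = poly q (coord b w)" for q w
      have evS: "ev q \<in> S" for q
      proof -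
        have "ev q = (\<lambda>w. poly q (coord b w))" by (simp add: fun_eq_iff ev_def)
        then show ?thesis using poly_coord_S[OF dual_S[OF coord_dual]] by simp
      qed
      have ev_mult: "ev (q * q') = ev q * ev q'" and ev_add: "ev (q + q') = ev q + ev q'" for q q'
        by (simp_all add: fun_eq_iff ev_def)
      have ev_1: "ev 1 = 1" by (simp add: fun_eq_iff ev_def)
      have ev_pow: "ev ([:- a, 1:] ^ n) = (coord b - (\<lambda>w. a)) ^ n" for a n
      proof (induction n)
        case (Suc n)
        have "ev [:- a, 1:] = coord b - (\<lambda>w. a)" by (simp add: fun_eq_iff ev_def)
        with Suc show ?case by (simp only: power_Suc ev_mult)
      qed (simp add: ev_1)
      let ?P = "\<lambda>q. q \<noteq> 0 \<and> ev q \<in> J"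
      have "\<exists>q. ?P q"
        using codim_imp_poly[OF J less.prems(6) dual_S[OF coord_dual[of b]]] by (simp add: ev_def[abs_def])
      \<comment> \<open>The minimal polynomial of the coordinate modulo \<open>J\<close>, up to a
        scalar.\<close>
      then obtain q where q: "q \<noteq> 0" "ev q \<in> J" and qmin: "\<And>q'. q' \<noteq> 0 \<Longrightarrow> ev q' \<in> J \<Longrightarrow> degree q \<le> degree q'"
        using ex_has_least_nat[of ?P _ degree] by blast
      have "degree q \<noteq> 0"
      proof
        assume "degree q = 0"
        then obtain a where a: "q = [:a:]" by (rule degree_eq_zeroE)
        then have "a \<noteq> 0" using q(1) by auto
        then have "fscale (1 / a) (ev q) = 1" by (simp add: a ev_def fun_eq_iff)
        with ideal_scale[OF J q(2), of "1 / a"] one show False by simp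
      qed
      then obtain a where root: "poly q a = 0" using alg_closed_imp_poly_has_root by blast
      define n where "n = order a q"
      obtain q2 where q2: "q = [:- a, 1:] ^ n * q2" "\<not> [:- a, 1:] dvd q2"
        using order_decomp[OF q(1), of a] unfolding n_def by blast
      have "n \<noteq> 0" using root q(1) order_root[of q a] unfolding n_def by simp
      have "poly q2 a \<noteq> 0" using q2(2) by (simp add: poly_eq_0_iff_dvd)
      then obtain u v where uv: "u * [:- a, 1:] ^ n + v * q2 = 1" using coprime_linear_power by blast
      \<comment> \<open>Bezout coefficients for the coprime factors \<open>[:- a, 1:] ^ n\<close>
        and \<open>q2\<close> give complementary idempotents modulo \<open>J\<close>: their product
        is a multiple of \<open>q\<close>.\<close>
      define e1 where "e1 = ev (v * q2)"
      define e2 where "e2 = ev (u * [:- a, 1:] ^ n)"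
      have e: "e1 \<in> S" "e2 \<in> S" unfolding e1_def e2_def by (rule evS)+
      have e12: "e1 + e2 = 1"
        unfolding e1_def e2_def ev_add[symmetric] by (simp only: add.commute[of "v * q2"] uv ev_1)
      have "e1 * e2 = ev (u * v) * ev q"
        unfolding e1_def e2_def q2(1) ev_mult by (simp only: mult_ac)
      then have e1e2: "e1 * e2 \<in> J" using ideal_mult[OF J evS q(2)] by (simp only:)
      \<comment> \<open>Otherwise the proper divisor \<open>q2\<close> of \<open>q\<close> would
        already lie in \<open>J\<close> after substitution, against minimality.\<close>
      have e1J: "e1 \<notin> J"
      proof
        assume "e1 \<in> J"
        then have "ev q2 * e1 + ev u * ev q \<in> J"
          by (rule ideal_add[OF J ideal_mult[OF J evS] ideal_mult[OF J evS q(2)]])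
        moreover have "ev q2 * e1 + ev u * ev q = ev q2 * (e1 + e2)"
          unfolding e1_def e2_def q2(1) ev_mult by (simp only: distrib_left mult_ac)
        ultimately have "ev q2 \<in> J" by (simp only: e12 mult_1_right)
        moreover have "q2 \<noteq> 0" using q q2 by auto
        ultimately have "degree q \<le> degree q2" by (rule qmin[rotated])
        moreover have "degree q = n + degree q2"
          using \<open>q2 \<noteq> 0\<close> unfolding q2(1) by (simp add: degree_mult_eq degree_power_eq)
        ultimately show False using \<open>n \<noteq> 0\<close> by simp
      qed
      \<comment> \<open>Here the failure of locality enters: no power of \<open>coord b - a\<close>
        lies in \<open>J\<close>.\<close>
      have e2J: "e2 \<notin> J"
      proof
        assume "e2 \<in> J"
        then have "ev ([:- a, 1:] ^ n) * e2 + ev v * ev q \<in> J"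
          by (rule ideal_add[OF J ideal_mult[OF J evS] ideal_mult[OF J evS q(2)]])
        moreover have "ev ([:- a, 1:] ^ n) * e2 + ev v * ev q = ev ([:- a, 1:] ^ n) * (e1 + e2)"
          unfolding e1_def e2_def q2(1) ev_mult by (simp only: distrib_left mult_ac add.commute)
        ultimately have "ev ([:- a, 1:] ^ n) \<in> J" by (simp only: e12 mult_1_right)
        then show False using b(2) unfolding ev_pow by blast
      qed
      have indep1: "indep_mod (colon J e) 1 (\<lambda>_. 1)" if "e \<notin> J" "e \<in> S" for e
        unfolding indep_mod_def
      proof (intro conjI allI impI)
        fix c :: "nat \<Rightarrow> 'a" and i :: nat
        assume "(\<Sum>i<1::nat. fscale (c i) (1 :: 'w \<Rightarrow> 'a)) \<in> colon J e" and i: "i < 1"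
        then have "e * fscale (c 0) 1 \<in> J" by (simp add: colon_def)
        then have "fscale (1 / c 0) (e * fscale (c 0) 1) \<in> J" by (rule ideal_scale[OF J])
        moreover have "fscale (1 / c 0) (e * fscale (c 0) 1) = e" if "c 0 \<noteq> 0"
          using that by (simp add: fun_eq_iff)
        ultimately show "c i = 0" using \<open>e \<notin> J\<close> i by (cases "c 0 = 0") auto
      qed (rule one_S)
      have cod2: "codim_le (colon J e2) r"
        unfolding codim_le_def
      proof (intro allI impI)
        fix n2 g2 assume "indep_mod (colon J e2) n2 g2"
        from indep_mod_colon[OF J e e12 e1e2 indep1[OF e1J e(1)] this]
        show "n2 \<le> r" using less.prems(6) unfolding codim_le_def by (meson add_leD2)
      qed
      \<comment> \<open>The exact codimension \<open>n2\<close> of one part leaves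
        \<open>r - n2\<close> for the other. Both parts are nonzero, so each number is strictly
        below \<open>r\<close>.\<close>
      obtain n2 g2 where n2: "indep_mod (colon J e2) n2 g2" "codim_le (colon J e2) n2"
        using codim_exact[OF cod2] by blast
      have "1 + n2 \<le> r"
        using indep_mod_colon[OF J e e12 e1e2 indep1[OF e1J e(1)] n2(1)] less.prems(6)
        unfolding codim_le_def by blast
      moreover have "1 \<le> n2" using n2(2) indep1[OF e2J e(2)] unfolding codim_le_def by blast
      ultimately have n2r: "n2 < r" "r - n2 < r" "n2 \<le> r" by auto
      have cod1: "codim_le (colon J e1) (r - n2)"
        unfolding codim_le_def
      proof (intro allI impI)
        fix n1 g1 assume "indep_mod (colon J e1) n1 g1"
        from indep_mod_colon[OF J e e12 e1e2 this n2(1)]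
        have "n1 + n2 \<le> r" using less.prems(6) unfolding codim_le_def by blast
        then show "n1 \<le> r - n2" by simp
      qed
      have step: "factors (\<lambda>i j. \<phi> (e * M i j)) (k * r')"
        if r': "r' < r" and eS: "e \<in> S" and cod: "codim_le (colon J e) r'" for e r'
      proof (rule less.IH[OF r' colon_ideal[OF J]])
        show "{g \<in> S. \<forall>w\<in>Z. g w = 0} \<subseteq> colon J e"
          using less.prems(2) subset_colon[OF J eS] by blast
        show "p \<in> Z \<and> smooth_point Z p" if "p \<in> zeros (colon J e)" for p
          using that less.prems(3)[of p] subset_colon[OF J eS] unfolding zeros_def by blast
        show "functional (\<lambda>g. \<phi> (e * g))"
          unfolding functional_def
        proof (intro conjI allI)
          show "\<phi> (e * (f + g)) = \<phi> (e * f) + \<phi> (e * g)" for f g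
            by (simp only: distrib_left functional_add[OF less.prems(4)])
          have "e * fscale c f = fscale c (e * f)" for c f by (simp add: fun_eq_iff)
          then show "\<phi> (e * fscale c f) = c * \<phi> (e * f)" for c f
            by (simp only: functional_scale[OF less.prems(4)])
        qed
        show "\<forall>f\<in>colon J e. \<phi> (e * f) = 0"
          using less.prems(5) unfolding colon_def by blast
      qed (rule cod)
      have "factors (\<lambda>i j. \<phi> (e1 * M i j) + \<phi> (e2 * M i j)) (k * (r - n2) + k * n2)"
        by (rule factors_add[OF step[OF n2r(2) e(1) cod1] step[OF n2r(1) e(2) n2(2)]])
      moreover have "\<phi> (e1 * M i j) + \<phi> (e2 * M i j) = \<phi> (M i j)" for i j
        by (simp only: functional_add[OF less.prems(4), symmetric] distrib_right[symmetric] e12 mult_1)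
      moreover have "k * (r - n2) + k * n2 = k * r"
        using n2r(3) by (simp flip: distrib_left)
      ultimately show ?thesis by (simp only:)
    qed
  qed
qed

end

section \<open>Square matrices over domains and fields\<close>

text \<open>Stated over a domain because it is also applied to polynomial entries, where the kernel
  vector has polynomial coordinates; that is the input for McCoy's argument.\<close>

lemma minor_eq_0_iff_kernel:
  fixes A :: "nat \<Rightarrow> nat \<Rightarrow> 'b::idom"
  shows "minor A r id id = 0 \<longleftrightarrow> (\<exists>v. (\<exists>j<r. v j \<noteq> 0) \<and> (\<forall>i<r. (\<Sum>j<r. A i j * v j) = 0))"
proof -
  let ?A = "mat r r (\<lambda>(i, j). A i j)"
  have mult: "(?A *\<^sub>v v) $ i = (\<Sum>j<r. A i j * v $ j)" if "v \<in> carrier_vec r" "i < r" for v i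
    using that by (auto simp: scalar_prod_def atLeast0LessThan)
  have "minor A r id id = 0 \<longleftrightarrow> (\<exists>v. v \<in> carrier_vec r \<and> v \<noteq> 0\<^sub>v r \<and> ?A *\<^sub>v v = 0\<^sub>v r)"
    unfolding minor_def by (subst det_0_iff_vec_prod_zero[of _ r]) auto
  also have "\<dots> \<longleftrightarrow> (\<exists>v. (\<exists>j<r. v j \<noteq> 0) \<and> (\<forall>i<r. (\<Sum>j<r. A i j * v j) = 0))"
  proof
    assume "\<exists>v. v \<in> carrier_vec r \<and> v \<noteq> 0\<^sub>v r \<and> ?A *\<^sub>v v = 0\<^sub>v r"
    then obtain v where v: "v \<in> carrier_vec r" "v \<noteq> 0\<^sub>v r" "?A *\<^sub>v v = 0\<^sub>v r" by blast
    have "\<exists>j<r. v $ j \<noteq> 0" using v(1,2) by (metis carrier_vecD eq_vecI index_zero_vec)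
    moreover have "\<forall>i<r. (\<Sum>j<r. A i j * v $ j) = 0" using mult[OF v(1)] v(3) by simp
    ultimately show "\<exists>v. (\<exists>j<r. v j \<noteq> 0) \<and> (\<forall>i<r. (\<Sum>j<r. A i j * v j) = 0)"
      by (intro exI[of _ "\<lambda>j. v $ j"]) simp
  next
    assume "\<exists>v. (\<exists>j<r. v j \<noteq> 0) \<and> (\<forall>i<r. (\<Sum>j<r. A i j * v j) = 0)"
    then obtain v j where v: "j < r" "v j \<noteq> 0" "\<forall>i<r. (\<Sum>j<r. A i j * v j) = 0" by blast
    have "vec r v \<noteq> 0\<^sub>v r" using v(1,2) by (metis index_vec index_zero_vec(1))
    moreover have "?A *\<^sub>v vec r v = 0\<^sub>v r" using v(3) mult[of "vec r v"] by (intro eq_vecI) auto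
    ultimately show "\<exists>v. v \<in> carrier_vec r \<and> v \<noteq> 0\<^sub>v r \<and> ?A *\<^sub>v v = 0\<^sub>v r"
      by (intro exI[of _ "vec r v"]) simp
  qed
  finally show ?thesis .
qed

lemma minor_nonzero_right_inverse:
  fixes A :: "nat \<Rightarrow> nat \<Rightarrow> 'b::field"
  assumes "minor A r id id \<noteq> 0"
  shows "\<exists>Z. \<forall>i<r. \<forall>j<r. (\<Sum>k<r. A i k * Z k j) = (if i = j then 1 else 0)"
proof -
  let ?A = "mat r r (\<lambda>(i, j). A i j)"
  have det: "det ?A = minor A r id id" by (simp add: minor_def)
  have car: "adj_mat ?A \<in> carrier_mat r r" by (rule adj_mat(1)) simp
  let ?Z = "\<lambda>k j. adj_mat ?A $$ (k, j) / det ?A"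
  have "(\<Sum>k<r. A i k * ?Z k j) = (if i = j then 1 else 0)" if ij: "i < r" "j < r" for i j
  proof -
    have "(\<Sum>k<r. A i k * adj_mat ?A $$ (k, j)) = (?A * adj_mat ?A) $$ (i, j)"
      using ij car by (auto simp: scalar_prod_def atLeast0LessThan intro!: sum.cong)
    also have "\<dots> = (if i = j then det ?A else 0)"
      using ij by (subst adj_mat(2)[of _ r]) auto
    finally show ?thesis using assms by (simp flip: sum_divide_distrib add: det)
  qed
  then show ?thesis by (intro exI[of _ ?Z]) blast
qed

lemma right_inverse_imp_left_inverse:
  fixes A Z :: "nat \<Rightarrow> nat \<Rightarrow> 'b::field"
  assumes "\<And>i j. i < r \<Longrightarrow> j < r \<Longrightarrow> (\<Sum>k<r. A i k * Z k j) = (if i = j then 1 else 0)"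
    and ij: "i < r" "j < r"
  shows "(\<Sum>k<r. Z i k * A k j) = (if i = j then 1 else 0)"
proof -
  let ?A = "mat r r (\<lambda>(i, j). A i j)" and ?Z = "mat r r (\<lambda>(i, j). Z i j)"
  have "?A * ?Z = 1\<^sub>m r"
    by (rule eq_matI) (auto simp: scalar_prod_def atLeast0LessThan assms(1))
  then have "?Z * ?A = 1\<^sub>m r" by (intro mat_mult_left_right_inverse[of ?A r ?Z]) auto
  then have "(?Z * ?A) $$ (i, j) = (if i = j then 1 else 0)" using ij by simp
  then show ?thesis using ij by (simp add: scalar_prod_def atLeast0LessThan)
qed

lemma poly_minor: "poly (minor A t \<rho> \<kappa>) c = minor (\<lambda>i j. poly (A i j) c) t \<rho> \<kappa>"
proof (induction t arbitrary: \<rho>)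
  case (Suc t)
  then show ?case by (simp add: minor_Suc poly_sum)
qed simp

context poly_functions
begin

section \<open>Counting modulo an ideal and extending functionals\<close>

lemma codim_le_spanned:
  assumes J: "poly_ideal J" and \<beta>: "spanned_mod r J \<beta>"
  shows "codim_le J r"
  unfolding codim_le_def
proof (intro allI impI)
  fix n g assume g: "indep_mod J n g"
  show "n \<le> r"
  proof (rule ccontr)
    assume "\<not> n \<le> r"
    then have n: "r < n" by simp
    have "\<forall>i. \<exists>c. i < n \<longrightarrow> g i - (\<Sum>k<r. fscale (c k) (\<beta> k)) \<in> J"
      using g \<beta> unfolding indep_mod_def spanned_mod_def by blast
    then obtain a where a: "\<And>i. i < n \<Longrightarrow> g i - (\<Sum>k<r. fscale (a i k) (\<beta> k)) \<in> J" by metis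
    \<comment> \<open>The coordinates of \<open>n > r\<close> elements, padded by zero rows to an
      \<open>n\<close>-by-\<open>n\<close> matrix, have a kernel vector, which is a nontrivial
      relation modulo \<open>J\<close>.\<close>
    have "minor (\<lambda>k i. if k < r then a i k else 0) n id id = 0"
      using n by (intro minor_zero_row[of r]) auto
    then obtain v j where v: "j < n" "v j \<noteq> 0" "\<And>k. k < n \<Longrightarrow> (\<Sum>i<n. (if k < r then a i k else 0) * v i) = 0"
      unfolding minor_eq_0_iff_kernel by blast
    have v0: "(\<Sum>i<n. v i * a i k) = 0" if "k < r" for k
      using v(3)[of k] n that by (simp add: mult.commute)
    have "(\<Sum>i<n. fscale (v i) (g i - (\<Sum>k<r. fscale (a i k) (\<beta> k)))) \<in> J"
      by (intro ideal_sum[OF J] ideal_scale[OF J] a) simp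
    moreover have "(\<Sum>i<n. fscale (v i) (g i - (\<Sum>k<r. fscale (a i k) (\<beta> k)))) = (\<Sum>i<n. fscale (v i) (g i))"
    proof
      fix w
      have "(\<Sum>i<n. v i * (\<Sum>k<r. a i k * \<beta> k w)) = (\<Sum>k<r. (\<Sum>i<n. v i * a i k) * \<beta> k w)"
        unfolding sum_distrib_left sum_distrib_right mult.assoc by (rule sum.swap)
      also have "\<dots> = 0" by (simp add: v0)
      finally have "(\<Sum>i<n. v i * (g i w - (\<Sum>k<r. a i k * \<beta> k w))) = (\<Sum>i<n. v i * g i w)"
        by (simp only: right_diff_distrib sum_subtractf diff_zero)
      then show "(\<Sum>i<n. fscale (v i) (g i - (\<Sum>k<r. fscale (a i k) (\<beta> k)))) w = (\<Sum>i<n. fscale (v i) (g i)) w"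
        by (simp add: sum_fun_apply)
    qed
    ultimately have "(\<Sum>i<n. fscale (v i) (g i)) \<in> J" by (simp only:)
    then have "\<forall>i<n. v i = 0" using g unfolding indep_mod_def by blast
    with v(1,2) show False by blast
  qed
qed

lemma functional_if_linear:
  assumes "Vector_Spaces.linear fscale (*) \<phi>"
  shows "functional \<phi>"
proof -
  interpret Modules.module_hom "fscale :: 'a \<Rightarrow> ('w \<Rightarrow> 'a) \<Rightarrow> _" "(*) :: 'a \<Rightarrow> 'a \<Rightarrow> 'a" \<phi>
    using assms by (rule Vector_Spaces.linear.axioms(3))
  show ?thesis unfolding functional_def using add scale by blast
qed

text \<open>Zero on \<open>U\<close> and \<open>\<psi>\<close> on \<open>P\<close> are compatible
  because \<open>\<psi>\<close> vanishes on the intersection. A basis \<open>C\<close> of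
  \<open>U\<close> is enlarged inside \<open>U \<union> P\<close>, so the added vectors lie in
  \<open>P\<close> and may be given the values of \<open>\<psi>\<close>.\<close>

lemma functional_extension:
  assumes U: "F.subspace U" and P: "F.subspace P" and \<psi>: "functional \<psi>"
    and UP: "\<And>f. f \<in> U \<Longrightarrow> f \<in> P \<Longrightarrow> \<psi> f = 0"
  shows "\<exists>\<phi>. functional \<phi> \<and> (\<forall>f\<in>U. \<phi> f = 0) \<and> (\<forall>f\<in>P. \<phi> f = \<psi> f)"
proof -
  interpret VP: vector_space_pair "fscale :: 'a \<Rightarrow> ('w \<Rightarrow> 'a) \<Rightarrow> _" "(*) :: 'a \<Rightarrow> 'a \<Rightarrow> 'a"
    by unfold_locales (auto simp: algebra_simps)
  obtain C where C: "C \<subseteq> U" "F.independent C" "U \<subseteq> F.span C"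
    using F.basis_exists[of U] by metis
  obtain D where D: "C \<subseteq> D" "D \<subseteq> U \<union> P" "F.independent D" "U \<union> P \<subseteq> F.span D"
    using F.maximal_independent_subset_extend[of C "U \<union> P"] C by blast
  have DC: "v \<in> P" if "v \<in> D" "v \<notin> C" for v
  proof -
    have "v \<notin> U"
    proof
      assume "v \<in> U"
      then have "v \<in> F.span (D - {v})" using C(3) D(1) that F.span_mono[of C "D - {v}"] by blast
      then show False using D(3) that(1) unfolding F.dependent_def by blast
    qed
    with D(2) that show ?thesis by blast
  qed
  obtain \<phi> where \<phi>: "Vector_Spaces.linear fscale (*) \<phi>" "\<forall>v\<in>D. \<phi> v = (if v \<in> C then 0 else \<psi> v)"
    using VP.linear_independent_extend[OF D(3), of "\<lambda>v. if v \<in> C then 0 else \<psi> v"] by blast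
  have lin: "functional \<phi>" by (rule functional_if_linear[OF \<phi>(1)])
  have sum: "\<chi> (\<Sum>v\<in>t. fscale (u v) v) = (\<Sum>v\<in>t. u v * \<chi> v)" if "functional \<chi>" for \<chi> t u
    by (simp only: functional_sum[OF that] functional_scale[OF that])
  have U0: "\<phi> f = 0" if "f \<in> U" for f
  proof -
    have "f \<in> F.span C" using that C(3) by blast
    then obtain t u where t: "finite t" "t \<subseteq> C" "f = (\<Sum>v\<in>t. fscale (u v) v)"
      unfolding F.span_explicit by blast
    then have "\<phi> f = (\<Sum>v\<in>t. u v * \<phi> v)" using sum[OF lin] by blast
    also have "\<dots> = 0"
    proof (intro sum.neutral ballI)
      fix v assume "v \<in> t"
      then have "v \<in> C" "v \<in> D" using t(2) D(1) by blast+
      then show "u v * \<phi> v = 0" using \<phi>(2) by simp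
    qed
    finally show ?thesis .
  qed
  have "\<phi> f = \<psi> f" if "f \<in> P" for f
  proof -
    have "f \<in> F.span D" using that D(4) by blast
    then obtain t u where t: "finite t" "t \<subseteq> D" "f = (\<Sum>v\<in>t. fscale (u v) v)"
      unfolding F.span_explicit by blast
    \<comment> \<open>The part of \<open>f\<close> over \<open>C\<close>. It equals
      \<open>f - Y\<close>, hence lies in both subspaces, and both functionals vanish on it.\<close>
    define X where "X = (\<Sum>v\<in>t \<inter> C. fscale (u v) v)"
    define Y where "Y = (\<Sum>v\<in>t - C. fscale (u v) v)"
    have f: "f = X + Y" unfolding t(3) X_def Y_def by (rule sum.Int_Diff[OF t(1)])
    have X: "X \<in> U" unfolding X_def using C(1) by (intro F.subspace_sum[OF U] F.subspace_scale[OF U]) blast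
    have Y: "Y \<in> P" unfolding Y_def using DC t(2) by (intro F.subspace_sum[OF P] F.subspace_scale[OF P]) blast
    have "f - Y \<in> P" by (rule F.subspace_diff[OF P that Y])
    then have "X \<in> P" using f by simp
    have "\<phi> Y = \<psi> Y" unfolding Y_def sum[OF lin] sum[OF \<psi>] using t(2) \<phi>(2) by (intro sum.cong) auto
    then show ?thesis
      unfolding f functional_add[OF lin] functional_add[OF \<psi>] using UP[OF X \<open>X \<in> P\<close>] U0[OF X] by simp
  qed
  then show ?thesis using lin U0 by blast
qed

subsection \<open>Graded pieces of the coordinate ring\<close>

lemma forms_subspace: "F.subspace (forms s d)"
  unfolding forms_def by (rule F.subspace_span)

lemma forms_S: "f \<in> forms s d \<Longrightarrow> f \<in> S"
  using forms_subset homog_subset by blast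

lemma forms_coord_expand:
  assumes "f \<in> forms s (Suc d)"
  shows "\<exists>g. (\<forall>b. g b \<in> forms s d) \<and> f = (\<Sum>b\<in>B. coord b * g b)"
  using assms unfolding forms_def[of s "Suc d"]
proof (induction rule: F.span_induct_alt)
  case base
  have "(0 :: 'w \<Rightarrow> 'a) = (\<Sum>b\<in>B. coord b * 0)" by simp
  then show ?case using F.subspace_0[OF forms_subspace, of d] by (intro exI[of _ "\<lambda>_. 0"]) blast
next
  case (step c x y)
  then obtain l where l: "\<forall>i<Suc d. l i \<in> dual s" "x = (\<lambda>w. \<Prod>i<Suc d. l i w)" by blast
  obtain g where g: "\<forall>b. g b \<in> forms s d" "y = (\<Sum>b\<in>B. coord b * g b)" using step(2) by blast
  define m where "m = (\<lambda>w. \<Prod>i<d. l i w)"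
  have m: "m \<in> forms s d"
    unfolding forms_def m_def using l(1) by (intro F.span_base CollectI exI[of _ l]) auto
  have "fscale c x + y = (\<Sum>b\<in>B. coord b * (fscale (c * l d b) m + g b))"
  proof
    fix w
    have "l d w = (\<Sum>b\<in>B. l d b * coord b w)"
      using fun_cong[OF dual_eq_sum_coord[of "l d"], of w] l(1) by (simp add: sum_fun_apply)
    then have "c * x w = (\<Sum>b\<in>B. coord b w * (c * l d b * m w))"
      unfolding l(2) m_def by (simp add: sum_distrib_left mult_ac)
    then show "(fscale c x + y) w = (\<Sum>b\<in>B. coord b * (fscale (c * l d b) m + g b)) w"
      unfolding g(2) by (simp add: sum_fun_apply distrib_left sum.distrib)
  qed
  moreover have "fscale (c * l d b) m + g b \<in> forms s d" for b
    using g(1) m by (intro F.subspace_add[OF forms_subspace] F.subspace_scale[OF forms_subspace]) auto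
  ultimately show ?case by (intro exI[of _ "\<lambda>b. fscale (c * l d b) m + g b"]) blast
qed

text \<open>Ensures that bases of the graded pieces are finite, so that \<open>dim\<close> in the
  Hilbert function condition is an honest count.\<close>

lemma forms_finite_span: "\<exists>G. finite G \<and> forms s d \<subseteq> F.span G"
proof (induction d)
  case 0
  have "forms s 0 \<subseteq> F.span {\<lambda>w. 1}" unfolding forms_def by (intro F.span_mono) auto
  then show ?case by blast
next
  case (Suc d)
  then obtain G where G: "finite G" "forms s d \<subseteq> F.span G" by blast
  let ?G = "(\<lambda>(b, g). coord b * g) ` (B \<times> G)"
  have 1: "coord b * f \<in> F.span ?G" if b: "b \<in> B" and f: "f \<in> forms s d" for b f
  proof -
    have "f \<in> F.span G" using f G(2) by blast
    then obtain t u where t: "finite t" "t \<subseteq> G" "f = (\<Sum>v\<in>t. fscale (u v) v)"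
      unfolding F.span_explicit by blast
    have "coord b * f = (\<Sum>v\<in>t. fscale (u v) (coord b * v))"
      unfolding t(3) by (simp add: fun_eq_iff sum_fun_apply sum_distrib_left mult.left_commute)
    also have "\<dots> \<in> F.span ?G"
    proof (intro F.span_sum F.span_scale F.span_base)
      fix v assume "v \<in> t"
      then show "coord b * v \<in> ?G" using t(2) b by (intro image_eqI[of _ _ "(b, v)"]) auto
    qed
    finally show ?thesis .
  qed
  have "forms s (Suc d) \<subseteq> F.span ?G"
  proof
    fix f assume "f \<in> forms s (Suc d)"
    then obtain g where g: "\<forall>b. g b \<in> forms s d" "f = (\<Sum>b\<in>B. coord b * g b)"
      using forms_coord_expand by blast
    show "f \<in> F.span ?G" unfolding g(2) using g(1) by (intro F.span_sum 1) auto
  qed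
  moreover have "finite ?G" using G(1) finite_Basis by simp
  ultimately show ?case by blast
qed

text \<open>Stated for any family of subspaces since it serves both all polynomials and a
  homogeneous ideal. The components form a function on all degrees, eventually 0, so that
  decompositions can be compared degree by degree.\<close>

lemma graded_decomposition:
  fixes V :: "nat \<Rightarrow> ('w \<Rightarrow> 'a) set"
  assumes V: "\<And>e. F.subspace (V e)" and f: "f \<in> F.span (\<Union>e. V e)"
  shows "\<exists>m b. (\<forall>e. b e \<in> V e) \<and> (\<forall>e\<ge>m. b e = 0) \<and> f = (\<Sum>e<m. b e)"
  using f
proof (induction rule: F.span_induct_alt)
  case base
  show ?case using F.subspace_0[OF V] by (intro exI[of _ 0] exI[of _ "\<lambda>_. 0"]) (simp add: zero_fun_def)
next
  case (step c x y)
  then obtain d where d: "x \<in> V d" by blast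
  obtain m b where b: "\<forall>e. b e \<in> V e" "\<forall>e\<ge>m. b e = 0" "y = (\<Sum>e<m. b e)" using step(2) by blast
  define b' where "b' e = (if e = d then fscale c x else 0) + b e" for e
  let ?m = "max m (Suc d)"
  have "b' e \<in> V e" for e
    unfolding b'_def using d b(1) F.subspace_scale[OF V] F.subspace_0[OF V]
    by (intro F.subspace_add[OF V]) auto
  moreover have "b' e = 0" if "?m \<le> e" for e unfolding b'_def using that b(2) by simp
  moreover have "fscale c x + y = (\<Sum>e<?m. b' e)"
  proof -
    have "y = (\<Sum>e<?m. b e)" unfolding b(3) using b(2) by (intro sum.mono_neutral_left) auto
    moreover have "fscale c x = (\<Sum>e<?m. if e = d then fscale c x else 0)"
      by (subst sum.delta) auto
    ultimately show ?thesis unfolding b'_def sum.distrib by argo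
  qed
  ultimately show ?case by blast
qed

text \<open>On the line through \<open>w\<close> the sum becomes a polynomial in the scaling
  parameter with coefficients \<open>f e w\<close>, and a polynomial vanishing on an infinite field
  is zero.\<close>

lemma graded_independent:
  assumes f: "\<And>e. f e \<in> forms s e" and sum: "(\<Sum>e<m. f e) = 0" and e: "e < m"
  shows "f e = 0"
proof
  fix w
  let ?q = "\<Sum>e<m. monom (f e w) e"
  have "poly ?q t = 0" for t
  proof -
    have "poly ?q t = (\<Sum>e<m. f e) (s t w)"
      by (simp add: poly_sum poly_monom sum_fun_apply forms_scale[OF f] mult.commute)
    then show ?thesis using sum by simp
  qed
  then have "?q = 0" by (intro alg_closed_poly_eqI) simp
  then have "coeff ?q e = 0" by simp
  then show "f e w = 0 w" using e by (simp add: coeff_sum)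
qed

lemma dual_mult_forms: "l \<in> dual s \<Longrightarrow> g \<in> forms s d \<Longrightarrow> l * g \<in> forms s (Suc d)"
  using forms_mult[OF dual_forms, of l] by (simp only: plus_1_eq_Suc)

lemma dual_lincomb: "(\<And>i. i \<in> T \<Longrightarrow> l i \<in> dual s) \<Longrightarrow> (\<Sum>i\<in>T. fscale (c i) (l i)) \<in> dual s"
  by (rule dualI)
    (simp_all add: sum_fun_apply dual_add dual_scale distrib_left sum.distrib sum_distrib_left mult.left_commute)

lemma lincomb_mod:
  fixes r :: nat
  assumes I: "poly_ideal I" and f: "\<And>x. x \<in> T \<Longrightarrow> f x - (\<Sum>k<r. fscale (a x k) (\<gamma> k)) \<in> I"
  shows "(\<Sum>x\<in>T. fscale (u x) (f x)) - (\<Sum>k<r. fscale (\<Sum>x\<in>T. u x * a x k) (\<gamma> k)) \<in> I"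
proof -
  have "(\<Sum>x\<in>T. fscale (u x) (f x - (\<Sum>k<r. fscale (a x k) (\<gamma> k)))) \<in> I"
    by (intro ideal_sum[OF I] ideal_scale[OF I] f)
  moreover have "(\<Sum>x\<in>T. fscale (u x) (f x - (\<Sum>k<r. fscale (a x k) (\<gamma> k)))) =
      (\<Sum>x\<in>T. fscale (u x) (f x)) - (\<Sum>k<r. fscale (\<Sum>x\<in>T. u x * a x k) (\<gamma> k))"
  proof
    fix w
    have "(\<Sum>x\<in>T. u x * (\<Sum>k<r. a x k * \<gamma> k w)) = (\<Sum>k<r. (\<Sum>x\<in>T. u x * a x k) * \<gamma> k w)"
      unfolding sum_distrib_left sum_distrib_right mult.assoc by (rule sum.swap)
    then have "(\<Sum>x\<in>T. u x * (f x w - (\<Sum>k<r. a x k * \<gamma> k w))) =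
        (\<Sum>x\<in>T. u x * f x w) - (\<Sum>k<r. (\<Sum>x\<in>T. u x * a x k) * \<gamma> k w)"
      by (simp only: right_diff_distrib sum_subtractf)
    then show "(\<Sum>x\<in>T. fscale (u x) (f x - (\<Sum>k<r. fscale (a x k) (\<gamma> k)))) w =
      ((\<Sum>x\<in>T. fscale (u x) (f x)) - (\<Sum>k<r. fscale (\<Sum>x\<in>T. u x * a x k) (\<gamma> k))) w"
      by (simp add: sum_fun_apply)
  qed
  ultimately show ?thesis by (simp only:)
qed

definition graded_basis :: "('w \<Rightarrow> 'a) set \<Rightarrow> nat \<Rightarrow> nat \<Rightarrow> (nat \<Rightarrow> 'w \<Rightarrow> 'a) \<Rightarrow> bool" where
  "graded_basis I d r \<beta> \<longleftrightarrow> (\<forall>i<r. \<beta> i \<in> forms s d) \<and>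
     (\<forall>g\<in>forms s d. \<exists>c. g - (\<Sum>i<r. fscale (c i) (\<beta> i)) \<in> I) \<and>
     (\<forall>c. (\<Sum>i<r. fscale (c i) (\<beta> i)) \<in> I \<longrightarrow> (\<forall>i<r. c i = 0))"

lemma ideal_subspace: "poly_ideal I \<Longrightarrow> F.subspace I"
  unfolding F.subspace_def by (blast intro: ideal_0 ideal_add ideal_scale)

text \<open>A basis of the degree \<open>d\<close> part of \<open>I\<close> is extended to one of
  all forms of degree \<open>d\<close>; the \<open>r\<close> new vectors represent the
  quotient.\<close>

lemma exists_graded_basis:
  assumes I: "poly_ideal I"
    and dim: "F.dim (forms s d) = F.dim (I \<inter> forms s d) + r"
  shows "\<exists>\<beta>. graded_basis I d r \<beta>"
proof -
  let ?V = "forms s d" and ?V' = "I \<inter> forms s d"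
  have V': "F.subspace ?V'" by (rule F.subspace_inter[OF ideal_subspace[OF I] forms_subspace])
  obtain C' where C': "C' \<subseteq> ?V'" "F.independent C'" "?V' \<subseteq> F.span C'" "card C' = F.dim ?V'"
    using F.basis_exists[of ?V'] by blast
  obtain C where C: "C' \<subseteq> C" "C \<subseteq> ?V" "F.independent C" "?V \<subseteq> F.span C"
    using F.maximal_independent_subset_extend[of C' ?V] C' by blast
  obtain G where G: "finite G" "?V \<subseteq> F.span G" using forms_finite_span by blast
  have finC: "finite C" using F.independent_span_bound[OF G(1) C(3)] C(2) G(2) by blast
  then have finC': "finite C'" using C(1) finite_subset by blast
  have "card C = F.dim ?V" using F.basis_card_eq_dim[OF C(2,4,3)] .
  then have "card (C - C') = r" using card_Diff_subset[OF finC' C(1)] C'(4) dim by simp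
  then obtain \<beta> where \<beta>: "bij_betw \<beta> {..<r} (C - C')"
    using ex_bij_betw_nat_finite[of "C - C'"] finC by (auto simp: atLeast0LessThan)
  have \<beta>C: "\<beta> i \<in> C - C'" if "i < r" for i using \<beta> that unfolding bij_betw_def by blast
  have "graded_basis I d r \<beta>"
    unfolding graded_basis_def
  proof (intro conjI ballI allI impI)
    show "\<beta> i \<in> forms s d" if "i < r" for i using \<beta>C[OF that] C(2) by blast
  next
    fix g assume "g \<in> ?V"
    then have "g \<in> F.span C" using C(4) by blast
    then obtain u where u: "g = (\<Sum>v\<in>C. fscale (u v) v)" using F.span_finite[OF finC] by auto
    have "g = (\<Sum>v\<in>C'. fscale (u v) v) + (\<Sum>v\<in>C - C'. fscale (u v) v)"
      unfolding u by (subst sum.subset_diff[OF C(1) finC]) (rule add.commute)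
    also have "(\<Sum>v\<in>C - C'. fscale (u v) v) = (\<Sum>i<r. fscale (u (\<beta> i)) (\<beta> i))"
      by (rule sum.reindex_bij_betw[OF \<beta>, symmetric])
    finally have "g - (\<Sum>i<r. fscale (u (\<beta> i)) (\<beta> i)) = (\<Sum>v\<in>C'. fscale (u v) v)"
      by (simp only: add_diff_cancel_right')
    moreover have "(\<Sum>v\<in>C'. fscale (u v) v) \<in> I"
      using C'(1) by (intro ideal_sum[OF I] ideal_scale[OF I]) blast
    ultimately have "g - (\<Sum>i<r. fscale (u (\<beta> i)) (\<beta> i)) \<in> I" by (simp only:)
    then show "\<exists>c. g - (\<Sum>i<r. fscale (c i) (\<beta> i)) \<in> I"
      by (rule exI[of "\<lambda>c. g - (\<Sum>i<r. fscale (c i) (\<beta> i)) \<in> I"])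
  next
    fix c i assume c: "(\<Sum>i<r. fscale (c i) (\<beta> i)) \<in> I" and i: "i < r"
    define ix where "ix = the_inv_into {..<r} \<beta>"
    have ix: "ix (\<beta> j) = j" if "j < r" for j
      using \<beta> that unfolding ix_def bij_betw_def by (intro the_inv_into_f_f) auto
    have "(\<Sum>j<r. fscale (c j) (\<beta> j)) = (\<Sum>j<r. fscale (c (ix (\<beta> j))) (\<beta> j))"
      using ix by (intro sum.cong) auto
    also have "\<dots> = (\<Sum>v\<in>C - C'. fscale (c (ix v)) v)"
      by (rule sum.reindex_bij_betw[OF \<beta>])
    finally have eq: "(\<Sum>j<r. fscale (c j) (\<beta> j)) = (\<Sum>v\<in>C - C'. fscale (c (ix v)) v)" .
    have "(\<Sum>v\<in>C - C'. fscale (c (ix v)) v) \<in> forms s d"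
      using C(2) by (intro F.subspace_sum[OF forms_subspace] F.subspace_scale[OF forms_subspace]) blast
    then have "(\<Sum>v\<in>C - C'. fscale (c (ix v)) v) \<in> F.span C'" using c C'(3) unfolding eq by blast
    then obtain u where u: "(\<Sum>v\<in>C - C'. fscale (c (ix v)) v) = (\<Sum>v\<in>C'. fscale (u v) v)"
      using F.span_finite[OF finC'] by auto
    define x where "x v = (if v \<in> C' then - u v else c (ix v))" for v
    have "(\<Sum>v\<in>C. fscale (x v) v) = (\<Sum>v\<in>C - C'. fscale (x v) v) + (\<Sum>v\<in>C'. fscale (x v) v)"
      by (rule sum.subset_diff[OF C(1) finC])
    also have "(\<Sum>v\<in>C - C'. fscale (x v) v) = (\<Sum>v\<in>C - C'. fscale (c (ix v)) v)"
      by (intro sum.cong) (auto simp: x_def)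
    also have "(\<Sum>v\<in>C'. fscale (x v) v) = - (\<Sum>v\<in>C'. fscale (u v) v)"
      unfolding sum_negf[symmetric] by (intro sum.cong) (auto simp: x_def fun_eq_iff)
    finally have "(\<Sum>v\<in>C. fscale (x v) v) = 0" unfolding u by (simp only: add.right_inverse)
    then have "x (\<beta> i) = 0" using F.independentD[OF C(3) finC subset_refl] \<beta>C[OF i] by blast
    then show "c i = 0" using \<beta>C[OF i] ix[OF i] by (simp add: x_def)
  qed
  then show ?thesis by blast
qed

text \<open>McCoy's argument: if a polynomial \<open>\<Sum>\<^sub>i X i T\<^sup>i\<close> kills a nonzero polynomial with coefficients
  in a module, then all \<open>X i\<close> kill a common nonzero element, here against saturation.\<close>

lemma mccoy:
  fixes g :: "nat \<Rightarrow> 'w \<Rightarrow> 'a" and n :: nat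
  assumes I: "poly_ideal I" and sat: "saturated s I" and b: "bij_betw b {..<n} B"
    and g: "\<And>t. g t \<in> forms s d" "\<And>t. T \<le> t \<Longrightarrow> g t = 0" "g t\<^sub>0 \<notin> I"
    and rel: "\<And>t. (\<Sum>i<n. if i \<le> t then coord (b i) * g (t - i) else 0) \<in> I"
  shows False
  using g rel
proof (induction T arbitrary: d g t\<^sub>0 rule: less_induct)
  case (less T d g t\<^sub>0)
  show ?case
  proof (cases "\<forall>i<n. coord (b i) * g t\<^sub>0 \<in> I")
    \<comment> \<open>Every linear form then multiplies \<open>g t\<^sub>0\<close> into
      \<open>I\<close>, and saturation applies with exponent 1.\<close>
    case True
    have "h * g t\<^sub>0 \<in> I" if h: "h \<in> forms s 1" for h
    proof -
      obtain h' where h': "\<forall>b. h' b \<in> forms s 0" "h = (\<Sum>b\<in>B. coord b * h' b)"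
        using forms_coord_expand[of h 0] h unfolding One_nat_def by blast
      have "h * g t\<^sub>0 = (\<Sum>b\<in>B. h' b * (coord b * g t\<^sub>0))"
        unfolding h'(2) sum_distrib_right by (intro sum.cong refl) (simp only: mult_ac)
      also have "\<dots> \<in> I"
      proof (rule ideal_sum[OF I])
        fix x assume "x \<in> B"
        then obtain i where "i < n" "x = b i" using b unfolding bij_betw_def by blast
        then have "coord x * g t\<^sub>0 \<in> I" using True by blast
        then show "h' x * (coord x * g t\<^sub>0) \<in> I"
          by (rule ideal_mult[OF I forms_S[OF h'(1)[rule_format]]])
      qed
      finally show ?thesis .
    qed
    then have "g t\<^sub>0 \<in> I" using sat forms_S[OF less.prems(1)] unfolding saturated_def by blast
    with less.prems(3) show False by blast
  next
    case False
    then obtain i\<^sub>0 where i0: "i\<^sub>0 < n" "coord (b i\<^sub>0) * g t\<^sub>0 \<notin> I" by blast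
    let ?P = "\<lambda>i. i < n \<and> (\<exists>t. coord (b i) * g t \<notin> I)"
    \<comment> \<open>The last coordinate that does not annihilate all coefficients modulo
      \<open>I\<close>.\<close>
    define i where "i = (GREATEST i. ?P i)"
    have "?P i" unfolding i_def by (rule GreatestI_nat[of ?P i\<^sub>0 n]) (use i0 in auto)
    then obtain t where t: "i < n" "coord (b i) * g t \<notin> I" by blast
    have max: "coord (b i') * g t \<in> I" if "i' < n" "i < i'" for i' t
      using Greatest_le_nat[of ?P i' n] that unfolding i_def[symmetric] by auto
    have "T \<noteq> 0"
    proof
      assume "T = 0"
      then have "g t\<^sub>0 = 0" by (intro less.prems(2)) simp
      then show False using less.prems(3) ideal_0[OF I] by metis
    qed
    then obtain T' where T': "T = Suc T'" by (cases T) auto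
    \<comment> \<open>In the relation of degree \<open>i + T'\<close>, earlier coordinates meet
      coefficients beyond the top one and later coordinates annihilate by the choice of
      \<open>i\<close>, so only this product remains.\<close>
    have top: "coord (b i) * g T' \<in> I"
    proof -
      let ?h = "\<lambda>i'. if i' \<le> i + T' then coord (b i') * g (i + T' - i') else 0"
      have "(\<Sum>i'<n. ?h i') = ?h i + (\<Sum>i'\<in>{..<n} - {i}. ?h i')"
        using t(1) by (intro sum.remove) auto
      moreover have rest: "(\<Sum>i'\<in>{..<n} - {i}. ?h i') \<in> I"
      proof (rule ideal_sum[OF I])
        fix i' assume i': "i' \<in> {..<n} - {i}"
        show "?h i' \<in> I"
        proof (cases "i' < i")
          case True
          then have "g (i + T' - i') = 0" using T' by (intro less.prems(2)) simp
          then show ?thesis using ideal_0[OF I] by simp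
        next
          case False
          then show ?thesis using i' max[of i'] ideal_0[OF I] by auto
        qed
      qed
      moreover have "(\<Sum>i'<n. ?h i') - (\<Sum>i'\<in>{..<n} - {i}. ?h i') \<in> I"
        by (rule ideal_diff[OF I less.prems(4)[of "i + T'"] rest])
      ultimately have "?h i \<in> I" by (simp only: add_diff_cancel_right')
      then show ?thesis by simp
    qed
    \<comment> \<open>Multiplying by \<open>coord (b i)\<close> kills the top coefficient modulo
      \<open>I\<close>, and it is replaced by an actual 0. The forms gain a degree, the sequence
      gets shorter, and some coefficient stays outside \<open>I\<close>.\<close>
    define g' where "g' t = (if t < T' then coord (b i) * g t else 0)" for t
    have "t < T'"
    proof (rule ccontr)
      assume "\<not> t < T'"
      then consider "t = T'" | "T \<le> t" using T' by linarith
      then show False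
      proof cases
        case 1
        then show ?thesis using top t(2) by simp
      next
        case 2
        then have "g t = 0" by (rule less.prems(2))
        then have "coord (b i) * g t = 0" by (simp only: mult_zero_right)
        then show ?thesis using ideal_0[OF I] t(2) by metis
      qed
    qed
    have "g' t \<in> forms s (Suc d)" for t
      unfolding g'_def using dual_mult_forms[OF coord_dual less.prems(1)] F.subspace_0[OF forms_subspace]
      by simp
    moreover have "g' t = 0" if "T' \<le> t" for t using that by (simp add: g'_def)
    moreover have "g' t \<notin> I" using \<open>t < T'\<close> t(2) by (simp add: g'_def)
    moreover have "(\<Sum>i'<n. if i' \<le> t then coord (b i') * g' (t - i') else 0) \<in> I" for t
    proof -
      have diff: "(if i' \<le> t then coord (b i') * g' (t - i') else 0) -
          coord (b i) * (if i' \<le> t then coord (b i') * g (t - i') else 0) \<in> I" for i'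
      proof (cases "i' \<le> t \<and> t - i' \<ge> T'")
        case False
        then have "(if i' \<le> t then coord (b i') * g' (t - i') else 0) -
            coord (b i) * (if i' \<le> t then coord (b i') * g (t - i') else 0) = 0"
          by (auto simp: g'_def mult.left_commute)
        then show ?thesis using ideal_0[OF I] by (simp only:)
      next
        case True
        have "coord (b i) * g (t - i') \<in> I"
        proof (cases "t - i' = T'")
          case True
          then show ?thesis using top by simp
        next
          case False
          then have "g (t - i') = 0" using True T' by (intro less.prems(2)) simp
          then show ?thesis using ideal_0[OF I] by simp
        qed
        then have "- (coord (b i') * (coord (b i) * g (t - i'))) \<in> I"
          by (intro ideal_uminus[OF I] ideal_mult[OF I dual_S[OF coord_dual], of "coord (b i) * g (t - i')"])
        then show ?thesis using True by (simp add: g'_def mult.left_commute)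
      qed
      let ?A = "\<lambda>i'. if i' \<le> t then coord (b i') * g' (t - i') else 0"
      let ?C = "\<lambda>i'. if i' \<le> t then coord (b i') * g (t - i') else 0"
      have "(\<Sum>i'<n. ?A i' - coord (b i) * ?C i') \<in> I" by (intro ideal_sum[OF I] diff)
      moreover have "coord (b i) * (\<Sum>i'<n. ?C i') \<in> I"
        by (rule ideal_mult[OF I dual_S[OF coord_dual] less.prems(4)])
      ultimately have "(\<Sum>i'<n. ?A i' - coord (b i) * ?C i') + coord (b i) * (\<Sum>i'<n. ?C i') \<in> I"
        by (rule ideal_add[OF I])
      then show "(\<Sum>i'<n. ?A i') \<in> I" by (simp only: sum_subtractf sum_distrib_left diff_add_cancel)
    qed
    moreover have "T' < T" by (simp add: T')
    ultimately show False by (rule less.IH[rotated])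
  qed
qed

text \<open>Multiplication by the linear form with coefficients \<open>c ^ i\<close> maps one
  \<open>r\<close>-dimensional graded piece to the next, and its determinant is a polynomial in
  \<open>c\<close>. If that vanished identically, a kernel vector with polynomial entries would
  contradict \<open>mccoy\<close>.\<close>

lemma exists_surjective_form:
  assumes I: "poly_ideal I" and sat: "saturated s I"
    and \<beta>: "graded_basis I N r \<beta>" and \<gamma>: "graded_basis I (Suc N) r \<gamma>"
  shows "\<exists>l\<in>dual s. \<forall>f\<in>forms s (Suc N). \<exists>g\<in>forms s N. f - l * g \<in> I"
proof -
  have \<beta>N: "\<beta> j \<in> forms s N" if "j < r" for j using \<beta> that unfolding graded_basis_def by blast
  obtain b where b: "bij_betw b {..<card B} B"
    using ex_bij_betw_nat_finite[OF finite_Basis] by (auto simp: atLeast0LessThan)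
  define n where "n = card B"
  note b = b[folded n_def]
  have "\<forall>i j. \<exists>c. j < r \<longrightarrow> coord (b i) * \<beta> j - (\<Sum>k<r. fscale (c k) (\<gamma> k)) \<in> I"
  proof (intro allI)
    fix i j
    show "\<exists>c. j < r \<longrightarrow> coord (b i) * \<beta> j - (\<Sum>k<r. fscale (c k) (\<gamma> k)) \<in> I"
    proof (cases "j < r")
      case True
      have "coord (b i) * \<beta> j \<in> forms s (Suc N)" by (rule dual_mult_forms[OF coord_dual \<beta>N[OF True]])
      then show ?thesis using \<gamma> unfolding graded_basis_def by blast
    qed blast
  qed
  then obtain a where a: "\<And>i j. j < r \<Longrightarrow> coord (b i) * \<beta> j - (\<Sum>k<r. fscale (a i j k) (\<gamma> k)) \<in> I"
    by metis
  define P where "P k j = (\<Sum>i<n. monom (a i j k) i)" for k j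
  have Pc: "poly (P k j) c = (\<Sum>i<n. c ^ i * a i j k)" for k j c
    by (simp add: P_def poly_sum poly_monom mult.commute)
  show ?thesis
  proof (cases "\<exists>c. poly (minor P r id id) c \<noteq> 0")
    case True
    then obtain c where "minor (\<lambda>k j. poly (P k j) c) r id id \<noteq> 0" unfolding poly_minor by blast
    then obtain Z where Z: "\<forall>i<r. \<forall>j<r. (\<Sum>k<r. poly (P i k) c * Z k j) = (if i = j then 1 else 0)"
      using minor_nonzero_right_inverse[of "\<lambda>k j. poly (P k j) c" r] by blast
    define l where "l = (\<Sum>i<n. fscale (c ^ i) (coord (b i)))"
    have l: "l \<in> dual s" unfolding l_def by (intro dual_lincomb coord_dual)
    have l\<beta>: "l * \<beta> j - (\<Sum>k<r. fscale (poly (P k j) c) (\<gamma> k)) \<in> I" if "j < r" for j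
    proof -
      have "l * \<beta> j = (\<Sum>i<n. fscale (c ^ i) (coord (b i) * \<beta> j))"
        unfolding l_def sum_distrib_right by (intro sum.cong refl) (simp add: fun_eq_iff)
      then show ?thesis
        using lincomb_mod[OF I, where T = "{..<n}" and f = "\<lambda>i. coord (b i) * \<beta> j" and r = r
            and a = "\<lambda>i. a i j" and \<gamma> = \<gamma> and u = "\<lambda>i. c ^ i", OF a[OF that]]
        unfolding Pc by (simp only:)
    qed
    have "\<exists>g\<in>forms s N. f - l * g \<in> I" if f: "f \<in> forms s (Suc N)" for f
    proof -
      obtain d where d: "f - (\<Sum>k<r. fscale (d k) (\<gamma> k)) \<in> I"
        using \<gamma> f unfolding graded_basis_def by blast
      define z where "z j = (\<Sum>m<r. Z j m * d m)" for j
      define g where "g = (\<Sum>j<r. fscale (z j) (\<beta> j))"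
      have gN: "g \<in> forms s N"
        unfolding g_def using \<beta>N
        by (intro F.subspace_sum[OF forms_subspace] F.subspace_scale[OF forms_subspace]) simp
      have "(\<Sum>j<r. z j * poly (P k j) c) = d k" if k: "k < r" for k
      proof -
        have "(\<Sum>j<r. z j * poly (P k j) c) = (\<Sum>j<r. \<Sum>m<r. poly (P k j) c * Z j m * d m)"
          unfolding z_def sum_distrib_right by (intro sum.cong refl) (simp add: mult_ac)
        also have "\<dots> = (\<Sum>m<r. (\<Sum>j<r. poly (P k j) c * Z j m) * d m)"
          unfolding sum_distrib_right by (rule sum.swap)
        also have "\<dots> = (\<Sum>m<r. if k = m then d m else 0)"
          using Z k by (intro sum.cong refl) simp
        also have "\<dots> = d k" using k by simp
        finally show ?thesis .
      qed
      then have eq: "(\<Sum>k<r. fscale (\<Sum>j<r. z j * poly (P k j) c) (\<gamma> k)) = (\<Sum>k<r. fscale (d k) (\<gamma> k))"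
        by (intro sum.cong refl) simp
      have "l * g = (\<Sum>j<r. fscale (z j) (l * \<beta> j))"
        unfolding g_def sum_distrib_left by (intro sum.cong refl) (simp add: fun_eq_iff)
      then have "l * g - (\<Sum>k<r. fscale (d k) (\<gamma> k)) \<in> I"
        using lincomb_mod[OF I, where T = "{..<r}" and f = "\<lambda>j. l * \<beta> j" and r = r
            and a = "\<lambda>j k. poly (P k j) c" and \<gamma> = \<gamma> and u = z] l\<beta>
        unfolding eq by simp
      from ideal_diff[OF I d this] have "f - l * g \<in> I" by (simp only: diff_diff_eq2 diff_add_cancel)
      then show ?thesis using gN by blast
    qed
    then show ?thesis using l by blast
  next
    case False
    then have "minor P r id id = 0" by (intro alg_closed_poly_eqI) simp
    then obtain v j\<^sub>0 where v: "j\<^sub>0 < r" "v j\<^sub>0 \<noteq> 0" "\<And>k. k < r \<Longrightarrow> (\<Sum>j<r. P k j * v j) = 0"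
      unfolding minor_eq_0_iff_kernel by blast
    \<comment> \<open>The coefficient of the \<open>t\<close>-th power of the parameter in the
      kernel vector, read as a form of degree \<open>N\<close>.\<close>
    define g where "g t = (\<Sum>j<r. fscale (coeff (v j) t) (\<beta> j))" for t
    have gN: "g t \<in> forms s N" for t
      unfolding g_def using \<beta>N
      by (intro F.subspace_sum[OF forms_subspace] F.subspace_scale[OF forms_subspace]) simp
    define T where "T = Suc (\<Sum>j<r. degree (v j))"
    have "g t = 0" if "T \<le> t" for t
    proof -
      have "coeff (v j) t = 0" if "j < r" for j
      proof (rule coeff_eq_0)
        have "degree (v j) \<le> (\<Sum>j<r. degree (v j))" using that by (intro member_le_sum) auto
        then show "degree (v j) < t" using \<open>T \<le> t\<close> unfolding T_def by simp
      qed
      then show ?thesis unfolding g_def by (intro sum.neutral ballI) (simp add: fun_eq_iff)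
    qed
    moreover have "g (degree (v j\<^sub>0)) \<notin> I"
    proof
      assume "g (degree (v j\<^sub>0)) \<in> I"
      then have "(\<Sum>j<r. fscale (coeff (v j) (degree (v j\<^sub>0))) (\<beta> j)) \<in> I" by (simp only: g_def)
      from \<beta>[unfolded graded_basis_def, THEN conjunct2, THEN conjunct2, rule_format, OF this v(1)]
      have "coeff (v j\<^sub>0) (degree (v j\<^sub>0)) = 0" .
      then show False using v(2) by simp
    qed
    moreover have "(\<Sum>i<n. if i \<le> t then coord (b i) * g (t - i) else 0) \<in> I" for t
    proof -
      define u where "u x = (if fst x \<le> t then coeff (v (snd x)) (t - fst x) else 0)" for x :: "nat \<times> nat"
      have "(\<Sum>x\<in>{..<n} \<times> {..<r}. u x * a (fst x) (snd x) k) = 0" if k: "k < r" for k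
      proof -
        have "0 = coeff (\<Sum>j<r. P k j * v j) t" using v(3)[OF k] by simp
        also have "\<dots> = (\<Sum>j<r. \<Sum>i<n. u (i, j) * a i j k)"
          unfolding P_def sum_distrib_right coeff_sum coeff_monom_mult u_def
          by (intro sum.cong refl) auto
        also have "\<dots> = (\<Sum>i<n. \<Sum>j<r. u (i, j) * a i j k)" by (rule sum.swap)
        also have "\<dots> = (\<Sum>x\<in>{..<n} \<times> {..<r}. u x * a (fst x) (snd x) k)"
          by (simp add: sum.cartesian_product case_prod_beta)
        finally show ?thesis by simp
      qed
      then have "(\<Sum>k<r. fscale (\<Sum>x\<in>{..<n} \<times> {..<r}. u x * a (fst x) (snd x) k) (\<gamma> k)) = 0"
        by (intro sum.neutral ballI) (simp add: fun_eq_iff)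
      moreover have "(\<Sum>x\<in>{..<n} \<times> {..<r}. fscale (u x) (coord (b (fst x)) * \<beta> (snd x))) -
          (\<Sum>k<r. fscale (\<Sum>x\<in>{..<n} \<times> {..<r}. u x * a (fst x) (snd x) k) (\<gamma> k)) \<in> I"
      proof (rule lincomb_mod[OF I])
        fix x :: "nat \<times> nat" assume "x \<in> {..<n} \<times> {..<r}"
        then have "snd x < r" by auto
        then show "coord (b (fst x)) * \<beta> (snd x) - (\<Sum>k<r. fscale (a (fst x) (snd x) k) (\<gamma> k)) \<in> I"
          by (rule a)
      qed
      ultimately have "(\<Sum>x\<in>{..<n} \<times> {..<r}. fscale (u x) (coord (b (fst x)) * \<beta> (snd x))) \<in> I"
        by (simp only: diff_zero)
      moreover have "(\<Sum>x\<in>{..<n} \<times> {..<r}. fscale (u x) (coord (b (fst x)) * \<beta> (snd x))) =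
          (\<Sum>i<n. if i \<le> t then coord (b i) * g (t - i) else 0)"
      proof -
        have "(\<Sum>x\<in>{..<n} \<times> {..<r}. fscale (u x) (coord (b (fst x)) * \<beta> (snd x))) =
            (\<Sum>i<n. \<Sum>j<r. fscale (u (i, j)) (coord (b i) * \<beta> j))"
          by (simp add: sum.cartesian_product case_prod_beta)
        also have "\<dots> = (\<Sum>i<n. if i \<le> t then coord (b i) * g (t - i) else 0)"
        proof (intro sum.cong refl)
          fix i
          show "(\<Sum>j<r. fscale (u (i, j)) (coord (b i) * \<beta> j)) =
              (if i \<le> t then coord (b i) * g (t - i) else 0)"
            unfolding g_def u_def sum_distrib_left
            by (auto simp: fun_eq_iff sum_fun_apply mult.left_commute intro!: sum.cong)
        qed
        finally show ?thesis .
      qed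
      ultimately show ?thesis by (simp only:)
    qed
    ultimately have False by (rule mccoy[OF I sat b gN])
    then show ?thesis ..
  qed
qed

text \<open>Surjectivity gives the matrix of multiplication by \<open>l\<close> a one-sided inverse.
  Both graded pieces have dimension \<open>r\<close>, so the matrix is square and the inverse
  two-sided.\<close>

lemma surjective_imp_injective:
  assumes I: "poly_ideal I" and l: "l \<in> dual s"
    and \<beta>: "graded_basis I d r \<beta>" and \<gamma>: "graded_basis I (Suc d) r \<gamma>"
    and surj: "\<And>f. f \<in> forms s (Suc d) \<Longrightarrow> \<exists>g\<in>forms s d. f - l * g \<in> I"
    and g: "g \<in> forms s d" "l * g \<in> I"
  shows "g \<in> I"
proof -
  have \<beta>d: "\<beta> j \<in> forms s d" if "j < r" for j using \<beta> that unfolding graded_basis_def by blast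
  have \<gamma>d: "\<gamma> j \<in> forms s (Suc d)" if "j < r" for j using \<gamma> that unfolding graded_basis_def by blast
  have \<gamma>0: "c k = 0" if "(\<Sum>k<r. fscale (c k) (\<gamma> k)) \<in> I" "k < r" for c k
    using \<gamma> that unfolding graded_basis_def by blast
  have "\<forall>j. \<exists>c. j < r \<longrightarrow> l * \<beta> j - (\<Sum>k<r. fscale (c k) (\<gamma> k)) \<in> I"
    using \<gamma> dual_mult_forms[OF l \<beta>d] unfolding graded_basis_def by blast
  then obtain A where A: "\<And>j. j < r \<Longrightarrow> l * \<beta> j - (\<Sum>k<r. fscale (A j k) (\<gamma> k)) \<in> I" by metis
  have comb: "l * (\<Sum>j<r. fscale (z j) (\<beta> j)) - (\<Sum>k<r. fscale (\<Sum>j<r. z j * A j k) (\<gamma> k)) \<in> I" for z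
  proof -
    have "l * (\<Sum>j<r. fscale (z j) (\<beta> j)) = (\<Sum>j<r. fscale (z j) (l * \<beta> j))"
      unfolding sum_distrib_left by (intro sum.cong refl) (simp add: fun_eq_iff)
    then show ?thesis using lincomb_mod[OF I, where T = "{..<r}" and f = "\<lambda>j. l * \<beta> j" and r = r
          and a = A and \<gamma> = \<gamma> and u = z] A by simp
  qed
  have "\<exists>z. \<forall>k<r. (\<Sum>j<r. z j * A j k) = (if m = k then 1 else 0)" if m: "m < r" for m
  proof -
    obtain h where h: "h \<in> forms s d" "\<gamma> m - l * h \<in> I" using surj[OF \<gamma>d[OF m]] by blast
    obtain z where z: "h - (\<Sum>j<r. fscale (z j) (\<beta> j)) \<in> I"
      using \<beta> h(1) unfolding graded_basis_def by blast
    let ?z = "\<Sum>j<r. fscale (z j) (\<beta> j)"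
    let ?A = "\<Sum>k<r. fscale (\<Sum>j<r. z j * A j k) (\<gamma> k)"
    have "(\<gamma> m - l * h) + l * (h - ?z) + (l * ?z - ?A) \<in> I"
      by (rule ideal_add[OF I ideal_add[OF I h(2) ideal_mult[OF I dual_S[OF l] z]] comb])
    moreover have "(\<gamma> m - l * h) + l * (h - ?z) + (l * ?z - ?A) = \<gamma> m - ?A"
      by (simp only: right_diff_distrib add_diff_eq diff_add_cancel)
    moreover have "\<gamma> m - ?A = (\<Sum>k<r. fscale ((if m = k then 1 else 0) - (\<Sum>j<r. z j * A j k)) (\<gamma> k))"
    proof
      fix w
      have "(\<Sum>k<r. (if m = k then 1 else 0) * \<gamma> k w) = (\<Sum>k<r. if m = k then \<gamma> k w else 0)"
        by (intro sum.cong) auto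
      also have "\<dots> = \<gamma> m w" using m by simp
      finally show "(\<gamma> m - ?A) w =
          (\<Sum>k<r. fscale ((if m = k then 1 else 0) - (\<Sum>j<r. z j * A j k)) (\<gamma> k)) w"
        by (simp only: minus_apply sum_fun_apply left_diff_distrib sum_subtractf)
    qed
    ultimately have "(\<Sum>k<r. fscale ((if m = k then 1 else 0) - (\<Sum>j<r. z j * A j k)) (\<gamma> k)) \<in> I"
      by (simp only:)
    from \<gamma>0[OF this] have "(if m = k then 1 else 0) - (\<Sum>j<r. z j * A j k) = 0" if "k < r" for k
      using that by blast
    then show ?thesis by (intro exI[of _ z]) simp
  qed
  then obtain Z where Z: "\<And>m k. m < r \<Longrightarrow> k < r \<Longrightarrow> (\<Sum>j<r. Z m j * A j k) = (if m = k then 1 else 0)"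
    by metis
  obtain c where c: "g - (\<Sum>j<r. fscale (c j) (\<beta> j)) \<in> I"
    using \<beta> g(1) unfolding graded_basis_def by blast
  let ?c = "\<Sum>j<r. fscale (c j) (\<beta> j)"
  let ?A = "\<Sum>k<r. fscale (\<Sum>j<r. c j * A j k) (\<gamma> k)"
  have "l * g - l * (g - ?c) - (l * ?c - ?A) \<in> I"
    by (rule ideal_diff[OF I ideal_diff[OF I g(2) ideal_mult[OF I dual_S[OF l] c]] comb])
  moreover have "l * g - l * (g - ?c) - (l * ?c - ?A) = ?A"
    by (simp only: right_diff_distrib diff_diff_eq2 add_diff_cancel_left' add.commute diff_add_cancel add_diff_cancel)
  ultimately have "?A \<in> I" by (simp only:)
  from \<gamma>0[OF this] have cA: "(\<Sum>j<r. c j * A j k) = 0" if "k < r" for k using that .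
  have "c m = 0" if m: "m < r" for m
  proof -
    have AZ: "(\<Sum>k<r. A j k * Z k m) = (if j = m then 1 else 0)" if "j < r" for j
      by (rule right_inverse_imp_left_inverse[OF Z that m])
    have "c m = (\<Sum>j<r. if j = m then c j else 0)" using m by simp
    also have "\<dots> = (\<Sum>j<r. c j * (\<Sum>k<r. A j k * Z k m))"
      by (intro sum.cong refl) (simp add: AZ)
    also have "\<dots> = (\<Sum>k<r. (\<Sum>j<r. c j * A j k) * Z k m)"
      unfolding sum_distrib_left sum_distrib_right mult.assoc by (rule sum.swap)
    also have "\<dots> = 0" by (simp add: cA)
    finally show ?thesis .
  qed
  then have "?c = 0" by (intro sum.neutral ballI) (simp add: fun_eq_iff)
  with c show ?thesis by (simp only: diff_zero)
qed

subsection \<open>Dehomogenization of finite subschemes\<close>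

lemma dual_subspace: "F.subspace (dual s)"
  unfolding F.subspace_def
  by (auto intro!: dualI simp: dual_add dual_scale distrib_left mult.left_commute)

lemma power_mult_forms: "l \<in> dual s \<Longrightarrow> f \<in> forms s e \<Longrightarrow> l ^ m * f \<in> forms s (m + e)"
proof (induction m)
  case (Suc m)
  have "l * (l ^ m * f) \<in> forms s (Suc (m + e))" using Suc by (intro dual_mult_forms)
  then have "l ^ Suc m * f \<in> forms s (Suc m + e)" by (simp only: power_Suc mult.assoc add_Suc)
  then show ?case .
qed (simp only: power_0 mult_1 add_0)

lemma homogeneous_ideal_poly_ideal: "homogeneous_ideal s I \<Longrightarrow> poly_ideal I"
  unfolding homogeneous_ideal_def poly_ideal_def by blast

lemma homogeneous_ideal_decomposition:
  assumes hom: "homogeneous_ideal s I" and f: "f \<in> I"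
  shows "\<exists>m b. (\<forall>e. b e \<in> I \<inter> forms s e) \<and> (\<forall>e\<ge>m. b e = 0) \<and> f = (\<Sum>e<m. b e)"
proof (rule graded_decomposition)
  show "F.subspace (I \<inter> forms s e)" for e
    by (intro F.subspace_inter ideal_subspace homogeneous_ideal_poly_ideal[OF hom] forms_subspace)
  have "I \<inter> homog s = (\<Union>e. I \<inter> forms s e)" unfolding homog_def by blast
  moreover have "f \<in> F.span (I \<inter> homog s)" using hom f unfolding homogeneous_ideal_def by blast
  ultimately show "f \<in> F.span (\<Union>e. I \<inter> forms s e)" by (simp only:)
qed

lemma polys_decomposition:
  assumes "f \<in> S"
  shows "\<exists>m b. (\<forall>e. b e \<in> forms s e) \<and> (\<forall>e\<ge>m. b e = 0) \<and> f = (\<Sum>e<m. b e)"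
  using assms unfolding polys_def homog_def by (intro graded_decomposition forms_subspace)

text \<open>\<open>J\<close> is \<open>I + (l - 1)\<close>, the scheme in the chart
  \<open>l = 1\<close>. Multiplication by \<open>l\<close> is onto in high degrees, so every form is
  congruent to one of degree \<open>N\<close>, which gives the codimension. Because \<open>l\<close>
  is not a zero divisor, a linear form in \<open>J\<close> already lies in \<open>I\<close>, so
  evaluation at \<open>v\<close> extends to a functional killing \<open>J\<close>. The origin is
  excluded because \<open>l - 1\<close> is nonzero there.\<close>

lemma finite_scheme_dehomogenization:
  assumes hom: "homogeneous_ideal s I" and sat: "saturated s I"
    and dim: "\<And>d. N \<le> d \<Longrightarrow> F.dim (forms s d) = F.dim (I \<inter> forms s d) + r"
    and v: "\<And>l. l \<in> I \<inter> dual s \<Longrightarrow> l v = 0"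
  shows "\<exists>J \<phi>. poly_ideal J \<and> I \<subseteq> J \<and> 0 \<notin> zeros J \<and> codim_le J r \<and>
    functional \<phi> \<and> (\<forall>f\<in>J. \<phi> f = 0) \<and> (\<forall>l\<in>dual s. \<phi> l = l v)"
proof -
  note I = homogeneous_ideal_poly_ideal[OF hom]
  have "\<forall>d. \<exists>\<beta>. N \<le> d \<longrightarrow> graded_basis I d r \<beta>" using exists_graded_basis[OF I dim] by blast
  then obtain \<beta> where \<beta>: "\<And>d. N \<le> d \<Longrightarrow> graded_basis I d r (\<beta> d)" by metis
  obtain l where l: "l \<in> dual s" and surjN: "\<forall>f\<in>forms s (Suc N). \<exists>g\<in>forms s N. f - l * g \<in> I"
    using exists_surjective_form[OF I sat \<beta>[of N] \<beta>[of "Suc N"]] by auto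
  have surj: "\<forall>f\<in>forms s (Suc d). \<exists>g\<in>forms s d. f - l * g \<in> I" if "N \<le> d" for d
    using that
  proof (induction d rule: dec_induct)
    case base
    show ?case by (rule surjN)
  next
    case (step d)
    show ?case
    proof
      fix f assume "f \<in> forms s (Suc (Suc d))"
      then obtain h where h: "\<forall>b. h b \<in> forms s (Suc d)" "f = (\<Sum>b\<in>B. coord b * h b)"
        using forms_coord_expand by blast
      have "\<forall>b. \<exists>g\<in>forms s d. h b - l * g \<in> I" using h(1) step.IH by blast
      then obtain g where g: "\<And>b. g b \<in> forms s d" "\<And>b. h b - l * g b \<in> I" by metis
      let ?G = "\<Sum>b\<in>B. coord b * g b"
      have "?G \<in> forms s (Suc d)"
        by (intro F.subspace_sum[OF forms_subspace] dual_mult_forms coord_dual g(1))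
      moreover have "f - l * ?G = (\<Sum>b\<in>B. coord b * (h b - l * g b))"
        unfolding h(2) by (simp only: right_diff_distrib sum_subtractf sum_distrib_left mult.left_commute)
      moreover have "(\<Sum>b\<in>B. coord b * (h b - l * g b)) \<in> I"
        by (rule ideal_sum[OF I]) (rule ideal_mult[OF I dual_S[OF coord_dual] g(2)])
      ultimately show "\<exists>g\<in>forms s (Suc d). f - l * g \<in> I" by (intro bexI[of _ ?G]) (simp_all only:)
    qed
  qed
  \<comment> \<open>Counting dimensions gives injectivity only from degree \<open>N\<close> on.
    Multiplying by forms of degree \<open>N\<close> moves into that range, and saturation brings the
    conclusion back.\<close>
  have inj: "f \<in> I" if f: "f \<in> forms s e" "l * f \<in> I" for f e
  proof -
    have "h * f \<in> I" if h: "h \<in> forms s N" for h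
    proof -
      have N: "N \<le> N + e" "N \<le> Suc (N + e)" by simp_all
      have "h * (l * f) \<in> I" by (rule ideal_mult[OF I forms_S[OF h] f(2)])
      then have "l * (h * f) \<in> I" by (simp only: mult.left_commute)
      then show ?thesis
        using surjective_imp_injective[OF I l \<beta>[OF N(1)] \<beta>[OF N(2)] _ forms_mult[OF h f(1)]] surj[OF N(1)]
        by blast
    qed
    then show ?thesis using sat forms_S[OF f(1)] unfolding saturated_def by blast
  qed
  have inj_power: "f \<in> I" if "f \<in> forms s e" "l ^ m * f \<in> I" for f e m
    using that(2)
  proof (induction m)
    case (Suc m)
    have "l * (l ^ m * f) \<in> I" using Suc.prems by (simp only: power_Suc mult.assoc)
    then have "l ^ m * f \<in> I" by (rule inj[OF power_mult_forms[OF l that(1)]])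
    then show ?case by (rule Suc.IH)
  qed (simp only: power_0 mult_1)
  define J where "J = {a + (l - 1) * b | a b. a \<in> I \<and> b \<in> S}"
  have l1: "l - 1 \<in> S" by (intro diff_S dual_S l one_S)
  have JI: "a + (l - 1) * b \<in> J" if "a \<in> I" "b \<in> S" for a b using that unfolding J_def by blast
  have J: "poly_ideal J"
    unfolding poly_ideal_def
  proof (intro conjI ballI subsetI)
    show "f \<in> S" if "f \<in> J" for f
      using that ideal_S[OF I] l1 unfolding J_def by (blast intro: add_S mult_S)
    show "0 \<in> J" using JI[OF ideal_0[OF I] zero_S] by (simp only: mult_zero_right add_0)
    show "f + g \<in> J" if fg: "f \<in> J" "g \<in> J" for f g
    proof -
      obtain a b a' b' where ab: "a \<in> I" "b \<in> S" "a' \<in> I" "b' \<in> S"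
        "f = a + (l - 1) * b" "g = a' + (l - 1) * b'" using fg unfolding J_def by blast
      have "f + g = (a + a') + (l - 1) * (b + b')" unfolding ab(5,6) by (simp only: distrib_left ac_simps)
      then show ?thesis using JI[OF ideal_add[OF I ab(1,3)] add_S[OF ab(2,4)]] by (simp only:)
    qed
    show "f * g \<in> J" if f: "f \<in> S" and g: "g \<in> J" for f g
    proof -
      obtain a b where ab: "a \<in> I" "b \<in> S" "g = a + (l - 1) * b" using g unfolding J_def by blast
      have "f * g = f * a + (l - 1) * (f * b)" unfolding ab(3) by (simp only: distrib_left mult.left_commute)
      then show ?thesis using JI[OF ideal_mult[OF I f ab(1)] mult_S[OF f ab(2)]] by (simp only:)
    qed
  qed
  have IJ: "f \<in> J" if "f \<in> I" for f using JI[OF that zero_S] by (simp only: mult_zero_right add_0_right)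
  have l1J: "(l - 1) * f \<in> J" if "f \<in> S" for f using JI[OF ideal_0[OF I] that] by (simp only: add_0)
  have "l - 1 \<in> J" using l1J[OF one_S] by (simp only: mult_1_right)
  then have "0 \<notin> zeros J" unfolding zeros_def using dual_0[OF l] by force
  moreover have "codim_le J r"
  proof (rule codim_le_spanned[OF J])
    have down: "\<exists>g\<in>forms s N. f - g \<in> J" if "f \<in> forms s (N + m)" for f m
      using that
    proof (induction m arbitrary: f)
      case 0
      then have "f \<in> forms s N" by simp
      moreover have "f - f \<in> J" using ideal_0[OF J] by (simp only: diff_self)
      ultimately show ?case by (intro bexI[of _ f])
    next
      case (Suc m)
      then obtain g where g: "g \<in> forms s (N + m)" "f - l * g \<in> I" using surj[of "N + m"] by auto
      obtain g' where g': "g' \<in> forms s N" "g - g' \<in> J" using Suc.IH[OF g(1)] by blast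
      have "(f - l * g) + (l - 1) * g + (g - g') \<in> J"
        by (intro ideal_add[OF J] IJ g(2) l1J forms_S[OF g(1)] g'(2))
      moreover have "(f - l * g) + (l - 1) * g + (g - g') = f - g'"
        by (simp only: left_diff_distrib mult_1 diff_add_cancel add_diff_eq)
      ultimately show ?case using g'(1) by (intro bexI[of _ g']) (simp_all only:)
    qed
    have up: "f - l ^ m * f \<in> J" if f: "f \<in> S" for f m
    proof (induction m)
      case 0
      show ?case using ideal_0[OF J] by (simp only: power_0 mult_1 diff_self)
    next
      case (Suc m)
      have "(f - l ^ m * f) - (l - 1) * (l ^ m * f) \<in> J"
        by (intro ideal_diff[OF J Suc l1J] mult_S power_S dual_S l f)
      moreover have "(f - l ^ m * f) - (l - 1) * (l ^ m * f) = f - l ^ Suc m * f"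
      proof -
        have "(x - y) - (l - 1) * y = x - l * y" for x y :: "'w \<Rightarrow> 'a" by (simp add: algebra_simps)
        then show ?thesis by (simp only: power_Suc mult.assoc)
      qed
      ultimately show ?case by (simp only:)
    qed
    have forms: "\<exists>c. f - (\<Sum>i<r. fscale (c i) (\<beta> N i)) \<in> J" if f: "f \<in> forms s e" for f e
    proof -
      have "l ^ N * f \<in> forms s (N + e)" by (rule power_mult_forms[OF l f])
      then obtain g where g: "g \<in> forms s N" "l ^ N * f - g \<in> J" using down by blast
      obtain c where c: "g - (\<Sum>i<r. fscale (c i) (\<beta> N i)) \<in> I"
        using \<beta>[of N] g(1) unfolding graded_basis_def by blast
      have "(f - l ^ N * f) + (l ^ N * f - g) + (g - (\<Sum>i<r. fscale (c i) (\<beta> N i))) \<in> J"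
        by (intro ideal_add[OF J] up forms_S[OF f] g(2) IJ c)
      then have "f - (\<Sum>i<r. fscale (c i) (\<beta> N i)) \<in> J" by (simp only: add_diff_eq diff_add_cancel)
      then show ?thesis by (rule exI[of "\<lambda>c. f - (\<Sum>i<r. fscale (c i) (\<beta> N i)) \<in> J"])
    qed
    show "spanned_mod r J (\<beta> N)"
      unfolding spanned_mod_def
    proof (intro conjI ballI)
      show "\<forall>i<r. \<beta> N i \<in> S" using \<beta>[of N] forms_S unfolding graded_basis_def by blast
      fix g assume "g \<in> S"
      then obtain m b where b: "\<forall>e. b e \<in> forms s e" "g = (\<Sum>e<m. b e)"
        using polys_decomposition by blast
      have "\<forall>e. \<exists>c. b e - (\<Sum>i<r. fscale (c i) (\<beta> N i)) \<in> J" using b(1) forms by blast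
      then obtain c where c: "\<And>e. b e - (\<Sum>i<r. fscale (c e i) (\<beta> N i)) \<in> J" by metis
      have "g - (\<Sum>i<r. fscale (\<Sum>e<m. c e i) (\<beta> N i)) = (\<Sum>e<m. b e - (\<Sum>i<r. fscale (c e i) (\<beta> N i)))"
      proof -
        have "(\<Sum>i<r. fscale (\<Sum>e<m. c e i) (\<beta> N i)) = (\<Sum>i<r. \<Sum>e<m. fscale (c e i) (\<beta> N i))"
          by (intro sum.cong refl) (simp add: fun_eq_iff sum_fun_apply sum_distrib_right)
        also have "\<dots> = (\<Sum>e<m. \<Sum>i<r. fscale (c e i) (\<beta> N i))" by (rule sum.swap)
        finally show ?thesis unfolding b(2) by (simp only: sum_subtractf)
      qed
      also have "\<dots> \<in> J" by (intro ideal_sum[OF J] c)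
      finally show "\<exists>c. g - (\<Sum>i<r. fscale (c i) (\<beta> N i)) \<in> J"
        by (rule exI[of "\<lambda>c. g - (\<Sum>i<r. fscale (c i) (\<beta> N i)) \<in> J"])
    qed
  qed
  moreover have "\<exists>\<phi>. functional \<phi> \<and> (\<forall>f\<in>J. \<phi> f = 0) \<and> (\<forall>f\<in>dual s. \<phi> f = f v)"
  proof (rule functional_extension[OF ideal_subspace[OF J] dual_subspace])
    show "functional (\<lambda>f. f v)" unfolding functional_def by simp
    fix x assume x: "x \<in> J" "x \<in> dual s"
    then obtain a b where ab: "a \<in> I" "b \<in> S" "x = a + (l - 1) * b" unfolding J_def by blast
    obtain m1 a' where a': "\<And>e. a' e \<in> I \<inter> forms s e" "\<And>e. e \<ge> m1 \<Longrightarrow> a' e = 0" "a = (\<Sum>e<m1. a' e)"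
      using homogeneous_ideal_decomposition[OF hom ab(1)] by metis
    obtain m2 b' where b': "\<And>e. b' e \<in> forms s e" "\<And>e. e \<ge> m2 \<Longrightarrow> b' e = 0" "b = (\<Sum>e<m2. b' e)"
      using polys_decomposition[OF ab(2)] by metis
    define m where "m = Suc (max m1 m2)"
    \<comment> \<open>The degree \<open>e\<close> component of \<open>x - a - l * b + b\<close>,
      which is zero; hence each component is zero.\<close>
    define f where "f e = (if e = 1 then x else 0) - a' e - (if e = 0 then 0 else l * b' (e - 1)) + b' e" for e
    have f_forms: "f e \<in> forms s e" for e
    proof -
      have "(if e = 1 then x else 0) \<in> forms s e"
        using dual_forms[OF x(2)] F.subspace_0[OF forms_subspace] by simp
      moreover have "(if e = 0 then 0 else l * b' (e - 1)) \<in> forms s e"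
        using dual_mult_forms[OF l b'(1)] F.subspace_0[OF forms_subspace] by (cases e) simp_all
      moreover have "a' e \<in> forms s e" using a'(1) by blast
      ultimately show ?thesis unfolding f_def
        by (intro F.subspace_add[OF forms_subspace] F.subspace_diff[OF forms_subspace] b'(1))
    qed
    have "(\<Sum>e<Suc m. f e) = 0"
    proof -
      have "(\<Sum>e<Suc m. if e = 1 then x else 0) = x" unfolding m_def by (subst sum.delta) auto
      moreover have "(\<Sum>e<Suc m. a' e) = a"
        unfolding a'(3) using a'(2) by (intro sum.mono_neutral_right) (auto simp: m_def)
      moreover have "(\<Sum>e<Suc m. b' e) = b"
        unfolding b'(3) using b'(2) by (intro sum.mono_neutral_right) (auto simp: m_def)
      moreover have "(\<Sum>e<Suc m. if e = 0 then 0 else l * b' (e - 1)) = l * b"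
      proof -
        have "(\<Sum>e<m. b' e) = b"
          unfolding b'(3) using b'(2) by (intro sum.mono_neutral_right) (auto simp: m_def)
        then show ?thesis unfolding sum.lessThan_Suc_shift by (simp flip: sum_distrib_left)
      qed
      moreover have "x - a - l * b + b = 0"
        unfolding ab(3) by (simp add: algebra_simps)
      ultimately show ?thesis unfolding f_def sum.distrib sum_subtractf by (simp only:)
    qed
    then have f0: "f e = 0" if "e < Suc m" for e by (rule graded_independent[OF f_forms _ that])
    \<comment> \<open>Comparing degrees modulo \<open>I\<close>: \<open>b'\<close> starts at 0,
      receives \<open>- x\<close> in degree 1, and is multiplied by \<open>l\<close> at each later
      step. Since \<open>b'\<close> is eventually 0, a power of \<open>l\<close> times
      \<open>x\<close> lies in \<open>I\<close>.\<close>
    have key: "b' (Suc e) + l ^ e * x \<in> I" if "Suc e < Suc m" for e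
      using that
    proof (induction e)
      case 0
      have b0: "b' 0 \<in> I"
      proof -
        have "f 0 = 0" by (rule f0) simp
        then have "b' 0 = a' 0" unfolding f_def by (simp add: diff_eq_eq fun_eq_iff)
        then show ?thesis using a'(1)[of 0] by simp
      qed
      have "f 1 = 0" using 0 by (intro f0) simp
      then have "b' (Suc 0) + l ^ 0 * x = a' 1 + l * b' 0"
        unfolding f_def by (simp add: fun_eq_iff algebra_simps)
      moreover have "a' 1 + l * b' 0 \<in> I"
        using a'(1)[of 1] b0 by (intro ideal_add[OF I] ideal_mult[OF I dual_S[OF l]]) auto
      ultimately show ?case by (simp only:)
    next
      case (Suc e)
      have "f (Suc (Suc e)) = 0" using Suc.prems by (intro f0) simp
      then have "b' (Suc (Suc e)) = a' (Suc (Suc e)) + l * b' (Suc e)"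
        unfolding f_def by (simp add: fun_eq_iff algebra_simps)
      then have "b' (Suc (Suc e)) + l ^ Suc e * x = a' (Suc (Suc e)) + l * (b' (Suc e) + l ^ e * x)"
        by (simp only: power_Suc distrib_left mult.assoc add.assoc)
      moreover have "a' (Suc (Suc e)) + l * (b' (Suc e) + l ^ e * x) \<in> I"
      proof (rule ideal_add[OF I _ ideal_mult[OF I dual_S[OF l]]])
        show "a' (Suc (Suc e)) \<in> I" using a'(1) by blast
        show "b' (Suc e) + l ^ e * x \<in> I" by (rule Suc.IH) (use Suc.prems in simp)
      qed
      ultimately show ?case by (simp only:)
    qed
    have "b' m = 0" by (rule b'(2)) (simp add: m_def)
    moreover have "b' m + l ^ (m - 1) * x \<in> I" using key[of "m - 1"] by (simp add: m_def)
    ultimately have "l ^ (m - 1) * x \<in> I" by (simp only: add_0)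
    then have "x \<in> I" by (rule inj_power[OF dual_forms[OF x(2)]])
    then show "x v = 0" using v x(2) by blast
  qed
  ultimately show ?thesis using J IJ by blast
qed

end

section \<open>Comparison with the rank of a matrix\<close>

lemma rank_le_iff_factors:
  fixes A :: "'a::field mat"
  assumes A: "A \<in> carrier_mat m n"
  shows "vec_space.rank m A \<le> t \<longleftrightarrow> factors (\<lambda>i j. if i < m \<and> j < n then A $$ (i, j) else 0) t"
    (is "_ \<longleftrightarrow> factors ?A t")
proof
  assume rank: "vec_space.rank m A \<le> t"
  show "factors ?A t"
  proof (rule factors_if_minors_eq_0)
    fix \<rho> \<kappa>
    \<comment> \<open>An index out of range selects a zero row or column of the padded
      matrix.\<close>
    consider a where "a < Suc t" "\<not> \<rho> a < m" | a where "a < Suc t" "\<not> \<kappa> a < n"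
      | "\<And>a. a < Suc t \<Longrightarrow> \<rho> a < m \<and> \<kappa> a < n" by blast
    then show "minor ?A (Suc t) \<rho> \<kappa> = 0"
    proof cases
      case 1
      then show ?thesis by (intro minor_zero_row[of a]) auto
    next
      case 2
      then show ?thesis by (intro minor_zero_col[of a]) auto
    next
      case 3
      have "minor ?A (Suc t) \<rho> \<kappa> = minor (\<lambda>i j. A $$ (i, j)) (Suc t) \<rho> \<kappa>"
        by (rule minor_cong) (use 3 in auto)
      then show ?thesis using rank_ge_minor[OF A, of "Suc t" \<kappa> \<rho>] 3 rank by fastforce
    qed
  qed
next
  assume "factors ?A t"
  then obtain P Q where PQ: "\<And>i j. ?A i j = (\<Sum>s<t. P i s * Q s j)" unfolding factors_def by blast
  show "vec_space.rank m A \<le> t"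
  proof (rule rank_le_sum[OF A])
    show "A $$ (i, j) = (\<Sum>s<t. P i s * Q s j)" if "i < m" "j < n" for i j
      using PQ[of i j] that by simp
  qed
qed

text \<open>The entries of a matrix, extended by \<open>0\<close> so that index ranges need no mention.\<close>

definition entry :: "('w \<Rightarrow> 'a::field) mat \<Rightarrow> nat \<Rightarrow> nat \<Rightarrow> 'w \<Rightarrow> 'a" where
  "entry M i j w = (if i < dim_row M \<and> j < dim_col M then (M $$ (i, j)) w else 0)"

lemma rank_at_le_iff: "rank_at M w \<le> t \<longleftrightarrow> factors (\<lambda>i j. entry M i j w) t"
proof -
  have "rank_at M w \<le> t \<longleftrightarrow> factors (\<lambda>i j. if i < dim_row M \<and> j < dim_col M
      then map_mat (\<lambda>l. l w) M $$ (i, j) else 0) t"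
    unfolding rank_at_def by (rule rank_le_iff_factors) simp
  also have "(\<lambda>i j. if i < dim_row M \<and> j < dim_col M then map_mat (\<lambda>l. l w) M $$ (i, j) else 0) =
      (\<lambda>i j. entry M i j w)"
    by (simp add: fun_eq_iff entry_def)
  finally show ?thesis .
qed

context poly_functions
begin

subsection \<open>Points and rank loci\<close>

definition point :: "'w \<Rightarrow> 'w set" where
  "point w = {u. \<exists>c. c \<noteq> 0 \<and> u = s c w}"

lemma in_point: "w \<in> point w"
  unfolding point_def by (auto intro!: exI[of _ 1])

lemma point_in_proj_space: "w \<noteq> 0 \<Longrightarrow> point w \<in> proj_space s"
  unfolding point_def proj_space_def quotient_def by auto

lemma proj_spaceE:
  assumes "P \<in> proj_space s"
  obtains w where "w \<noteq> 0" "P = point w"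
  using assms unfolding proj_space_def quotient_def point_def by auto

lemma proj_space_nonzero: "P \<in> proj_space s \<Longrightarrow> w \<in> P \<Longrightarrow> w \<noteq> 0"
  by (erule proj_spaceE) (auto simp: point_def)

lemma proj_space_nonempty: "P \<in> proj_space s \<Longrightarrow> \<exists>w. w \<in> P"
  by (erule proj_spaceE) (auto intro: in_point)

lemma topspace_zariski: "topspace (zariski s) = proj_space s"
proof -
  have "openin (zariski s) (proj_space s)"
    unfolding openin_zariski
  proof (intro exI[of _ "{\<lambda>w. 1}"] conjI)
    show "{\<lambda>w. 1} \<subseteq> homog s" using const_forms[of 1] forms_subset by blast
    show "proj_space s = proj_space s - zero_locus s {\<lambda>w. 1}"
      using proj_space_nonempty by (auto simp: zero_locus_def)
  qed
  then show ?thesis unfolding topspace_def openin_zariski by blast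
qed

lemma closedin_zero_locus: "G \<subseteq> homog s \<Longrightarrow> closedin (zariski s) (zero_locus s G)"
  unfolding closedin_def topspace_zariski openin_zariski by (auto simp: zero_locus_def)

lemma entry_dual:
  assumes "linear_form_matrix s M"
  shows "entry M i j \<in> dual s"
proof (cases "i < dim_row M \<and> j < dim_col M")
  case True
  then have "entry M i j = M $$ (i, j)" by (simp add: fun_eq_iff entry_def)
  moreover have "M $$ (i, j) \<in> elements_mat M"
    using True by (intro elements_matI[of M "dim_row M" "dim_col M" i j]) auto
  then have "M $$ (i, j) \<in> dual s" using assms unfolding linear_form_matrix_def by blast
  ultimately show ?thesis by (simp only:)
next
  case False
  then have "entry M i j = 0" by (auto simp: fun_eq_iff entry_def)
  then show ?thesis using F.subspace_0[OF dual_subspace] by (simp only:)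
qed

lemma minor_forms:
  assumes "\<And>i j. A i j \<in> dual s"
  shows "minor A t \<rho> \<kappa> \<in> forms s t"
proof (induction t arbitrary: \<rho>)
  case 0
  have "minor A 0 \<rho> \<kappa> = (\<lambda>w. 1)" by (simp add: fun_eq_iff)
  then show ?case by (simp only: const_forms)
next
  case (Suc t)
  have eq: "A (\<rho> a) (\<kappa> t) * ((-1) ^ (a + t) * m) = fscale ((-1) ^ (a + t)) (A (\<rho> a) (\<kappa> t) * m)" for a m
  proof -
    have "((-1) ^ n :: 'w \<Rightarrow> 'a) w = (-1) ^ n" for n w by (induction n) auto
    then show ?thesis by (simp add: fun_eq_iff mult.left_commute)
  qed
  show ?case unfolding minor_Suc eq
    by (intro F.subspace_sum[OF forms_subspace] F.subspace_scale[OF forms_subspace]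
        dual_mult_forms assms Suc)
qed

text \<open>The minors of size \<open>Suc t\<close> are forms of that degree and cut out the locus.
  Closedness is what allows passing to the closure in the cactus variety.\<close>

lemma closedin_rank_locus:
  assumes M: "linear_form_matrix s M"
  shows "closedin (zariski s) (rank_locus s M (int t))"
proof -
  let ?G = "{minor (entry M) (Suc t) \<rho> \<kappa> | \<rho> \<kappa>. True}"
  have "int (rank_at M w) \<le> int t \<longleftrightarrow> (\<forall>f\<in>?G. f w = 0)" for w
  proof -
    have "int (rank_at M w) \<le> int t \<longleftrightarrow> factors (\<lambda>i j. entry M i j w) t" by (simp add: rank_at_le_iff)
    also have "\<dots> \<longleftrightarrow> (\<forall>\<rho> \<kappa>. minor (\<lambda>i j. entry M i j w) (Suc t) \<rho> \<kappa> = 0)"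
      using factors_imp_minor_eq_0 factors_if_minors_eq_0 by blast
    also have "\<dots> \<longleftrightarrow> (\<forall>f\<in>?G. f w = 0)" unfolding minor_apply[symmetric] by blast
    finally show ?thesis .
  qed
  then have "rank_locus s M (int t) = zero_locus s ?G"
    unfolding rank_locus_def zero_locus_def by blast
  moreover have "?G \<subseteq> homog s" using minor_forms[of "entry M", OF entry_dual[OF M]] forms_subset by blast
  ultimately show ?thesis by (simp only: closedin_zero_locus)
qed

lemma smooth_at_imp_smooth_point:
  assumes "smooth_at s X P" "p \<in> P"
  shows "smooth_point (\<Union>X) p"
proof -
  have van: "vanishing_ideal s X = {f \<in> S. \<forall>w\<in>\<Union>X. f w = 0}"
    unfolding vanishing_ideal_def by blast
  obtain c :: nat and f h where "h \<in> homog s" "\<forall>i<c. f i \<in> vanishing_ideal s X \<inter> homog s"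
    "\<forall>w\<in>P. h w \<noteq> 0"
    "\<forall>g\<in>vanishing_ideal s X. \<exists>a. (\<forall>i<c. a i \<in> S) \<and> h * g = (\<Sum>i<c. a i * f i)"
    "\<forall>w\<in>P. \<forall>b. (\<forall>v. (\<Sum>i<c. b i * differential s (f i) w v) = 0) \<longrightarrow> (\<forall>i<c. b i = 0)"
    using assms(1) unfolding smooth_at_def by blast
  moreover from this have "h \<in> S" using homog_subset by blast
  ultimately show ?thesis
    using assms(2) unfolding smooth_point_def van
    by (intro exI[of _ c] exI[of _ f] bexI[of _ h] conjI) simp_all
qed

text \<open>A homogeneous ideal contains the components of its members, so vanishing at one
  representative passes to its multiples.\<close>

lemma homogeneous_ideal_zero_point:
  assumes hom: "homogeneous_ideal s I" and p: "p \<noteq> 0" "\<And>f. f \<in> I \<Longrightarrow> f p = 0"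
  shows "point p \<in> zero_locus s I"
proof -
  have "f w = 0" if f: "f \<in> I" and w: "w \<in> point p" for f w
  proof -
    obtain c where c: "w = s c p" using w unfolding point_def by blast
    obtain m b where b: "\<forall>e. b e \<in> I \<inter> forms s e" "f = (\<Sum>e<m. b e)"
      using homogeneous_ideal_decomposition[OF hom f] by blast
    have "b e w = 0" for e
      using b(1) p(2)[of "b e"] forms_scale[of "b e" s e c p] unfolding c by auto
    then show ?thesis unfolding b(2) by (simp add: sum_fun_apply)
  qed
  then show ?thesis using point_in_proj_space[OF p(1)] unfolding zero_locus_def by blast
qed

text \<open>The zeros of the dehomogenized ideal are nonzero vectors, hence represent support points
  of the scheme, which are smooth points of \<open>X\<close>. On the linear entries of
  \<open>M\<close> the functional is evaluation at \<open>v\<close>, so the affine bound is a bound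
  for the rank at \<open>v\<close>.\<close>

lemma linear_span_subset_rank_locus:
  assumes M: "linear_form_matrix s M" and X: "X \<subseteq> rank_locus s M (int k)"
    and I: "finite_subscheme s r (smooth_locus s X) I"
  shows "linear_span s I \<subseteq> rank_locus s M (int (k * r))"
proof
  fix P assume P: "P \<in> linear_span s I"
  obtain N where hom: "homogeneous_ideal s I" and sat: "saturated s I"
    and van: "vanishing_ideal s (smooth_locus s X) \<subseteq> I"
    and supp: "zero_locus s I \<subseteq> smooth_locus s X"
    and dim: "\<And>d. N \<le> d \<Longrightarrow> F.dim (forms s d) = F.dim (I \<inter> forms s d) + r"
    using I unfolding finite_subscheme_def by blast
  have "rank_at M v \<le> k * r" if v: "v \<in> P" for v
  proof -
    have "l v = 0" if "l \<in> I \<inter> dual s" for l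
      using P v that unfolding linear_span_def zero_locus_def by blast
    then obtain J \<phi> where J: "poly_ideal J" "I \<subseteq> J" "0 \<notin> zeros J" "codim_le J r"
      and \<phi>: "functional \<phi>" "\<forall>f\<in>J. \<phi> f = 0" "\<forall>l\<in>dual s. \<phi> l = l v"
      using finite_scheme_dehomogenization[where v = v, OF hom sat dim] by blast
    have "factors (\<lambda>i j. \<phi> (entry M i j)) (k * r)"
    proof (rule affine_rank_bound[where Z = "\<Union>X" and M = "entry M", OF entry_dual[OF M] _ J(1) _ _ \<phi>(1,2) J(4)])
      fix q \<rho> \<kappa> assume "q \<in> \<Union>X"
      then have "rank_at M q \<le> k" using X unfolding rank_locus_def by auto
      then show "minor (\<lambda>i j. entry M i j q) (Suc k) \<rho> \<kappa> = 0"
        unfolding rank_at_le_iff by (rule factors_imp_minor_eq_0)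
    next
      have "smooth_locus s X \<subseteq> X" unfolding smooth_locus_def by blast
      then show "{g \<in> S. \<forall>w\<in>\<Union>X. g w = 0} \<subseteq> J"
        using van J(2) unfolding vanishing_ideal_def by blast
    next
      fix p assume p: "p \<in> zeros J"
      then have "p \<noteq> 0" using J(3) by metis
      then have "point p \<in> zero_locus s I"
        using p J(2) unfolding zeros_def by (intro homogeneous_ideal_zero_point[OF hom]) auto
      then have "point p \<in> X" "smooth_at s X (point p)" using supp unfolding smooth_locus_def by auto
      then show "p \<in> \<Union>X \<and> smooth_point (\<Union>X) p"
        using in_point smooth_at_imp_smooth_point by blast
    qed
    moreover have "\<phi> (entry M i j) = entry M i j v" for i j using \<phi>(3) entry_dual[OF M] by blast
    ultimately show ?thesis by (simp add: rank_at_le_iff)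
  qed
  moreover have "P \<in> proj_space s" using P unfolding linear_span_def zero_locus_def by blast
  ultimately show "P \<in> rank_locus s M (int (k * r))"
    unfolding rank_locus_def by (simp add: nat_int_comparison(3))
qed

text \<open>Minor sizes are natural numbers, so \<open>k\<close> must be seen to be nonnegative:
  \<open>X\<close> spans a nonempty space, hence has a point, and ranks are nonnegative. The rank
  locus being closed, it suffices to treat the span of a single scheme.\<close>

lemma cactus_variety_subset_rank_locus:
  assumes M: "linear_form_matrix s M" and X: "X \<subseteq> rank_locus s M k"
    and span: "linear_span s (vanishing_ideal s X) = proj_space s"
  shows "cactus_variety s r (smooth_locus s X) \<subseteq> rank_locus s M (k * int r)"
proof (cases "proj_space s = {}")
  case True
  then show ?thesis
    using closure_of_subset_topspace[of "zariski s"] unfolding cactus_variety_def topspace_zariski by blast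
next
  case False
  then obtain P w where P: "P \<in> proj_space s" "w \<in> P" using proj_space_nonempty by blast
  have "X \<noteq> {}"
  proof
    \<comment> \<open>All coordinates would vanish on the span, which then has no points.\<close>
    assume "X = {}"
    then have "coord b \<in> vanishing_ideal s X \<inter> dual s" for b
      unfolding vanishing_ideal_def using coord_dual dual_S by blast
    moreover have "P \<in> linear_span s (vanishing_ideal s X)" using span P(1) by blast
    ultimately have "coord b w = 0" for b
      using P(2) unfolding linear_span_def zero_locus_def by blast
    then have "w = 0" using sum_coord[of w] by simp
    with proj_space_nonzero[OF P] show False ..
  qed
  then obtain Q where Q: "Q \<in> X" by blast
  then have "Q \<in> rank_locus s M k" using X by blast
  then have "\<exists>u\<in>Q. int (rank_at M u) \<le> k" using proj_space_nonempty[of Q] unfolding rank_locus_def by blast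
  then have k: "k = int (nat k)" by auto
  have "linear_span s I \<subseteq> rank_locus s M (int (nat k * r))" if "finite_subscheme s r (smooth_locus s X) I" for I
    using X k by (intro linear_span_subset_rank_locus[OF M _ that]) simp
  then have "\<Union>{linear_span s I | I. finite_subscheme s r (smooth_locus s X) I} \<subseteq>
      rank_locus s M (int (nat k * r))" by blast
  then have "cactus_variety s r (smooth_locus s X) \<subseteq> rank_locus s M (int (nat k * r))"
    unfolding cactus_variety_def by (rule closure_of_minimal) (rule closedin_rank_locus[OF M])
  then show ?thesis using k by simp
qed

end

theorem theorem1p2:
  fixes s :: "'a::alg_closed_field \<Rightarrow> 'w::ab_group_add \<Rightarrow> 'w"
    and B :: "'w set"
    and X :: "'w set set"
  assumes "finite_dimensional_vector_space s B"
    and "locally_closed s X"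
    and "linear_span s (vanishing_ideal s X) = proj_space s"
  shows "(\<forall>(M :: ('w \<Rightarrow> 'a) mat) (k::int) (r::nat).
            linear_form_matrix s M \<longrightarrow> X \<subseteq> rank_locus s M k \<longrightarrow> r > 0 \<longrightarrow>
            cactus_variety s r (smooth_locus s X) \<subseteq> rank_locus s M (k * int r)) \<and>
         (\<forall>g::nat. g > 0 \<longrightarrow> cactus_variety s g (smooth_locus s X) = proj_space s \<longrightarrow>
            (\<forall>(M :: ('w \<Rightarrow> 'a) mat) (k::int) (F::'w).
               linear_form_matrix s M \<longrightarrow> k \<ge> 1 \<longrightarrow> X \<subseteq> rank_locus s M k \<longrightarrow>
               real (rank_at M F) / real_of_int k \<le> real g))"
proof -
  interpret poly_functions s B using assms(1) by (simp add: poly_functions_def)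
  have first: "cactus_variety s r (smooth_locus s X) \<subseteq> rank_locus s M (k * int r)"
    if "linear_form_matrix s M" "X \<subseteq> rank_locus s M k" for M k r
    using that assms(3) by (rule cactus_variety_subset_rank_locus)
  have "real (rank_at M F) / real_of_int k \<le> real g"
    if "cactus_variety s g (smooth_locus s X) = proj_space s" "linear_form_matrix s M" "k \<ge> 1"
      "X \<subseteq> rank_locus s M k" for g M k F
  proof -
    have "int (rank_at M F) \<le> k * int g"
    proof (cases "F = 0")
      \<comment> \<open>The zero vector represents no point of projective space, so its rank is
        computed directly.\<close>
      case True
      have "rank_at M 0 \<le> 0"
        unfolding rank_at_le_iff by (rule factors_0) (simp add: entry_dual[OF that(2)] dual_0)
      then show ?thesis using True that(3) by simp
    next
      case False
      then have "point F \<in> rank_locus s M (k * int g)"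
        using first[OF that(2,4), of g] point_in_proj_space[OF False] unfolding that(1) by blast
      then show ?thesis using in_point[of F] unfolding rank_locus_def by blast
    qed
    then have "real (rank_at M F) \<le> real_of_int k * real g"
      by (metis of_int_le_iff of_int_mult of_int_of_nat_eq)
    then show ?thesis using that(3) by (simp add: divide_le_eq mult.commute)
  qed
  with first show ?thesis by blast
qed

end
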